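(* Let $d\geq 3$ be an integer and let $\psi:\mathbb{N}\to[0,\infty)$ be a non-increasing function such that $\sum_{q\in\mathbb{N}}\psi(q)^d$ diverges. For $x\in\mathbb{R}$, let $F(x)$ denote the statement: for Lebesgue-almost every $(x_2,\dots,x_d)\in\mathbb{R}^{d-1}$ one has $(x,x_2,\dots,x_d)\in\mathcal{W}_d(\psi)$. Then $F(x)$ holds for: (a) every $x\in\mathbb{Q}$ (and this part also holds when $d=2$); (b) every $x\in\mathbb{R}\setminus\mathbb{Q}$ with the positive density property. The irrational numbers with the positive density property include: - every irrational $x\notin\mathcal{W}_1(\varphi)$, where $\varphi=\frac{1+\sqrt5}{2}$; - every irrational $x\notin\mathcal{W}_1(2)$ for which there exists $R\ge1$ such that $q_{k_m}\ge 2q_{k_{m-1}+1}$ for all but finitely many $m$ (i.e. eventually, whenever a partial quotient of $x$ exceeds $R$, the continuants at least double before the next partial quotient exceeding $R$); (c) uncountably many numbers $x$ of any Diophantine type; that is, for every $\sigma\in[1,\infty]$ there are uncountably many $x\in\mathbb{R}$ of Diophantine type $\sigma$ for which $F(x)$ holds.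
   Context: For $\psi:\mathbb{N}\to[0,\infty)$, $\mathcal{W}_d(\psi)$ is the set of $\boldsymbol{x}\in\mathbb{R}^d$ such that $\|q\boldsymbol{x}-\boldsymbol{p}\|_\infty<\psi(q)$ holds for infinitely many $(\boldsymbol{p},q)\in\mathbb{Z}^d\times\mathbb{N}$. For $\tau>0$ write $\mathcal{W}_1(\tau)=\mathcal{W}_1(q\mapsto q^{-\tau})$. The Diophantine type of $x\in\mathbb{R}$ is the supremum (in $(0,\infty]$) of all $\tau>0$ with $x\in\mathcal{W}_1(\tau)$. For irrational $x=[a_0;a_1,a_2,\dots]$ (simple continued fraction, with partial quotients $a_k$), the continuants are $q_{-1}=0$, $q_0=1$, $q_k=a_kq_{k-1}+q_{k-2}$. Given an integer $R\ge1$, put $k_0=-1$ and let $k_1<k_2<\cdots$ be the (finite or infinite) increasing list of all indices $k\ge0$ with $a_{k+1}>R$. For $m\ge0$ define the block $B_{m+1}=[\,q_{k_m+1}-Rq_{k_m},\;q_{k_{m+1}}\,]\cap\mathbb{N}$; if the list ends with $k_t$, then $B_{t+1}=[\,q_{k_t+1}-Rq_{k_t},\infty)\cap\mathbb{N}$ is the last block. Let $\{L_n\}_{n\ge1}$ be the sequence obtained by concatenating the blocks $B_1,B_2,\dots$ (each in increasing order), and $\Sigma_n=L_1+\dots+L_n$. Let $\omega_0=0$, $\omega_m=|B_1|+\dots+|B_m|$ and $\alpha_m=\omega_{m-1}+1$, so $L_{\alpha_m}=\min B_m$ and $L_{\omega_m}=\max B_m$. The number $x$ has the positive density property if there is $R\ge1$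 such that $\limsup_{m\to\infty}L_{\alpha_m}/\Sigma_{\alpha_m}<1$. If the list $\{k_m\}$ is finite, conditions on $m\to\infty$ are vacuous and regarded as satisfied. *)

theory Defs
  imports "HOL-Analysis.Analysis"
begin

section \<open>Simultaneous approximation\<close>

text \<open>Vectors in \<open>\<real>\<^sup>d\<close> and \<open>\<int>\<^sup>d\<close> are extensional functions on the index set \<open>{1..d}\<close>;
  extensionality makes the pairs \<open>(p, q)\<close> countable without repetition. Since \<open>\<nat>\<close> means
  the positive integers, only the values \<open>\<psi> q\<close> with \<open>q \<ge> 1\<close> are used.\<close>

definition W :: "nat \<Rightarrow> (nat \<Rightarrow> real) \<Rightarrow> (nat \<Rightarrow> real) set" where
  "W d \<psi> = {x \<in> {1..d} \<rightarrow>\<^sub>E UNIV.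
     infinite {(p, q). p \<in> {1..d} \<rightarrow>\<^sub>E (UNIV :: int set) \<and> 1 \<le> q \<and>
       (MAX i\<in>{1..d}. \<bar>real q * x i - real_of_int (p i)\<bar>) < \<psi> q}}"

definition W1 :: "real \<Rightarrow> real set" where
  "W1 \<tau> = {x. (\<lambda>i\<in>{1}. x) \<in> W 1 (\<lambda>q. real q powr (- \<tau>))}"

definition dioph_type :: "real \<Rightarrow> ereal" where
  "dioph_type x = Sup {ereal \<tau> |\<tau>. 0 < \<tau> \<and> x \<in> W1 \<tau>}"

text \<open>For an extensional \<open>y\<close> on \<open>{2..d}\<close>, the vector \<open>(x, y\<^sub>2, \<dots>, y\<^sub>d)\<close> is \<open>y(1 := x)\<close>.\<close>

definition fibre_full :: "nat \<Rightarrow> (nat \<Rightarrow> real) \<Rightarrow> real \<Rightarrow> bool" where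
  "fibre_full d \<psi> x \<longleftrightarrow>
     (AE y in (\<Pi>\<^sub>M i\<in>{2..d}. (lborel :: real measure)). y(1 := x) \<in> W d \<psi>)"

section \<open>Continued fractions\<close>

text \<open>The notions below are meant for irrational \<open>x\<close>, for which no complete quotient is an
  integer.\<close>

primrec complete_quotient :: "real \<Rightarrow> nat \<Rightarrow> real" where
  "complete_quotient x 0 = x"
| "complete_quotient x (Suc n) = 1 / frac (complete_quotient x n)"

definition partial_quotient :: "real \<Rightarrow> nat \<Rightarrow> int" where
  "partial_quotient x n = \<lfloor>complete_quotient x n\<rfloor>"

text \<open>The shifted sequence \<open>continuant' x n = q\<^bsub>n-1\<^esub>\<close> gives the continuants \<open>q\<^sub>k\<close> for
  \<open>k \<ge> -1\<close>.\<close>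

fun continuant' :: "real \<Rightarrow> nat \<Rightarrow> int" where
  "continuant' x 0 = 0"
| "continuant' x (Suc 0) = 1"
| "continuant' x (Suc (Suc n)) =
     partial_quotient x (Suc n) * continuant' x (Suc n) + continuant' x n"

definition continuant :: "real \<Rightarrow> int \<Rightarrow> int" where
  "continuant x k = continuant' x (nat (k + 1))"

section \<open>Blocks and the positive density property\<close>

definition large_indices :: "real \<Rightarrow> int \<Rightarrow> nat set" where
  "large_indices x R = {k. partial_quotient x (k + 1) > R}"

text \<open>The index \<open>k\<^sub>m\<close>; when there are only \<open>t\<close> large indices it is meaningful only for
  \<open>m \<le> t\<close>.\<close>

definition large_index :: "real \<Rightarrow> int \<Rightarrow> nat \<Rightarrow> int" where
  "large_index x R m =
     (if m = 0 then -1 else int (enumerate (large_indices x R) (m - 1)))"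

definition block_start :: "real \<Rightarrow> int \<Rightarrow> nat \<Rightarrow> int" where
  "block_start x R m =
     continuant x (large_index x R (m - 1) + 1) - R * continuant x (large_index x R (m - 1))"

text \<open>The block \<open>B\<^sub>m\<close>, for \<open>m \<ge> 1\<close>. When there are only \<open>t\<close> large indices, the block of
  number \<open>t + 1\<close> is unbounded and is the last one; index \<open>0\<close> and the later indices get the
  empty set.\<close>

definition block :: "real \<Rightarrow> int \<Rightarrow> nat \<Rightarrow> nat set" where
  "block x R m =
     (if m = 0 \<or> finite (large_indices x R) \<and> card (large_indices x R) + 1 < m then {}
      else if finite (large_indices x R) \<and> m = card (large_indices x R) + 1
        then {n. block_start x R m \<le> int n}
      else {n. block_start x R m \<le> int n \<and> int n \<le> continuant x (large_index x R m)})"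

definition block_end_pos :: "real \<Rightarrow> int \<Rightarrow> nat \<Rightarrow> nat" where
  "block_end_pos x R m = (\<Sum>i=1..m. card (block x R i))"

definition block_start_pos :: "real \<Rightarrow> int \<Rightarrow> nat \<Rightarrow> nat" where
  "block_start_pos x R m = block_end_pos x R (m - 1) + 1"

text \<open>The number of the block that contributes the term at position \<open>n \<ge> 1\<close> of the
  concatenation. An infinite block absorbs all remaining positions.\<close>

definition block_at :: "real \<Rightarrow> int \<Rightarrow> nat \<Rightarrow> nat" where
  "block_at x R n = (LEAST m. infinite (block x R m) \<or> n \<le> block_end_pos x R m)"

definition concat_blocks :: "real \<Rightarrow> int \<Rightarrow> nat \<Rightarrow> nat" where
  "concat_blocks x R n =
     enumerate (block x R (block_at x R n)) (n - block_start_pos x R (block_at x R n))"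

definition concat_sum :: "real \<Rightarrow> int \<Rightarrow> nat \<Rightarrow> nat" where
  "concat_sum x R n = (\<Sum>i=1..n. concat_blocks x R i)"

definition positive_density :: "real \<Rightarrow> bool" where
  "positive_density x \<longleftrightarrow> (\<exists>R\<ge>1. finite (large_indices x R) \<or>
     limsup (\<lambda>m. ereal (real (concat_blocks x R (block_start_pos x R m)) /
                        real (concat_sum x R (block_start_pos x R m)))) < 1)"

definition doubling :: "real \<Rightarrow> bool" where
  "doubling x \<longleftrightarrow> (\<exists>R\<ge>1. finite (large_indices x R) \<or>
     (\<forall>\<^sub>F m in sequentially.
        continuant x (large_index x R (Suc m)) \<ge> 2 * continuant x (large_index x R m + 1)))"

end

theory Submission
  imports Defs
begin

text \<open>In fact \<open>F(x)\<close> holds for every real \<open>x\<close> once \<open>d \<ge> 3\<close>. By the pigeonhole principle at least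
  \<open>N t / 2 - 1\<close> of the integers \<open>1 \<le> q \<le> N\<close> satisfy \<open>\<parallel>q x\<parallel> < t\<close>, whatever \<open>x\<close> is; summation by parts
  turns this into the divergence of the sum of \<open>\<psi>(q)\<^bsup>d-1\<^esup>\<close> over the \<open>q\<close> with \<open>\<parallel>q x\<parallel> < \<psi>(q)\<close>.
  The remaining \<open>d - 1 \<ge> 2\<close> coordinates are then handled by Gallagher's theorem, Khintchine's
  theorem in dimension at least two without monotonicity. There the approximating sets use only
  the numerators \<open>p\<close> with \<open>gcd(p\<^sub>1, \<dots>, p\<^sub>n, q) = 1\<close>: two such points with different denominators
  differ in some coordinate, which forces pairwise quasi-independence, and a second moment
  argument shows that no set of positive measure avoids almost all approximating sets.

  Positive density and the existence of many numbers of each Diophantine type are therefore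
  independent of \<open>\<psi>\<close> and concern continued fractions only.\<close>

section \<open>Divergence along a fibre\<close>

text \<open>The obstacle is the loss of monotonicity. Keeping only the q with |q x - p| < \<psi> q
  leaves a function supported on an irregular set, out of reach of the monotone form of Khintchine's
  theorem in the other coordinates. If n >= 2 of these remain, the numerator vectors sharing a
  factor e with q have proportion about e^(-n), and these proportions add up to less than 1 over e
  >= 2; primitive numerators therefore keep a fixed positive share for every q. In one coordinate
  that share is the totient ratio of q, which can be arbitrarily small; this is why d = 2 takes
  another route.

  A second moment bound by itself only shows that the limsup set has positive measure. Full measure
  comes from localising it: the lower bound has the same constant in every box, so it persists on a
  dyadic set E close to a hypothetical avoiding set F. Whatever the approximating sets cover in E
  would then lie in the small set E - F, and there they would overlap more than quasi-independence
  permits.\<close>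

lemma card_fract_close:
  fixes x t :: real
  assumes t: "0 < t" "t \<le> 1"
  shows "real N * t / 2 - 1 \<le> real (card {q \<in> {1..N}. \<exists>p::int. \<bar>real q * x - of_int p\<bar> < t})"
    (is "_ \<le> real (card ?S)")
proof -
  \<comment> \<open>The \<open>N + 1\<close> multiples j x with j <= N fall into \<open>K\<close>
    boxes of length 1/K <= t. Since t <= 1, also 1/t + 1 <= 2/t; this is the factor 1/2 in the
    claim.\<close>
  define K where "K = nat \<lceil>1 / t\<rceil>"
  have Kpos: "0 < K" using t by (simp add: K_def)
  have Kge: "1 / t \<le> real K" using t unfolding K_def by linarith
  have Kle: "real K \<le> 2 / t"
  proof -
    have "real K < 1 / t + 1" using t unfolding K_def by (simp add: of_nat_nat) linarith
    also have "\<dots> \<le> 2 / t" using t by (simp add: field_simps)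
    finally show ?thesis by simp
  qed
  define f where "f j = nat \<lfloor>frac (real j * x) * real K\<rfloor>" for j :: nat
  have f_lt: "f j < K" for j
  proof -
    have "frac (real j * x) * real K < 1 * real K"
      using Kpos frac_lt_1 by (intro mult_strict_right_mono) auto
    then show ?thesis unfolding f_def using Kpos by (simp add: nat_less_iff floor_less_iff)
  qed
  define Z where "Z z = {j \<in> {0..N}. f j = z}" for z
  have "\<exists>z<K. real (N + 1) / real K \<le> real (card (Z z))"
  proof (rule ccontr)
    assume "\<not> ?thesis"
    then have neg: "\<And>z. z < K \<Longrightarrow> real (card (Z z)) < real (N + 1) / real K" by force
    have "{0..N} \<subseteq> (\<Union>z\<in>{..<K}. Z z)" using f_lt by (auto simp: Z_def)
    then have "card {0..N} \<le> card (\<Union>z\<in>{..<K}. Z z)"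
      by (rule card_mono[rotated]) (auto simp: Z_def)
    also have "\<dots> \<le> (\<Sum>z<K. card (Z z))" by (rule card_UN_le) simp
    finally have "real (N + 1) \<le> (\<Sum>z<K. real (card (Z z)))"
      by (simp flip: of_nat_sum)
    also have "\<dots> < (\<Sum>z<K. real (N + 1) / real K)"
      using neg Kpos by (intro sum_strict_mono) (auto simp: lessThan_empty_iff)
    also have "\<dots> = real (N + 1)" using Kpos by simp
    finally show False by simp
  qed
  then obtain z where z: "z < K" "real (N + 1) / real K \<le> real (card (Z z))" by blast
  have fin: "finite (Z z)" by (simp add: Z_def)
  have "0 < real (card (Z z))" using z(2) Kpos by (smt (verit) divide_pos_pos of_nat_0_less_iff zero_less_Suc Suc_eq_plus1)
  then have ne: "Z z \<noteq> {}" by auto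
  define m where "m = Min (Z z)"
  have m: "m \<in> Z z" "\<And>j. j \<in> Z z \<Longrightarrow> m \<le> j" using fin ne by (auto simp: m_def)
  \<comment> \<open>Differences with the smallest index \<open>m\<close> of the box are good
    denominators; losing \<open>m\<close> itself costs the -1.\<close>
  have "(\<lambda>j. j - m) ` (Z z - {m}) \<subseteq> ?S"
  proof clarify
    fix j assume j: "j \<in> Z z" "j \<notin> {}" "j \<noteq> m"
    then have mj: "m < j" using m(2) by force
    have "f j = f m" using j m by (simp add: Z_def)
    then have "\<lfloor>frac (real j * x) * real K\<rfloor> = \<lfloor>frac (real m * x) * real K\<rfloor>"
      unfolding f_def by (simp add: nat_eq_iff2 split: if_splits)
    then have "\<bar>frac (real j * x) * real K - frac (real m * x) * real K\<bar> < 1" by linarith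
    then have "\<bar>frac (real j * x) - frac (real m * x)\<bar> * real K < 1"
      by (simp flip: left_diff_distrib add: abs_mult)
    then have "\<bar>frac (real j * x) - frac (real m * x)\<bar> < 1 / real K"
      using Kpos by (simp add: field_simps)
    also have "\<dots> \<le> t" using Kge Kpos t by (simp add: field_simps)
    finally have "\<bar>real (j - m) * x - of_int (\<lfloor>real j * x\<rfloor> - \<lfloor>real m * x\<rfloor>)\<bar> < t"
      using mj by (simp add: frac_def of_nat_diff algebra_simps)
    moreover have mj': "1 \<le> j - m" "j - m \<le> N" using mj j by (auto simp: Z_def)
    ultimately have "\<exists>p::int. \<bar>real (j - m) * x - of_int p\<bar> < t" by blast
    then show "j - m \<in> {1..N} \<and> (\<exists>p::int. \<bar>real (j - m) * x - of_int p\<bar> < t)"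
      using mj' by auto
  qed
  then have "card ((\<lambda>j. j - m) ` (Z z - {m})) \<le> card ?S" by (intro card_mono) auto
  moreover have "inj_on (\<lambda>j. j - m) (Z z - {m})"
    using m(2) by (intro inj_onI) (metis DiffD1 eq_diff_iff)
  ultimately have "card (Z z - {m}) \<le> card ?S" by (simp add: card_image)
  then have "card (Z z) - 1 \<le> card ?S" using m fin by simp
  moreover have "real N * t / 2 \<le> real (card (Z z))"
  proof -
    have "real N * t / 2 \<le> real (N + 1) * (t / 2)" using t by simp
    also have "\<dots> \<le> real (N + 1) * (1 / real K)"
      using Kle Kpos t by (intro mult_left_mono) (auto simp: field_simps)
    also have "\<dots> \<le> real (card (Z z))" using z by simp
    finally show ?thesis .
  qed
  ultimately show ?thesis by linarith
qed

text \<open>For v near u the ratio of the right side to u^(n+1) - v^(n+1) is about n/(n+1), which is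
  at least 1/2. After summation by parts this trades a decrement of the power n + 1 weighted by r
  for one of the power n weighted by r u, the order of the number of good denominators up to
  r.\<close>

lemma power_diff_ge_half:
  fixes u v :: real
  assumes "0 \<le> v" "v \<le> u" "1 \<le> n"
  shows "(u ^ Suc n - v ^ Suc n) / 2 \<le> u * (u ^ n - v ^ n)"
proof -
  obtain k where n: "n = Suc k" using assms(3) by (cases n) auto
  have "v ^ k \<le> u ^ k" using assms by (intro power_mono) auto
  then have "0 \<le> (u * u * (u ^ k - v ^ k) + (u - v) * (u - v) * v ^ k) / 2"
    using assms by simp
  also have "\<dots> = u * (u ^ n - v ^ n) - (u ^ Suc n - v ^ Suc n) / 2"
    by (simp add: n field_simps)
  finally show ?thesis by simp
qed

lemma summation_by_parts_count:
  fixes w :: "nat \<Rightarrow> real"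
  shows "(\<Sum>q=1..Q. if q \<in> S then w q else 0) =
    (\<Sum>r=1..Q. real (card (S \<inter> {1..r})) * (w r - w (Suc r))) + real (card (S \<inter> {1..Q})) * w (Suc Q)"
proof (induction Q)
  case (Suc Q)
  have "S \<inter> {1..Suc Q} = (if Suc Q \<in> S then insert (Suc Q) (S \<inter> {1..Q}) else S \<inter> {1..Q})"
    by (auto simp: le_Suc_eq)
  then have "card (S \<inter> {1..Suc Q}) = card (S \<inter> {1..Q}) + (if Suc Q \<in> S then 1 else 0)"
    by simp
  then show ?case using Suc by (auto simp: algebra_simps)
qed simp

text \<open>By \<open>cnt\<close> the set S has density at least of order \<open>u r\<close> up to
  r, so the sum of u^n over S should dominate that of u * u^n over all q. Summation by parts makes
  this rigorous, because it sees S only through its counting function.\<close>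

lemma not_summable_restrict:
  fixes u :: "nat \<Rightarrow> real"
  assumes nonneg: "\<And>q. 1 \<le> q \<Longrightarrow> 0 \<le> u q"
    and anti: "\<And>q. 1 \<le> q \<Longrightarrow> u (Suc q) \<le> u q"
    and cnt: "\<And>r. 1 \<le> r \<Longrightarrow> real r * u r / 2 - 1 \<le> real (card (S \<inter> {1..r}))"
    and n: "1 \<le> n"
    and div: "\<not> summable (\<lambda>q. u q ^ Suc n)"
  shows "\<not> summable (\<lambda>q. if q \<in> S then u q ^ n else 0)"
proof
  let ?g = "\<lambda>q. if q \<in> S then u q ^ n else 0"
  assume sm: "summable ?g"
  have tele: "(\<Sum>r=1..Q. u r ^ n - u (Suc r) ^ n) = u 1 ^ n - u (Suc Q) ^ n" for Q
    by (induction Q) auto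
  \<comment> \<open>The 4 comes from two halves, one in \<open>cnt\<close> and one in
    \<open>power_diff_ge_half\<close>. The -1 in \<open>cnt\<close> multiplies decrements of u^n,
    which together with the boundary term telescope to \<open>u 1 ^ n\<close>.\<close>
  have bound: "(\<Sum>q=1..Q. u q ^ Suc n) \<le> 4 * ((\<Sum>q=1..Q. ?g q) + u 1 ^ n)" if Q: "1 \<le> Q" for Q
  proof -
    have parts: "(\<Sum>q=1..Q. u q ^ Suc n) =
        (\<Sum>r=1..Q. real r * (u r ^ Suc n - u (Suc r) ^ Suc n)) + real Q * u (Suc Q) ^ Suc n"
      using summation_by_parts_count[where S = UNIV and w = "\<lambda>q. u q ^ Suc n" and Q = Q] by simp
    have "(\<Sum>r=1..Q. real r * (u r ^ Suc n - u (Suc r) ^ Suc n)) / 4 - (u 1 ^ n - u (Suc Q) ^ n)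
        = (\<Sum>r=1..Q. real r / 2 * ((u r ^ Suc n - u (Suc r) ^ Suc n) / 2) - (u r ^ n - u (Suc r) ^ n))"
      unfolding tele[symmetric] sum_divide_distrib sum_subtractf[symmetric] by (rule sum.cong) auto
    also have "\<dots> \<le> (\<Sum>r=1..Q. real (card (S \<inter> {1..r})) * (u r ^ n - u (Suc r) ^ n))"
    proof (intro sum_mono)
      fix r assume "r \<in> {1..Q}"
      then have r: "1 \<le> r" by simp
      have d: "0 \<le> u r ^ n - u (Suc r) ^ n"
        using nonneg[of "Suc r"] anti[OF r] power_mono by fastforce
      have "real r / 2 * ((u r ^ Suc n - u (Suc r) ^ Suc n) / 2)
          \<le> real r / 2 * (u r * (u r ^ n - u (Suc r) ^ n))"
        using nonneg[of "Suc r"] anti[OF r] n by (intro mult_left_mono power_diff_ge_half) auto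
      moreover have "(real r * u r / 2 - 1) * (u r ^ n - u (Suc r) ^ n)
          \<le> real (card (S \<inter> {1..r})) * (u r ^ n - u (Suc r) ^ n)"
        using cnt[OF r] d by (rule mult_right_mono)
      moreover have "real r / 2 * (u r * (u r ^ n - u (Suc r) ^ n)) - (u r ^ n - u (Suc r) ^ n)
          = (real r * u r / 2 - 1) * (u r ^ n - u (Suc r) ^ n)"
        by (simp add: algebra_simps)
      ultimately show "real r / 2 * ((u r ^ Suc n - u (Suc r) ^ Suc n) / 2) - (u r ^ n - u (Suc r) ^ n)
         \<le> real (card (S \<inter> {1..r})) * (u r ^ n - u (Suc r) ^ n)"
        by linarith
    qed
    finally have 1: "(\<Sum>r=1..Q. real r * (u r ^ Suc n - u (Suc r) ^ Suc n)) / 4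
        - (u 1 ^ n - u (Suc Q) ^ n) \<le> \<dots>" .
    have "(real Q * u (Suc Q) / 2 - 1) * u (Suc Q) ^ n \<le> (real Q * u Q / 2 - 1) * u (Suc Q) ^ n"
      using nonneg[of "Suc Q"] anti[OF Q] by (intro mult_right_mono) (auto intro: mult_left_mono)
    also have "\<dots> \<le> real (card (S \<inter> {1..Q})) * u (Suc Q) ^ n"
      using cnt[OF Q] nonneg[of "Suc Q"] by (intro mult_right_mono) auto
    finally have 2: "real Q * u (Suc Q) ^ Suc n / 2 - u (Suc Q) ^ n
        \<le> real (card (S \<inter> {1..Q})) * u (Suc Q) ^ n"
      by (simp add: algebra_simps)
    have "0 \<le> real Q * u (Suc Q) ^ Suc n" using nonneg[of "Suc Q"] by simp
    then show ?thesis
      using 1 2 parts summation_by_parts_count[where S = S and w = "\<lambda>q. u q ^ n" and Q = Q]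
      by simp
  qed
  \<comment> \<open>The shift to \<open>Suc q\<close> is there because the hypotheses say nothing
    about \<open>u 0\<close>.\<close>
  have "(\<Sum>q\<le>Q. norm (u (Suc q) ^ Suc n)) \<le> 4 * ((\<Sum>q. norm (?g q)) + u 1 ^ n)" for Q
  proof -
    have "(\<Sum>q\<le>Q. norm (u (Suc q) ^ Suc n)) = (\<Sum>q\<le>Q. u (Suc q) ^ Suc n)"
      using nonneg by (intro sum.cong) auto
    also have "\<dots> = (\<Sum>q=1..Suc Q. u q ^ Suc n)"
      by (simp only: sum.atLeast1_atMost_eq One_nat_def lessThan_Suc_atMost)
    also have "\<dots> \<le> 4 * ((\<Sum>q=1..Suc Q. ?g q) + u 1 ^ n)" by (rule bound) simp
    also have "(\<Sum>q=1..Suc Q. ?g q) = (\<Sum>q=1..Suc Q. norm (?g q))"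
      using nonneg by (intro sum.cong) auto
    also have "\<dots> \<le> (\<Sum>q. norm (?g q))"
    proof (rule sum_le_suminf)
      have "summable (\<lambda>q. ?g (Suc q))" using summable_Suc_iff[of ?g] sm by simp
      moreover have "(\<lambda>q. ?g (Suc q)) = (\<lambda>q. norm (?g (Suc q)))"
        using nonneg by (auto simp: fun_eq_iff)
      ultimately have "summable (\<lambda>q. norm (?g (Suc q)))" by (simp only:)
      then show "summable (\<lambda>q. norm (?g q))" using summable_Suc_iff[of "\<lambda>q. norm (?g q)"] by (simp only:)
    qed auto
    finally show ?thesis by simp
  qed
  then have "summable (\<lambda>q. norm (u (Suc q) ^ Suc n))"
    by (intro bounded_imp_summable) auto
  then have "summable (\<lambda>q. u (Suc q) ^ Suc n)" by (rule summable_norm_cancel)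
  then have "summable (\<lambda>q. u q ^ Suc n)"
    using summable_Suc_iff[of "\<lambda>q. u q ^ Suc n"] by (simp only:)
  then show False using div by simp
qed

section \<open>Overlaps of the approximating sets\<close>

lemma card_int_abs_less:
  fixes y :: real
  assumes "0 \<le> y"
  shows "finite {k::int. \<bar>real_of_int k\<bar> < y}" "real (card {k::int. \<bar>real_of_int k\<bar> < y}) \<le> 2 * y + 1"
proof -
  have sub: "{k::int. \<bar>real_of_int k\<bar> < y} \<subseteq> {-\<lfloor>y\<rfloor>..\<lfloor>y\<rfloor>}"
  proof
    fix k :: int assume "k \<in> {k. \<bar>real_of_int k\<bar> < y}"
    then have "real_of_int k < y" "real_of_int (- k) < y" by auto
    then have "k \<le> \<lfloor>y\<rfloor>" "- k \<le> \<lfloor>y\<rfloor>" by linarith+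
    then show "k \<in> {-\<lfloor>y\<rfloor>..\<lfloor>y\<rfloor>}" by simp
  qed
  then show "finite {k::int. \<bar>real_of_int k\<bar> < y}" by (rule finite_subset) simp
  have "card {k::int. \<bar>real_of_int k\<bar> < y} \<le> card {-\<lfloor>y\<rfloor>..\<lfloor>y\<rfloor>}" by (rule card_mono[OF _ sub]) simp
  also have "\<dots> = nat (2 * \<lfloor>y\<rfloor> + 1)" by simp
  finally have "card {k::int. \<bar>real_of_int k\<bar> < y} \<le> nat (2 * \<lfloor>y\<rfloor> + 1)" .
  then show "real (card {k::int. \<bar>real_of_int k\<bar> < y}) \<le> 2 * y + 1"
    using assms by linarith
qed

text \<open>For a given value of \<open>a r - b q\<close> the first entry \<open>a\<close> is confined to one residue class modulo
  \<open>q / gcd q r\<close>, so the pair is determined by that value and the quotient of \<open>a\<close> by \<open>q / gcd q r\<close>.\<close>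

lemma card_near_pairs:
  fixes q r K :: nat and D :: real
  assumes q: "1 \<le> q" and r: "1 \<le> r" and D: "real (gcd q r) < D"
  defines "T \<equiv> {(a :: int, b :: int). a \<in> {- int (K * q)..<int (K * q)} \<and>
    \<bar>real_of_int (a * int r - b * int q)\<bar> < D}"
  shows "finite T" "real (card T) \<le> 6 * real K * D"
proof -
  define g where "g = gcd q r"
  have g: "0 < g" using q by (simp add: g_def)
  obtain q' where q': "q = g * q'" unfolding g_def by (metis dvd_def gcd_dvd1)
  obtain r' where r': "r = g * r'" unfolding g_def by (metis dvd_def gcd_dvd2)
  have pos: "0 < q'" "0 < r'" using q r q' r' by (auto intro: Nat.gr0I)
  have cop: "coprime (int q') (int r')"
  proof -
    have "g * gcd q' r' = g" using q' r' by (metis g_def gcd_mult_distrib_nat)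
    then show ?thesis using g by (simp add: coprime_iff_gcd_eq_1)
  qed
  define f where "f = (\<lambda>(a, b). (a * int r' - b * int q', a div int q'))"
  have inj: "inj_on f T"
  proof (rule inj_onI, clarsimp simp: f_def)
    fix a b a' b' :: int
    assume e: "a * int r' - b * int q' = a' * int r' - b' * int q'" "a div int q' = a' div int q'"
    have "(a - a') * int r' = (b - b') * int q'" using e(1) by (simp add: algebra_simps)
    then have "int q' dvd (a - a') * int r'" by simp
    then have "int q' dvd a - a'" using cop by (simp add: coprime_dvd_mult_left_iff)
    then have "a mod int q' = a' mod int q'" by (simp add: mod_eq_dvd_iff)
    then have "a = a'" using e(2) by (metis mult_div_mod_eq)
    then show "a = a' \<and> b = b'" using e(1) pos by simp
  qed
  have img: "f ` T \<subseteq> {k. \<bar>real_of_int k\<bar> < D / real g} \<times> {- int (K * g)..<int (K * g)}"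
  proof (clarsimp simp: f_def T_def)
    fix a b :: int
    assume a: "- (int K * int q) \<le> a" "a < int K * int q"
      and b: "\<bar>real_of_int a * real r - real_of_int b * real q\<bar> < D"
    have "real_of_int a * real r - real_of_int b * real q
        = real g * (real_of_int a * real r' - real_of_int b * real q')"
      unfolding q' r' by (simp add: algebra_simps)
    then have "real g * \<bar>real_of_int a * real r' - real_of_int b * real q'\<bar>
        = \<bar>real_of_int a * real r - real_of_int b * real q\<bar>"
      by (simp add: abs_mult)
    then have "\<bar>real_of_int a * real r' - real_of_int b * real q'\<bar> < D / real g"
      using b g by (simp add: field_simps)
    moreover have "- (int K * int g) \<le> a div int q'"
    proof -
      have "(- (int K * int g)) * int q' \<le> a" using a(1) unfolding q' by (simp add: algebra_simps)
      then have "((- (int K * int g)) * int q') div int q' \<le> a div int q'"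
        using pos by (intro zdiv_mono1) auto
      then show ?thesis using pos by (metis int_ops(1) less_irrefl nonzero_mult_div_cancel_right of_nat_0_less_iff)
    qed
    moreover have "a div int q' < int K * int g"
    proof (rule ccontr)
      assume "\<not> ?thesis"
      then have "int K * int g * int q' \<le> a div int q' * int q'" by (intro mult_right_mono) auto
      also have "\<dots> \<le> a" using pos by (simp add: minus_mod_eq_div_mult[symmetric])
      finally show False using a(2) unfolding q' by simp
    qed
    ultimately show "\<bar>real_of_int a * real r' - real_of_int b * real q'\<bar> < D / real g \<and>
        - (int K * int g) \<le> a div int q' \<and> a div int q' < int K * int g" by blast
  qed
  \<comment> \<open>This turns the count 2 y + 1 into at most 3 y. With the 2 K g possible quotients
    the constant is 6, and g cancels.\<close>
  have y: "1 < D / real g" using D g by (simp add: g_def)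
  have fin: "finite ({k. \<bar>real_of_int k\<bar> < D / real g} \<times> {- int (K * g)..<int (K * g)})"
    using y by (intro finite_cartesian_product card_int_abs_less) auto
  show "finite T" using inj img fin by (metis finite_imageD finite_subset)
  have "card T \<le> card ({k. \<bar>real_of_int k\<bar> < D / real g} \<times> {- int (K * g)..<int (K * g)})"
    using inj img fin by (rule card_inj_on_le)
  also have "\<dots> = card {k. \<bar>real_of_int k\<bar> < D / real g} * (2 * K * g)"
    by (simp add: card_cartesian_product nat_mult_distrib)
  finally have "real (card T) \<le> real (card {k. \<bar>real_of_int k\<bar> < D / real g}) * real (2 * K * g)"
    by (simp flip: of_nat_mult)
  also have "\<dots> \<le> (3 * (D / real g)) * real (2 * K * g)"
    using card_int_abs_less(2)[of "D / real g"] y by (intro mult_right_mono) auto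
  also have "\<dots> = 6 * real K * D" using g by simp
  finally show "real (card T) \<le> 6 * real K * D" .
qed

text \<open>The range places p/q in the cube with sides [-K, K), so the set is finite. Primitivity
  is joint in all coordinates and q, which is weaker than asking each p i to be coprime to q; that
  is what preserves a positive proportion of the numerators.\<close>

definition prim_points :: "'i set \<Rightarrow> nat \<Rightarrow> nat \<Rightarrow> ('i \<Rightarrow> int) set" where
  "prim_points I K q = {p \<in> I \<rightarrow>\<^sub>E {- int (K * q)..<int (K * q)}.
     \<forall>e::nat. e dvd q \<and> (\<forall>i\<in>I. int e dvd p i) \<longrightarrow> e = 1}"

definition nbhd :: "'i set \<Rightarrow> nat \<Rightarrow> real \<Rightarrow> ('i \<Rightarrow> int) \<Rightarrow> ('i \<Rightarrow> real) set" where
  "nbhd I q t p = (\<Pi>\<^sub>E i\<in>I. {(real_of_int (p i) - t) / real q <..< (real_of_int (p i) + t) / real q})"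

definition approx_set :: "'i set \<Rightarrow> nat \<Rightarrow> nat \<Rightarrow> real \<Rightarrow> ('i \<Rightarrow> real) set" where
  "approx_set I K q t = (\<Union>p\<in>prim_points I K q. nbhd I q t p)"

abbreviation leb :: "'i set \<Rightarrow> ('i \<Rightarrow> real) measure" where
  "leb I \<equiv> (\<Pi>\<^sub>M i\<in>I. lborel)"

lemma finite_prim_points: "finite I \<Longrightarrow> finite (prim_points I K q)"
  by (rule finite_subset[of _ "I \<rightarrow>\<^sub>E {- int (K * q)..<int (K * q)}"])
    (auto simp: prim_points_def intro!: finite_PiE)

lemma
  fixes I :: "'i set"
  assumes "finite I" "\<And>i. i \<in> I \<Longrightarrow> A i \<in> sets borel" 
  shows sets_leb_PiE: "Pi\<^sub>E I A \<in> sets (leb I)"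
    and emeasure_leb_PiE: "emeasure (leb I) (Pi\<^sub>E I A) = (\<Prod>i\<in>I. emeasure lborel (A i))"
    and measure_leb_PiE: "measure (leb I) (Pi\<^sub>E I A) = (\<Prod>i\<in>I. measure lborel (A i))"
proof -
  interpret product_sigma_finite "\<lambda>_::'i. lborel :: real measure" ..
  show "Pi\<^sub>E I A \<in> sets (leb I)" using assms by (intro sets_PiM_I_finite) auto
  show e: "emeasure (leb I) (Pi\<^sub>E I A) = (\<Prod>i\<in>I. emeasure lborel (A i))"
    using assms by (intro emeasure_PiM) auto
  have "enn2real (prod f J) = (\<Prod>i\<in>J. enn2real (f i))" if "finite J" for f :: "'i \<Rightarrow> ennreal" and J
    using that by induction (auto simp: enn2real_mult)
  then show "measure (leb I) (Pi\<^sub>E I A) = (\<Prod>i\<in>I. measure lborel (A i))"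
    using assms(1) by (simp add: measure_def e)
qed

lemma prim_points_extensional: "p \<in> prim_points I K q \<Longrightarrow> p \<in> extensional I"
  by (auto simp: prim_points_def PiE_iff)

lemma nbhd_sets: "finite I \<Longrightarrow> nbhd I q t p \<in> sets (leb I)"
  unfolding nbhd_def by (rule sets_leb_PiE) auto

lemma approx_set_sets: "finite I \<Longrightarrow> approx_set I K q t \<in> sets (leb I)"
  unfolding approx_set_def by (auto intro!: sets.finite_UN finite_prim_points nbhd_sets)

lemma measure_nbhd:
  assumes "finite I" "0 \<le> t" "1 \<le> q"
  shows "measure (leb I) (nbhd I q t p) = (2 * t / real q) ^ card I"
    and "emeasure (leb I) (nbhd I q t p) = ennreal ((2 * t / real q) ^ card I)"
proof -
  have l: "(real_of_int (p i) - t) / real q \<le> (real_of_int (p i) + t) / real q" for i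
    using assms by (intro divide_right_mono) auto
  have d: "(real_of_int (p i) + t) / real q - (real_of_int (p i) - t) / real q = 2 * t / real q" for i
    by (simp add: diff_divide_distrib[symmetric])
  show "measure (leb I) (nbhd I q t p) = (2 * t / real q) ^ card I"
    unfolding nbhd_def using assms l by (subst measure_leb_PiE) (auto simp: d)
  show "emeasure (leb I) (nbhd I q t p) = ennreal ((2 * t / real q) ^ card I)"
    unfolding nbhd_def using assms l by (subst emeasure_leb_PiE) (auto simp: d ennreal_power)
qed

text \<open>Two boxes can meet only if in every coordinate their centres are closer than t/q + s/r;
  multiplied by q r this is the condition with D. When they meet, the overlap is at most the smaller
  box, of side 2 m.\<close>

lemma measure_nbhd_Int_le:
  assumes "finite I" "0 \<le> t" "0 \<le> s" "1 \<le> q" "1 \<le> r"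
  defines "m \<equiv> min (t / real q) (s / real r)"
  defines "D \<equiv> t * real r + s * real q"
  shows "measure (leb I) (nbhd I q t p \<inter> nbhd I r s p') \<le> 
    (if \<forall>i\<in>I. \<bar>real_of_int (p i * int r - p' i * int q)\<bar> < D then (2 * m) ^ card I else 0)"
proof (cases "\<forall>i\<in>I. \<bar>real_of_int (p i * int r - p' i * int q)\<bar> < D")
  case True
  have "measure (leb I) (nbhd I q t p \<inter> nbhd I r s p') \<le> (2 * m) ^ card I"
  proof (cases "t / real q \<le> s / real r")
    case True
    have "measure (leb I) (nbhd I q t p \<inter> nbhd I r s p') \<le> measure (leb I) (nbhd I q t p)"
      using assms by (intro measure_mono_fmeasurable) (auto simp: fmeasurable_def nbhd_sets measure_nbhd)
    then show ?thesis using True assms by (simp add: measure_nbhd m_def min_def)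
  next
    case False
    have "measure (leb I) (nbhd I q t p \<inter> nbhd I r s p') \<le> measure (leb I) (nbhd I r s p')"
      using assms by (intro measure_mono_fmeasurable) (auto simp: fmeasurable_def nbhd_sets measure_nbhd)
    then show ?thesis using False assms by (simp add: measure_nbhd m_def min_def)
  qed
  with True show ?thesis by simp
next
  case False
  then obtain i where i: "i \<in> I" "D \<le> \<bar>real_of_int (p i * int r - p' i * int q)\<bar>" by force
  have "nbhd I q t p \<inter> nbhd I r s p' = {}"
  proof (rule ccontr)
    assume "\<not> ?thesis"
    then obtain y where "y \<in> nbhd I q t p" "y \<in> nbhd I r s p'" by auto
    then have y: "(real_of_int (p i) - t) / real q < y i" "y i < (real_of_int (p i) + t) / real q"
        "(real_of_int (p' i) - s) / real r < y i" "y i < (real_of_int (p' i) + s) / real r"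
      using i(1) by (auto simp: nbhd_def)
    have "(real_of_int (p i) - t) / real q < (real_of_int (p' i) + s) / real r"
      "(real_of_int (p' i) - s) / real r < (real_of_int (p i) + t) / real q"
      using y by linarith+
    then have "\<bar>real_of_int (p i * int r - p' i * int q)\<bar> < D"
      using assms(4,5) unfolding D_def by (simp add: field_simps abs_less_iff)
    then show False using i by simp
  qed
  then show ?thesis unfolding if_not_P[OF False] by simp
qed

text \<open>This is quasi-independence: t^n and s^n are the orders of the two measures. It holds for
  every pair q, r with no loss depending on their gcd, because \<open>card_near_pairs\<close> bounds
  the near pairs per coordinate by a multiple of D once D exceeds the gcd, and primitivity excludes
  near pairs otherwise.\<close>

lemma measure_approx_set_Int_le:
  assumes I: "finite I" and qr: "1 \<le> q" "1 \<le> r" "q \<noteq> r" and ts: "0 \<le> t" "0 \<le> s"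
  shows "measure (leb I) (approx_set I K q t \<inter> approx_set I K r s) \<le> (24 * real K * t * s) ^ card I"
proof -
  define m where "m = min (t / real q) (s / real r)"
  define D where "D = t * real r + s * real q"
  define P where "P = prim_points I K q \<times> prim_points I K r"
  define N where "N = (\<lambda>(p, p'). \<forall>i\<in>I. \<bar>real_of_int (p i * int r - p' i * int q)\<bar> < D)"
  have finP: "finite P" using I by (simp add: P_def finite_prim_points)
  have "approx_set I K q t \<inter> approx_set I K r s = (\<Union>(p, p')\<in>P. nbhd I q t p \<inter> nbhd I r s p')"
    by (auto simp: approx_set_def P_def)
  then have "measure (leb I) (approx_set I K q t \<inter> approx_set I K r s)
      \<le> (\<Sum>(p, p')\<in>P. measure (leb I) (nbhd I q t p \<inter> nbhd I r s p'))"
    using measure_UNION_le[OF finP, of "\<lambda>z. nbhd I q t (fst z) \<inter> nbhd I r s (snd z)" "leb I"] I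
    by (simp add: nbhd_sets case_prod_beta sets.Int)
  also have "\<dots> \<le> (\<Sum>z\<in>P. if N z then (2 * m) ^ card I else 0)"
    unfolding N_def m_def D_def case_prod_beta by (intro sum_mono measure_nbhd_Int_le[OF I ts qr(1,2)])
  also have "\<dots> = real (card {z \<in> P. N z}) * (2 * m) ^ card I"
    using finP by (simp add: sum.If_cases Int_def)
  also have "\<dots> \<le> (6 * real K * D) ^ card I * (2 * m) ^ card I"
  proof (intro mult_right_mono)
    show "0 \<le> (2 * m) ^ card I" using ts by (simp add: m_def)
    show "real (card {z \<in> P. N z}) \<le> (6 * real K * D) ^ card I"
    proof (cases "real (gcd q r) < D")
      case True
      define T where "T = {(a :: int, b :: int). a \<in> {- int (K * q)..<int (K * q)} \<and>
        \<bar>real_of_int (a * int r - b * int q)\<bar> < D}"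
      have T: "finite T" "real (card T) \<le> 6 * real K * D"
        using card_near_pairs[OF qr(1,2) True] by (auto simp: T_def)
      define f where "f = (\<lambda>(p, p'). \<lambda>i\<in>I. (p i :: int, p' i :: int))"
      have "inj_on f {z \<in> P. N z}"
      proof (rule inj_onI, clarsimp simp: f_def P_def)
        fix p1 p1' p2 p2'
        assume h: "p1 \<in> prim_points I K q" "p1' \<in> prim_points I K r"
          "p2 \<in> prim_points I K q" "p2' \<in> prim_points I K r"
          and e: "(\<lambda>i\<in>I. (p1 i, p1' i)) = (\<lambda>i\<in>I. (p2 i, p2' i))"
        have "p1 i = p2 i \<and> p1' i = p2' i" if "i \<in> I" for i
          using fun_cong[OF e, of i] that by simp
        then show "p1 = p2 \<and> p1' = p2'"
          using h by (auto intro!: extensionalityI prim_points_extensional)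
      qed
      moreover have "f ` {z \<in> P. N z} \<subseteq> I \<rightarrow>\<^sub>E T"
        by (auto simp: f_def P_def N_def T_def prim_points_def PiE_iff)
      ultimately have "card {z \<in> P. N z} \<le> card (I \<rightarrow>\<^sub>E T)"
        using I T by (intro card_inj_on_le[of f] finite_PiE) auto
      also have "\<dots> = card T ^ card I" using I by (simp add: card_PiE)
      finally have "real (card {z \<in> P. N z}) \<le> real (card T) ^ card I" by (simp flip: of_nat_power)
      also have "\<dots> \<le> (6 * real K * D) ^ card I" using T by (intro power_mono) auto
      finally show ?thesis .
    next
      case False
      \<comment> \<open>Each p i * r - p' i * q is a multiple of gcd q r and smaller than it in
        absolute value, hence zero. Then q' = q/gcd divides q and every p i, so primitivity forces
        q' = 1; likewise r' = 1, and q = r, a contradiction.\<close>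
      have "\<not> N z" if "z \<in> P" for z
      proof
        assume Nz: "N z"
        obtain p p' where z: "z = (p, p')" by (cases z)
        have p: "p \<in> prim_points I K q" "p' \<in> prim_points I K r" using that z by (auto simp: P_def)
        have eq: "p i * int r = p' i * int q" if i: "i \<in> I" for i
        proof (rule ccontr)
          assume "p i * int r \<noteq> p' i * int q"
          moreover have "int (gcd q r) dvd p i * int r - p' i * int q" by (simp add: dvd_diff)
          ultimately have "int (gcd q r) \<le> \<bar>p i * int r - p' i * int q\<bar>"
            by (metis abs_of_nat dvd_imp_le_int right_minus_eq)
          then have "real (gcd q r) \<le> \<bar>real_of_int (p i * int r - p' i * int q)\<bar>" by linarith
          then show False using Nz i False z by (auto simp: N_def)
        qed
        define g where "g = gcd q r"
        have g: "0 < g" using qr by (simp add: g_def)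
        obtain q' where q': "q = g * q'" unfolding g_def by (metis dvd_def gcd_dvd1)
        obtain r' where r': "r = g * r'" unfolding g_def by (metis dvd_def gcd_dvd2)
        have cop: "coprime (int q') (int r')"
        proof -
          have "g * gcd q' r' = g" using q' r' by (metis g_def gcd_mult_distrib_nat)
          then show ?thesis using g by (simp add: coprime_iff_gcd_eq_1)
        qed
        have eq': "p i * int r' = p' i * int q'" if "i \<in> I" for i
          using eq[OF that] g unfolding q' r' by (simp add: algebra_simps)
        have "\<forall>i\<in>I. int q' dvd p i"
          using eq' cop by (metis coprime_dvd_mult_left_iff dvd_triv_right)
        then have "q' = 1" using p(1) q' unfolding prim_points_def by (auto simp: dvd_def)
        moreover have "\<forall>i\<in>I. int r' dvd p' i"
          using eq' cop by (metis coprime_commute coprime_dvd_mult_left_iff dvd_triv_right)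
        then have "r' = 1" using p(2) r' unfolding prim_points_def by (auto simp: dvd_def)
        ultimately show False using qr(3) q' r' by simp
      qed
      then have "{z \<in> P. N z} = {}" by blast
      moreover have "0 \<le> D" using ts by (simp add: D_def)
      ultimately show ?thesis by (simp only: card.empty) simp
    qed
  qed
  also have "\<dots> = (12 * real K * (m * D)) ^ card I"
    unfolding power_mult_distrib[symmetric]
    by (rule arg_cong[where f = "\<lambda>x. x ^ card I"]) (simp add: algebra_simps)
  also have "\<dots> \<le> (24 * real K * t * s) ^ card I"
  proof (intro power_mono)
    \<comment> \<open>In each summand of m D the minimum is bounded by the term that cancels its
      denominator, so each is at most t s; the constant 12 thus becomes 24.\<close>
    have "m * (t * real r) \<le> s / real r * (t * real r)" using ts by (intro mult_right_mono) (auto simp: m_def)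
    moreover have "m * (s * real q) \<le> t / real q * (s * real q)" using ts by (intro mult_right_mono) (auto simp: m_def)
    ultimately have "m * D \<le> 2 * t * s" using qr by (simp add: D_def algebra_simps)
    then have "12 * real K * (m * D) \<le> 12 * real K * (2 * t * s)" by (intro mult_left_mono) auto
    then show "12 * real K * (m * D) \<le> 24 * real K * t * s" by simp
    show "0 \<le> 12 * real K * (m * D)" using ts by (simp add: m_def D_def)
  qed
  finally show ?thesis .
qed

section \<open>The approximating sets inside a box\<close>

text \<open>Telescoping after the first term 1/4. What matters is a bound below 1: this sum controls
  the share of non-primitive numerator vectors in dimension two and higher.\<close>

lemma sum_inverse_squares_le: "(\<Sum>e=2..q. 1 / (real e)\<^sup>2) \<le> 3 / 4"
proof -
  have "(\<Sum>e=2..q. 1 / (real e)\<^sup>2) \<le> 3 / 4 - 1 / real q" if "2 \<le> q"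
    using that
  proof (induction q rule: nat_induct_at_least)
    case (Suc q)
    have "1 / (real (Suc q))\<^sup>2 \<le> 1 / (real q * real (Suc q))"
      using Suc.hyps by (intro divide_left_mono) (auto simp: power2_eq_square)
    also have "\<dots> = 1 / real q - 1 / real (Suc q)" using Suc.hyps by (simp add: field_simps)
    finally show ?case using Suc by simp
  qed simp
  moreover have "0 \<le> 1 / real q" by simp
  ultimately have "2 \<le> q \<Longrightarrow> ?thesis" by linarith
  then show ?thesis by (cases "2 \<le> q") auto
qed

lemma card_multiples_le:
  fixes a b :: real and e :: nat
  assumes "a \<le> b" "1 \<le> e"
  shows "real (card {k::int. a \<le> k \<and> k \<le> b \<and> int e dvd k}) \<le> (b - a) / real e + 1"
proof -
  have "{k::int. a \<le> k \<and> k \<le> b \<and> int e dvd k} \<subseteq> (\<lambda>k. int e * k) ` {\<lceil>a / real e\<rceil>..\<lfloor>b / real e\<rfloor>}"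
  proof clarify
    fix k :: int assume k: "a \<le> k" "k \<le> b" "int e dvd k"
    then obtain c where c: "k = int e * c" by (auto simp: dvd_def)
    then have "a \<le> real e * real_of_int c" "real e * real_of_int c \<le> b" using k by auto
    then have "a / real e \<le> real_of_int c" "real_of_int c \<le> b / real e"
      using assms(2) by (auto simp: field_simps)
    then show "k \<in> (\<lambda>k. int e * k) ` {\<lceil>a / real e\<rceil>..\<lfloor>b / real e\<rfloor>}"
      using c by (auto simp: ceiling_le_iff le_floor_iff)
  qed
  then have "card {k::int. a \<le> k \<and> k \<le> b \<and> int e dvd k} \<le> card {\<lceil>a / real e\<rceil>..\<lfloor>b / real e\<rfloor>}"
    by (rule surj_card_le[rotated]) simp
  also have "real \<dots> \<le> b / real e - a / real e + 1"
  proof -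
    have "a / real e \<le> b / real e" using assms by (intro divide_right_mono) auto
    then show ?thesis by simp linarith
  qed
  finally show ?thesis by (simp add: diff_divide_distrib)
qed

lemma card_int_between_ge:
  fixes a b :: real
  shows "b - a - 1 \<le> real (card {k::int. a \<le> k \<and> k \<le> b})"
proof -
  have "{k::int. a \<le> k \<and> k \<le> b} = {\<lceil>a\<rceil>..\<lfloor>b\<rfloor>}" by (auto simp: ceiling_le_iff le_floor_iff)
  then show ?thesis by simp linarith
qed

lemma finite_int_between: "finite {k::int. (a::real) \<le> k \<and> k \<le> b \<and> P k}"
  by (rule finite_subset[of _ "{\<lceil>a\<rceil>..\<lfloor>b\<rfloor>}"]) (auto simp: ceiling_le_iff le_floor_iff)

text \<open>A sieve by union bound: a non-primitive point has a common divisor e in 2..q, and about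
  e^(-n) of the lattice points are divisible by e. The sizes required of q make the boundary errors
  small: at least 15/16 of the volume is counted in G and at most 14/16 is removed. The margin 1/2
  in G later keeps whole neighbourhoods inside the box.\<close>

lemma card_prim_ge:
  fixes u v :: "'i \<Rightarrow> real"
  assumes I: "finite I" "2 \<le> card I" and l: "0 < l" "\<And>i. i \<in> I \<Longrightarrow> l \<le> v i - u i"
    and q: "32 * real (card I) / l \<le> real q" "208 / l\<^sup>2 \<le> real q" "1 \<le> q"
  defines "G \<equiv> (\<Pi>\<^sub>E i\<in>I. {k::int. real q * u i + 1 / 2 \<le> k \<and> k \<le> real q * v i - 1 / 2})"
  shows "finite G"
    "(1 / 16) * (\<Prod>i\<in>I. real q * (v i - u i)) \<le>
      real (card {p \<in> G. \<forall>e::nat. e dvd q \<and> (\<forall>i\<in>I. int e dvd p i) \<longrightarrow> e = 1})"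
      (is "_ \<le> real (card ?H)")
proof -
  define n where "n = card I"
  define t where "t = real q * l"
  define L where "L i = real q * (v i - u i)" for i
  have L: "t \<le> L i" if "i \<in> I" for i using l that by (auto simp: t_def L_def intro!: mult_left_mono)
  have nt: "32 * real n \<le> t" using q l by (simp add: t_def n_def field_simps)
  have n2: "2 \<le> n" using I by (simp add: n_def)
  have t64: "64 \<le> t" using nt n2 by linarith
  have Lpos: "0 < L i" if "i \<in> I" for i using L[OF that] t64 by linarith
  show finG: "finite G" unfolding G_def using I finite_int_between[where P = "\<lambda>_. True"]
    by (intro finite_PiE) auto
  have cG: "(\<Prod>i\<in>I. L i) * (1 - 2 / t) ^ n \<le> real (card G)"
  proof -
    have "(\<Prod>i\<in>I. L i) * (1 - 2 / t) ^ n = (\<Prod>i\<in>I. L i * (1 - 2 / t))"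
      by (simp add: prod.distrib n_def)
    also have "\<dots> \<le> (\<Prod>i\<in>I. real (card {k::int. real q * u i + 1 / 2 \<le> k \<and> k \<le> real q * v i - 1 / 2}))"
    proof (intro prod_mono conjI)
      fix i assume i: "i \<in> I"
      show "0 \<le> L i * (1 - 2 / t)" using Lpos[OF i] t64 by simp
      have "1 \<le> L i / t" using L[OF i] t64 by simp
      then have "L i - 2 * (L i / t) \<le> L i - 2" by linarith
      moreover have "L i * (1 - 2 / t) = L i - 2 * (L i / t)" by (simp add: algebra_simps)
      ultimately have "L i * (1 - 2 / t) \<le> L i - 2" by (simp only:)
      also have "\<dots> = (real q * v i - 1 / 2) - (real q * u i + 1 / 2) - 1"
        by (simp add: L_def algebra_simps)
      also have "\<dots> \<le> real (card {k::int. real q * u i + 1 / 2 \<le> k \<and> k \<le> real q * v i - 1 / 2})"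
        by (rule card_int_between_ge)
      finally show "L i * (1 - 2 / t) \<le> \<dots>" .
    qed
    also have "\<dots> = real (card G)" unfolding G_def using I by (simp add: card_PiE)
    finally show ?thesis .
  qed
  define Bad where "Bad e = {p \<in> G. \<forall>i\<in>I. int e dvd p i}" for e :: nat
  have cBad: "real (card (Bad e)) \<le> (\<Prod>i\<in>I. L i) * (1 / real e + 1 / t)\<^sup>2" if e: "2 \<le> e" for e
  proof -
    have "Bad e = (\<Pi>\<^sub>E i\<in>I. {k::int. real q * u i + 1 / 2 \<le> k \<and> k \<le> real q * v i - 1 / 2 \<and> int e dvd k})"
      unfolding Bad_def G_def by (auto simp: PiE_iff extensional_def)
    then have "real (card (Bad e)) =
        (\<Prod>i\<in>I. real (card {k::int. real q * u i + 1 / 2 \<le> k \<and> k \<le> real q * v i - 1 / 2 \<and> int e dvd k}))"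
      using I by (simp add: card_PiE)
    also have "\<dots> \<le> (\<Prod>i\<in>I. L i * (1 / real e + 1 / t))"
    proof (intro prod_mono conjI)
      fix i assume i: "i \<in> I"
      have le: "real q * u i + 1 / 2 \<le> real q * v i - 1 / 2"
        using L[OF i] t64 by (simp add: L_def algebra_simps)
      have "real (card {k::int. real q * u i + 1 / 2 \<le> k \<and> k \<le> real q * v i - 1 / 2 \<and> int e dvd k})
          \<le> ((real q * v i - 1 / 2) - (real q * u i + 1 / 2)) / real e + 1"
        using e by (intro card_multiples_le le) auto
      also have "\<dots> \<le> L i / real e + L i / t"
      proof (rule add_mono)
        show "((real q * v i - 1 / 2) - (real q * u i + 1 / 2)) / real e \<le> L i / real e"
          by (intro divide_right_mono) (auto simp: L_def algebra_simps)
        show "1 \<le> L i / t" using L[OF i] t64 by simp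
      qed
      finally show "real (card {k::int. real q * u i + 1 / 2 \<le> k \<and> k \<le> real q * v i - 1 / 2 \<and> int e dvd k})
          \<le> L i * (1 / real e + 1 / t)" by (simp add: algebra_simps)
    qed auto
    also have "\<dots> = (\<Prod>i\<in>I. L i) * (1 / real e + 1 / t) ^ n" by (simp add: prod.distrib n_def)
    also have "\<dots> \<le> (\<Prod>i\<in>I. L i) * (1 / real e + 1 / t)\<^sup>2"
    proof (intro mult_left_mono power_decreasing n2)
      show "0 \<le> (\<Prod>i\<in>I. L i)" using Lpos by (intro prod_nonneg) (auto intro: less_imp_le)
      have "1 / real e \<le> 1 / 2" using e by (simp add: field_simps)
      moreover have "1 / t \<le> 1 / 2" using t64 by (simp add: field_simps)
      ultimately show "1 / real e + 1 / t \<le> 1" by simp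
      show "0 \<le> 1 / real e + 1 / t" using t64 by simp
    qed
    finally show ?thesis .
  qed
  have "G \<subseteq> ?H \<union> (\<Union>e\<in>{2..q}. Bad e)"
  proof
    fix p assume p: "p \<in> G"
    show "p \<in> ?H \<union> (\<Union>e\<in>{2..q}. Bad e)"
    proof (cases "p \<in> ?H")
      case False
      then obtain e where e: "e dvd q" "\<forall>i\<in>I. int e dvd p i" "e \<noteq> 1" using p by auto
      have "e \<noteq> 0" using e(1) q(3) by (metis dvd_0_left_iff not_one_le_zero)
      moreover have "e \<le> q" using e(1) q(3) by (intro dvd_imp_le) auto
      ultimately show ?thesis using e p by (auto simp: Bad_def)
    qed simp
  qed
  then have "card G \<le> card (?H \<union> (\<Union>e\<in>{2..q}. Bad e))"
    using finG by (intro card_mono) (auto simp: Bad_def)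
  also have "\<dots> \<le> card ?H + card (\<Union>e\<in>{2..q}. Bad e)" by (rule card_Un_le)
  also have "\<dots> \<le> card ?H + (\<Sum>e=2..q. card (Bad e))" by (intro add_left_mono card_UN_le) simp
  finally have "real (card G) \<le> real (card ?H) + (\<Sum>e=2..q. real (card (Bad e)))"
    by (simp flip: of_nat_sum of_nat_add)
  also have "(\<Sum>e=2..q. real (card (Bad e))) \<le> (\<Sum>e=2..q. (\<Prod>i\<in>I. L i) * (1 / real e + 1 / t)\<^sup>2)"
    by (intro sum_mono cBad) auto
  also have "\<dots> = (\<Prod>i\<in>I. L i) * (\<Sum>e=2..q. (1 / real e + 1 / t)\<^sup>2)" by (simp add: sum_distrib_left)
  also have "\<dots> \<le> (\<Prod>i\<in>I. L i) * (14 / 16)"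
  proof (intro mult_left_mono)
    have "(\<Sum>e=2..q. (1 / real e + 1 / t)\<^sup>2) \<le> (\<Sum>e=2..q. 13 / 12 * (1 / (real e)\<^sup>2) + 13 * (1 / t)\<^sup>2)"
    proof (intro sum_mono)
      fix e :: nat
      \<comment> \<open>This weighted square bounds the cross term by 1/(12 e^2) + 12/t^2, so that
        the main term is at most 13/12 * 3/4 = 13/16.\<close>
      have "0 \<le> (1 / real e - 12 * (1 / t))\<^sup>2" by simp
      then show "(1 / real e + 1 / t)\<^sup>2 \<le> 13 / 12 * (1 / (real e)\<^sup>2) + 13 * (1 / t)\<^sup>2"
        by (simp add: power2_eq_square algebra_simps)
    qed
    also have "\<dots> = 13 / 12 * (\<Sum>e=2..q. 1 / (real e)\<^sup>2) + real (card {2..q}) * (13 * (1 / t)\<^sup>2)"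
      by (simp add: sum.distrib sum_distrib_left del: card_atLeastAtMost)
    also have "\<dots> \<le> 13 / 12 * (3 / 4) + real q * (13 * (1 / t)\<^sup>2)"
      using sum_inverse_squares_le[of q] by (intro add_mono mult_left_mono mult_right_mono) auto
    \<comment> \<open>Here t = q l, and 208 = 13 * 16 in the hypothesis on q is chosen for this
      estimate.\<close>
    also have "real q * (13 * (1 / t)\<^sup>2) \<le> 1 / 16"
      using q l by (simp add: t_def power2_eq_square field_simps)
    finally show "(\<Sum>e=2..q. (1 / real e + 1 / t)\<^sup>2) \<le> 14 / 16" by simp
    show "0 \<le> (\<Prod>i\<in>I. L i)" using Lpos by (intro prod_nonneg) (auto intro: less_imp_le)
  qed
  finally have 1: "(\<Prod>i\<in>I. L i) * (1 - 2 / t) ^ n \<le> real (card ?H) + (\<Prod>i\<in>I. L i) * (14 / 16)"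
    using cG by linarith
  \<comment> \<open>From 32 n <= t one gets 2 n/t <= 1/16, and Bernoulli's inequality
    finishes.\<close>
  have "15 / 16 \<le> 1 + real n * (- 2 / t)" using nt t64 by (simp add: field_simps)
  also have "\<dots> \<le> (1 + (- 2 / t)) ^ n" using t64 by (intro Bernoulli_inequality) (simp add: field_simps)
  finally have "(\<Prod>i\<in>I. L i) * (15 / 16) \<le> (\<Prod>i\<in>I. L i) * (1 - 2 / t) ^ n"
    using Lpos by (intro mult_left_mono prod_nonneg) (auto intro: less_imp_le)
  then show "(1 / 16) * (\<Prod>i\<in>I. real q * (v i - u i)) \<le> real (card ?H)"
    using 1 by (simp add: L_def)
qed

lemma nbhd_disjoint:
  assumes "p \<noteq> p'" "p \<in> extensional I" "p' \<in> extensional I" "t \<le> 1 / 2" "1 \<le> q"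
  shows "nbhd I q t p \<inter> nbhd I q t p' = {}"
proof (rule ccontr)
  assume "\<not> ?thesis"
  then obtain y where y: "y \<in> nbhd I q t p" "y \<in> nbhd I q t p'" by auto
  have "p i = p' i" if i: "i \<in> I" for i
  proof -
    have "(real_of_int (p i) - t) / real q < y i" "y i < (real_of_int (p i) + t) / real q"
        "(real_of_int (p' i) - t) / real q < y i" "y i < (real_of_int (p' i) + t) / real q"
      using y i by (auto simp: nbhd_def)
    then have "real_of_int (p i) - t < y i * real q" "y i * real q < real_of_int (p i) + t"
        "real_of_int (p' i) - t < y i * real q" "y i * real q < real_of_int (p' i) + t"
      using assms(5) by (auto simp: field_simps)
    then have "\<bar>real_of_int (p i) - real_of_int (p' i)\<bar> < 1" using assms(4) by linarith
    then show ?thesis by linarith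
  qed
  then show False using assms by (metis extensionalityI)
qed

text \<open>The primitive points found by \<open>card_prim_ge\<close> have disjoint neighbourhoods
  inside the box, because t <= 1/2. Two uniformities matter later: the constant 1/16 is the same for
  all boxes, and \<open>q0\<close> is independent of t, which will vary with q.\<close>

lemma local_lower_bound:
  fixes u v :: "'i \<Rightarrow> real"
  assumes I: "finite I" "2 \<le> card I" and uv: "\<And>i. i \<in> I \<Longrightarrow> u i < v i"
    and K: "\<And>i. i \<in> I \<Longrightarrow> - real K \<le> u i" "\<And>i. i \<in> I \<Longrightarrow> v i \<le> real K"
  shows "\<exists>q0. \<forall>q\<ge>q0. \<forall>t. 0 \<le> t \<longrightarrow> t \<le> 1 / 2 \<longrightarrow>
    (1 / 16) * (2 * t) ^ card I * measure (leb I) (\<Pi>\<^sub>E i\<in>I. {u i..<v i}) \<le>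
      measure (leb I) (approx_set I K q t \<inter> (\<Pi>\<^sub>E i\<in>I. {u i..<v i}))"
proof -
  have Ine: "I \<noteq> {}" using I by auto
  define l where "l = Min ((\<lambda>i. v i - u i) ` I)"
  have l: "0 < l" "\<And>i. i \<in> I \<Longrightarrow> l \<le> v i - u i" using I Ine uv by (auto simp: l_def)
  define q0 where "q0 = nat \<lceil>32 * real (card I) / l\<rceil> + nat \<lceil>208 / l\<^sup>2\<rceil> + 1"
  define B where "B = (\<Pi>\<^sub>E i\<in>I. {u i..<v i})"
  have Bs: "B \<in> sets (leb I)" unfolding B_def using I by (intro sets_leb_PiE) auto
  have "(1 / 16) * (2 * t) ^ card I * measure (leb I) B \<le> measure (leb I) (approx_set I K q t \<inter> B)"
    if "q0 \<le> q" and t: "0 \<le> t" "t \<le> 1 / 2" for q t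
  proof -
    have q: "32 * real (card I) / l \<le> real q" "208 / l\<^sup>2 \<le> real q" "1 \<le> q"
      using that unfolding q0_def by linarith+
    define G where "G = (\<Pi>\<^sub>E i\<in>I. {k::int. real q * u i + 1 / 2 \<le> k \<and> k \<le> real q * v i - 1 / 2})"
    define H where "H = {p \<in> G. \<forall>e::nat. e dvd q \<and> (\<forall>i\<in>I. int e dvd p i) \<longrightarrow> e = 1}"
    have H: "finite H" "(1 / 16) * (\<Prod>i\<in>I. real q * (v i - u i)) \<le> real (card H)"
      using card_prim_ge[where u = u and v = v, OF I l q] by (auto simp: H_def G_def)
    have "H \<subseteq> prim_points I K q"
    proof
      fix p assume p: "p \<in> H"
      have "- int (K * q) \<le> p i \<and> p i < int (K * q)" if i: "i \<in> I" for i
      proof -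
        have "real q * u i + 1 / 2 \<le> p i" "p i \<le> real q * v i - 1 / 2"
          using p i by (auto simp: H_def G_def)
        moreover have "real q * (- real K) \<le> real q * u i" "real q * v i \<le> real q * real K"
          using K i by (intro mult_left_mono; simp)+
        ultimately have "- real (K * q) < p i" "p i < real (K * q)" by (auto simp: mult.commute)
        then show ?thesis by linarith
      qed
      then show "p \<in> prim_points I K q" using p by (auto simp: H_def G_def prim_points_def PiE_iff)
    qed
    moreover have "nbhd I q t p \<subseteq> B" if p: "p \<in> H" for p
      unfolding nbhd_def B_def
    proof (rule PiE_mono)
      fix i assume i: "i \<in> I"
      have "real q * u i + 1 / 2 \<le> p i" "p i \<le> real q * v i - 1 / 2"
          using p i by (auto simp: H_def G_def)
      then have "u i \<le> (real_of_int (p i) - t) / real q" "(real_of_int (p i) + t) / real q \<le> v i"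
        using q t by (auto simp: field_simps)
      then show "{(real_of_int (p i) - t) / real q <..< (real_of_int (p i) + t) / real q} \<subseteq> {u i..<v i}"
        by auto
    qed
    ultimately have sub: "(\<Union>p\<in>H. nbhd I q t p) \<subseteq> approx_set I K q t \<inter> B"
      by (auto simp: approx_set_def)
    have "(1 / 16) * (2 * t) ^ card I * measure (leb I) B
        = (1 / 16) * (2 * t) ^ card I * (\<Prod>i\<in>I. v i - u i)"
      unfolding B_def using I uv by (subst measure_leb_PiE) (auto simp: less_imp_le)
    also have "\<dots> = (1 / 16) * (\<Prod>i\<in>I. real q * (v i - u i)) * (2 * t / real q) ^ card I"
      using q by (simp add: prod.distrib power_divide power_mult_distrib)
    also have "\<dots> \<le> real (card H) * (2 * t / real q) ^ card I"
      using H t by (intro mult_right_mono) auto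
    also have "\<dots> = (\<Sum>p\<in>H. measure (leb I) (nbhd I q t p))"
      using I t q by (simp add: measure_nbhd)
    also have "\<dots> = measure (leb I) (\<Union>p\<in>H. nbhd I q t p)"
    proof (rule measure_finite_Union[symmetric])
      show "disjoint_family_on (nbhd I q t) H"
        unfolding disjoint_family_on_def
        using t q by (intro ballI impI nbhd_disjoint) (auto simp: H_def G_def PiE_iff)
    qed (use H I t q in \<open>auto simp: nbhd_sets measure_nbhd\<close>)
    also have "\<dots> \<le> measure (leb I) (approx_set I K q t \<inter> B)"
    proof (rule measure_mono_fmeasurable[OF sub])
      show "(\<Union>p\<in>H. nbhd I q t p) \<in> sets (leb I)" using H I by (auto intro!: sets.finite_UN nbhd_sets)
      have "emeasure (leb I) B < \<infinity>" unfolding B_def using I uv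
        by (subst emeasure_leb_PiE) (auto simp: less_imp_le ennreal_prod_eq_top less_top[symmetric])
      then have "B \<in> fmeasurable (leb I)" using Bs by (simp add: fmeasurable_def)
      then show "approx_set I K q t \<inter> B \<in> fmeasurable (leb I)"
        using approx_set_sets[OF I(1)] by (metis Int_commute fmeasurable_Int_fmeasurable)
    qed
    finally show ?thesis .
  qed
  then show ?thesis unfolding B_def by blast
qed

section \<open>Approximation by dyadic grid sets\<close>

text \<open>The sets that can be approximated form a sigma-algebra. Only countable unions need work:
  continuity from below leaves finitely many sets and a tail of measure below e/2.\<close>

lemma (in finite_measure) approximation_by_algebra:
  assumes alg: "algebra (space M) \<A>" and sub: "\<A> \<subseteq> sets M"
    and S: "S \<in> sigma_sets (space M) \<A>" and e: "0 < e"
  shows "\<exists>E\<in>\<A>. measure M ((S - E) \<union> (E - S)) < e"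
  using S e
proof (induction arbitrary: e)
  interpret algebra "space M" \<A> by (rule alg)
  have sets: "S \<in> sets M" if "S \<in> sigma_sets (space M) \<A>" for S
    using that sub by (metis sets.sigma_sets_subset subsetD)
  {
    case (Basic a)
    then show ?case by (intro bexI[of _ a]) auto
  next
    case Empty
    then show ?case by (intro bexI[of _ "{}"]) auto
  next
    case (Compl a)
    then obtain E where E: "E \<in> \<A>" "measure M ((a - E) \<union> (E - a)) < e" by blast
    have "a \<subseteq> space M" "E \<subseteq> space M"
      using sets[OF Compl.hyps] E(1) sub sets.sets_into_space by blast+
    then have "(space M - a - (space M - E)) \<union> (space M - E - (space M - a)) = (a - E) \<union> (E - a)"
      by blast
    then show ?case using E by (intro bexI[of _ "space M - E"]) auto
  next
    case (Union a)
    have a: "a i \<in> sets M" for i using sets Union.hyps by blast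
    define b where "b N = (\<Union>i<N. a i)" for N
    have "(\<lambda>N. measure M (b N)) \<longlonglongrightarrow> measure M (\<Union>N. b N)"
      using a by (intro finite_Lim_measure_incseq) (auto simp: b_def incseq_def intro: less_le_trans)
    moreover have U: "(\<Union>N. b N) = (\<Union>i. a i)" by (auto simp: b_def)
    ultimately have "\<forall>\<^sub>F N in sequentially. dist (measure M (b N)) (measure M (\<Union>i. a i)) < e / 2"
      using Union.prems by (intro tendstoD) auto
    then obtain N where N: "dist (measure M (b N)) (measure M (\<Union>i. a i)) < e / 2"
      by (meson eventually_sequentially order_refl)
    have bN: "b N \<in> sets M" using a by (auto simp: b_def)
    have "measure M ((\<Union>i. a i) - b N) = measure M (\<Union>i. a i) - measure M (b N)"
      using a bN by (intro finite_measure_Diff) (auto simp: b_def)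
    then have tail: "measure M ((\<Union>i. a i) - b N) < e / 2" using N unfolding dist_real_def by linarith
    \<comment> \<open>\<open>Suc N\<close> in place of N keeps the tolerance meaningful when N =
      0.\<close>
    have "\<forall>i. \<exists>E\<in>\<A>. measure M ((a i - E) \<union> (E - a i)) < e / (2 * real (Suc N))"
      using Union.IH Union.prems by simp
    then obtain E where E: "\<And>i. E i \<in> \<A>"
      "\<And>i. measure M ((a i - E i) \<union> (E i - a i)) < e / (2 * real (Suc N))" by metis
    define G where "G = (\<Union>i<N. E i)"
    have Es: "E i \<in> sets M" for i using E(1) sub by blast
    have sd: "(a i - E i) \<union> (E i - a i) \<in> sets M" for i using a Es by auto
    have "measure M (((\<Union>i. a i) - G) \<union> (G - (\<Union>i. a i)))
        \<le> measure M (((\<Union>i. a i) - b N) \<union> (\<Union>i<N. (a i - E i) \<union> (E i - a i)))"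
      using a bN Es by (intro finite_measure_mono) (auto simp: G_def b_def)
    also have "\<dots> \<le> measure M ((\<Union>i. a i) - b N) + measure M (\<Union>i<N. (a i - E i) \<union> (E i - a i))"
      using a bN Es by (intro measure_Un_le) auto
    also have "measure M (\<Union>i<N. (a i - E i) \<union> (E i - a i))
        \<le> (\<Sum>i<N. measure M ((a i - E i) \<union> (E i - a i)))"
      using sd by (intro measure_UNION_le) auto
    also have "\<dots> \<le> (\<Sum>i<N. e / (2 * real (Suc N)))" using E(2) by (intro sum_mono) (auto intro: less_imp_le)
    also have "\<dots> \<le> e / 2" using Union.prems by (simp add: field_simps)
    finally have "measure M (((\<Union>i. a i) - G) \<union> (G - (\<Union>i. a i))) < e" using tail by linarith
    moreover have "G \<in> \<A>" unfolding G_def using E(1) by (intro finite_UN) auto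
    ultimately show ?case by blast
  }
qed

text \<open>Integrate (a 1_D - f)^2 / a >= 0, where f is the sum of the indicators of the sets A q.
  This is Cauchy-Schwarz in a form without square roots; the free parameter a is balanced by the
  caller.\<close>

lemma second_moment_bound:
  assumes J: "finite J" and A: "\<And>q. q \<in> J \<Longrightarrow> A q \<in> fmeasurable M" and D: "D \<in> fmeasurable M"
    and a: "0 < (a::real)"
  shows "2 * (\<Sum>q\<in>J. measure M (A q \<inter> D)) \<le>
    a * measure M D + (\<Sum>q\<in>J. \<Sum>r\<in>J. measure M (A q \<inter> A r)) / a"
proof -
  let ?f = "\<lambda>x. \<Sum>q\<in>J. indicator (A q) x :: real"
  have AD: "A q \<inter> D \<in> fmeasurable M" if "q \<in> J" for q
    using A[OF that] D by (intro fmeasurable_Int_fmeasurable) (auto dest: fmeasurableD)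
  have AA: "A q \<inter> A r \<in> fmeasurable M" if "q \<in> J" "r \<in> J" for q r
    using A that by (intro fmeasurable_Int_fmeasurable) (auto dest: fmeasurableD)
  have ind: "integrable M (indicator B :: _ \<Rightarrow> real)" "integral\<^sup>L M (indicator B :: _ \<Rightarrow> real) = measure M B"
    if "B \<in> fmeasurable M" for B
    using that fmeasurableD[OF that] sets.sets_into_space[OF fmeasurableD[OF that]]
    by (auto simp: fmeasurable_def Int_absorb2)
  have "2 * (\<Sum>q\<in>J. measure M (A q \<inter> D)) = integral\<^sup>L M (\<lambda>x. 2 * (\<Sum>q\<in>J. indicator (A q \<inter> D) x))"
    using AD by (simp add: ind)
  also have "\<dots> \<le> integral\<^sup>L M (\<lambda>x. a * indicator D x + (\<Sum>q\<in>J. \<Sum>r\<in>J. indicator (A q \<inter> A r) x) / a)"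
  proof (rule integral_mono)
    show "integrable M (\<lambda>x. 2 * (\<Sum>q\<in>J. indicator (A q \<inter> D) x) :: real)" using AD by (simp add: ind)
    show "integrable M (\<lambda>x. a * indicator D x + (\<Sum>q\<in>J. \<Sum>r\<in>J. indicator (A q \<inter> A r) x) / a :: real)"
      using AA D by (intro Bochner_Integration.integrable_add integrable_mult_right
          Bochner_Integration.integrable_divide Bochner_Integration.integrable_sum) (auto simp: ind)
    fix x
    have 1: "(\<Sum>q\<in>J. indicator (A q \<inter> D) x) = indicator D x * ?f x"
      by (simp add: indicator_inter_arith sum_distrib_left mult.commute)
    have 2: "(\<Sum>q\<in>J. \<Sum>r\<in>J. indicator (A q \<inter> A r) x) = (?f x)\<^sup>2"
      by (simp add: indicator_inter_arith power2_eq_square sum_product)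
    have "0 \<le> (a * indicator D x - ?f x)\<^sup>2 / a" using a by simp
    also have "\<dots> = a * indicator D x - 2 * (indicator D x * ?f x) + (?f x)\<^sup>2 / a"
      using a by (cases "x \<in> D") (auto simp: power2_eq_square field_simps)
    finally show "2 * (\<Sum>q\<in>J. indicator (A q \<inter> D) x)
       \<le> a * indicator D x + (\<Sum>q\<in>J. \<Sum>r\<in>J. indicator (A q \<inter> A r) x) / a"
      unfolding 1 2 by simp
  qed
  also have "\<dots> = a * measure M D + (\<Sum>q\<in>J. \<Sum>r\<in>J. measure M (A q \<inter> A r)) / a"
    using AA D by (subst Bochner_Integration.integral_add) (auto simp: ind intro!: Bochner_Integration.integrable_sum)
  finally show ?thesis .
qed

definition cube :: "'i set \<Rightarrow> nat \<Rightarrow> ('i \<Rightarrow> real) set" where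
  "cube I K = (\<Pi>\<^sub>E i\<in>I. {- real K..<real K})"

definition cell :: "'i set \<Rightarrow> nat \<Rightarrow> ('i \<Rightarrow> int) \<Rightarrow> ('i \<Rightarrow> real) set" where
  "cell I j z = (\<Pi>\<^sub>E i\<in>I. {real_of_int (z i) / 2 ^ j..<(real_of_int (z i) + 1) / 2 ^ j})"

definition cell_index :: "'i set \<Rightarrow> nat \<Rightarrow> ('i \<Rightarrow> real) \<Rightarrow> 'i \<Rightarrow> int" where
  "cell_index I j y = (\<lambda>i\<in>I. \<lfloor>2 ^ j * y i\<rfloor>)"

text \<open>Finite unions of dyadic cells of one level, described by index sets so that complements
  and unions act on Z alone; two levels are reconciled by passing to the finer one. Z is
  unrestricted, but only the finitely many indices of cells in the cube count.\<close>

definition grid_sets :: "'i set \<Rightarrow> nat \<Rightarrow> ('i \<Rightarrow> real) set set" where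
  "grid_sets I K = {{y \<in> cube I K. cell_index I j y \<in> Z} |j Z. True}"

lemma grid_setsI: "{y \<in> cube I K. cell_index I j y \<in> Z} \<in> grid_sets I K"
  unfolding grid_sets_def by blast

lemma cell_index_eq_iff:
  assumes "y \<in> extensional I" "z \<in> extensional I"
  shows "cell_index I j y = z \<longleftrightarrow> y \<in> cell I j z"
proof -
  have "\<lfloor>2 ^ j * y i\<rfloor> = z i \<longleftrightarrow> real_of_int (z i) / 2 ^ j \<le> y i \<and> y i < (real_of_int (z i) + 1) / 2 ^ j" for i
    by (simp add: floor_eq_iff field_simps)
  moreover have "cell_index I j y = z \<longleftrightarrow> (\<forall>i\<in>I. \<lfloor>2 ^ j * y i\<rfloor> = z i)"
    using assms by (auto simp: cell_index_def fun_eq_iff extensional_def restrict_def)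
  ultimately show ?thesis using assms by (auto simp: cell_def PiE_iff)
qed

lemma grid_set_eq_UN_cells:
  fixes I :: "'i set" and j K :: nat
  defines "Z' \<equiv> I \<rightarrow>\<^sub>E {- int (K * 2 ^ j)..<int (K * 2 ^ j)}"
  shows "{y \<in> cube I K. cell_index I j y \<in> Z} = (\<Union>z\<in>Z \<inter> Z'. cell I j z)"
proof (intro set_eqI iffI)
  fix y assume y: "y \<in> {y \<in> cube I K. cell_index I j y \<in> Z}"
  then have ext: "y \<in> extensional I" by (auto simp: cube_def PiE_iff)
  have "- int (K * 2 ^ j) \<le> \<lfloor>2 ^ j * y i\<rfloor> \<and> \<lfloor>2 ^ j * y i\<rfloor> < int (K * 2 ^ j)" if "i \<in> I" for i
  proof -
    have "- real K \<le> y i" "y i < real K" using y that by (auto simp: cube_def)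
    then have "2 ^ j * (- real K) \<le> 2 ^ j * y i" "2 ^ j * y i < 2 ^ j * real K"
      by (intro mult_left_mono mult_strict_left_mono; simp)+
    then show ?thesis by (auto simp: le_floor_iff floor_less_iff mult.commute)
  qed
  then have "cell_index I j y \<in> Z'" by (auto simp: Z'_def cell_index_def)
  moreover have "y \<in> cell I j (cell_index I j y)"
    using cell_index_eq_iff[OF ext, of "cell_index I j y" j] by (simp add: cell_index_def)
  ultimately show "y \<in> (\<Union>z\<in>Z \<inter> Z'. cell I j z)" using y by auto
next
  fix y assume "y \<in> (\<Union>z\<in>Z \<inter> Z'. cell I j z)"
  then obtain z where z: "z \<in> Z" "z \<in> Z'" "y \<in> cell I j z" by auto
  then have ext: "y \<in> extensional I" "z \<in> extensional I" by (auto simp: cell_def Z'_def PiE_iff)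
  have "- real K \<le> y i \<and> y i < real K" if i: "i \<in> I" for i
  proof -
    have "- int (K * 2 ^ j) \<le> z i" "z i + 1 \<le> int (K * 2 ^ j)" using z(2) i by (auto simp: Z'_def PiE_iff)
    then have "real_of_int (- int (K * 2 ^ j)) \<le> real_of_int (z i)"
      "real_of_int (z i + 1) \<le> real_of_int (int (K * 2 ^ j))" by (simp_all only: of_int_le_iff)
    then have "- real K \<le> real_of_int (z i) / 2 ^ j" "(real_of_int (z i) + 1) / 2 ^ j \<le> real K"
      by (auto simp: field_simps)
    moreover have "real_of_int (z i) / 2 ^ j \<le> y i" "y i < (real_of_int (z i) + 1) / 2 ^ j"
      using z(3) i by (auto simp: cell_def PiE_iff)
    ultimately show ?thesis by linarith
  qed
  then have "y \<in> cube I K" using ext by (auto simp: cube_def PiE_iff)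
  then show "y \<in> {y \<in> cube I K. cell_index I j y \<in> Z}"
    using z cell_index_eq_iff[OF ext, of j] by auto
qed

lemma cell_sets: "finite I \<Longrightarrow> cell I j z \<in> sets (leb I)"
  unfolding cell_def by (rule sets_leb_PiE) auto

lemma cube_sets: "finite I \<Longrightarrow> cube I K \<in> sets (leb I)"
  unfolding cube_def by (rule sets_leb_PiE) auto

lemma cube_fmeasurable: "finite I \<Longrightarrow> cube I K \<in> fmeasurable (leb I)"
  by (simp add: fmeasurable_def cube_sets) 
    (simp add: cube_def emeasure_leb_PiE less_top[symmetric] ennreal_power)

lemma cell_index_refine:
  assumes "j \<le> k"
  shows "cell_index I j y = (\<lambda>i\<in>I. cell_index I k y i div 2 ^ (k - j))"
proof -
  have "\<lfloor>2 ^ j * y i\<rfloor> = \<lfloor>2 ^ k * y i\<rfloor> div 2 ^ (k - j)" for i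
  proof -
    have "(2 :: real) ^ k = 2 ^ j * 2 ^ (k - j)" using assms by (simp flip: power_add)
    then have "2 ^ k * y i / real_of_int (2 ^ (k - j)) = 2 ^ j * y i" by simp
    then show ?thesis using floor_divide_real_eq_div[of "2 ^ (k - j)" "2 ^ k * y i"] by simp
  qed
  then show ?thesis by (auto simp: cell_index_def)
qed

lemma algebra_grid_sets: "algebra (cube I K) (grid_sets I K)"
proof -
  have lift: "\<exists>Z'. {y \<in> cube I K. cell_index I j y \<in> Z} = {y \<in> cube I K. cell_index I k y \<in> Z'}"
    if "j \<le> k" for j k Z
    by (rule exI[of _ "{w. (\<lambda>i\<in>I. w i div 2 ^ (k - j)) \<in> Z}"])
      (simp add: cell_index_refine[OF that])
  show ?thesis
    unfolding algebra_iff_Un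
  proof (intro conjI ballI)
    show "grid_sets I K \<subseteq> Pow (cube I K)" by (auto simp: grid_sets_def)
    show "{} \<in> grid_sets I K" unfolding grid_sets_def by (auto intro!: exI[of _ "{}"])
  next
    fix a assume "a \<in> grid_sets I K"
    then obtain j Z where "a = {y \<in> cube I K. cell_index I j y \<in> Z}" by (auto simp: grid_sets_def)
    then have "cube I K - a = {y \<in> cube I K. cell_index I j y \<in> - Z}" by auto
    then show "cube I K - a \<in> grid_sets I K" by (simp only: grid_setsI)
  next
    fix a b assume "a \<in> grid_sets I K" "b \<in> grid_sets I K"
    then obtain j1 Z1 j2 Z2 where ab: "a = {y \<in> cube I K. cell_index I j1 y \<in> Z1}"
      "b = {y \<in> cube I K. cell_index I j2 y \<in> Z2}" by (auto simp: grid_sets_def)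
    obtain Z1' where "a = {y \<in> cube I K. cell_index I (max j1 j2) y \<in> Z1'}"
      using ab(1) lift[of j1 "max j1 j2" Z1] by auto
    moreover obtain Z2' where "b = {y \<in> cube I K. cell_index I (max j1 j2) y \<in> Z2'}"
      using ab(2) lift[of j2 "max j1 j2" Z2] by auto
    ultimately have "a \<union> b = {y \<in> cube I K. cell_index I (max j1 j2) y \<in> Z1' \<union> Z2'}" by auto
    then show "a \<union> b \<in> grid_sets I K" by (simp only: grid_setsI)
  qed
qed

text \<open>It suffices that the coordinates are measurable for the grid sigma-algebra: w i < a
  holds exactly if, at some level, the dyadic interval containing w i ends at or before a.\<close>

lemma sets_cube_subset_sigma_grid:
  assumes S: "S \<in> sets (leb I)" "S \<subseteq> cube I K"
  shows "S \<in> sigma_sets (cube I K) (grid_sets I K)"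
proof -
  define N where "N = sigma (cube I K) (grid_sets I K)"
  have sub: "grid_sets I K \<subseteq> Pow (cube I K)" by (auto simp: grid_sets_def)
  have N: "space N = cube I K" "sets N = sigma_sets (cube I K) (grid_sets I K)"
    using sub by (auto simp: N_def)
  have "(\<lambda>y. y i) \<in> borel_measurable N" if i: "i \<in> I" for i
    unfolding borel_measurable_iff_less
  proof
    fix a :: real
    have "{w \<in> space N. w i < a} = (\<Union>j. {y \<in> cube I K. cell_index I j y \<in> {z. real_of_int (z i) + 1 \<le> 2 ^ j * a}})"
    proof (intro set_eqI iffI)
      fix w assume w: "w \<in> {w \<in> space N. w i < a}"
      then obtain j where j: "(1 / 2) ^ j < a - w i"
        using real_arch_pow_inv[of "a - w i" "1 / 2"] by auto
      have "real_of_int \<lfloor>2 ^ j * w i\<rfloor> + 1 \<le> 2 ^ j * w i + 2 ^ j * (1 / 2) ^ j"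
        by (simp flip: power_mult_distrib)
      also have "\<dots> \<le> 2 ^ j * w i + 2 ^ j * (a - w i)"
        using j by (intro add_left_mono mult_left_mono) auto
      finally show "w \<in> (\<Union>j. {y \<in> cube I K. cell_index I j y \<in> {z. real_of_int (z i) + 1 \<le> 2 ^ j * a}})"
        using w i by (auto simp: N cell_index_def algebra_simps)
    next
      fix w assume "w \<in> (\<Union>j. {y \<in> cube I K. cell_index I j y \<in> {z. real_of_int (z i) + 1 \<le> 2 ^ j * a}})"
      then obtain j where w: "w \<in> cube I K" "real_of_int \<lfloor>2 ^ j * w i\<rfloor> + 1 \<le> 2 ^ j * a"
        using i by (auto simp: cell_index_def)
      have "2 ^ j * w i < 2 ^ j * a" using w(2) by linarith
      then show "w \<in> {w \<in> space N. w i < a}" using w by (simp add: N)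
    qed
    also have "\<dots> \<in> sets N"
      unfolding N by (rule sigma_sets.Union, rule sigma_sets.Basic, rule grid_setsI)
    finally show "{w \<in> space N. w i < a} \<in> sets N" .
  qed
  then have "(\<lambda>y. y) \<in> measurable N (leb I)"
    by (intro measurable_PiM_single') (auto simp: N cube_def PiE_iff)
  then have "(\<lambda>y. y) -` S \<inter> space N \<in> sets N" using S(1) by (rule measurable_sets)
  then show ?thesis using S(2) by (simp add: N Int_absorb2)
qed

section \<open>Gallagher's theorem\<close>

lemma approx_set_fmeasurable:
  assumes "finite I" "0 \<le> t" "1 \<le> q"
  shows "approx_set I K q t \<in> fmeasurable (leb I)"
  unfolding approx_set_def using assms
  by (intro fmeasurable.finite_UN finite_prim_points) (auto simp: fmeasurable_def nbhd_sets measure_nbhd)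

lemma measure_approx_set_le:
  assumes I: "finite I" and t: "0 \<le> t" and q: "1 \<le> q"
  shows "measure (leb I) (approx_set I K q t) \<le> (4 * real K * t) ^ card I"
proof -
  have "measure (leb I) (approx_set I K q t) \<le> (\<Sum>p\<in>prim_points I K q. measure (leb I) (nbhd I q t p))"
    unfolding approx_set_def using I by (intro measure_UNION_le finite_prim_points nbhd_sets)
  also have "\<dots> = real (card (prim_points I K q)) * (2 * t / real q) ^ card I"
    using assms by (simp add: measure_nbhd)
  also have "\<dots> \<le> (real (2 * K * q)) ^ card I * (2 * t / real q) ^ card I"
  proof (intro mult_right_mono)
    have "card (prim_points I K q) \<le> card (I \<rightarrow>\<^sub>E {- int (K * q)..<int (K * q)})"
      using I by (intro card_mono finite_PiE) (auto simp: prim_points_def)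
    also have "\<dots> = (2 * K * q) ^ card I" using I by (simp add: card_PiE nat_mult_distrib power_mult_distrib)
    finally show "real (card (prim_points I K q)) \<le> real (2 * K * q) ^ card I"
      by (simp only: of_nat_le_iff flip: of_nat_power)
  qed (use t in auto)
  also have "\<dots> = (4 * real K * t) ^ card I"
    unfolding power_mult_distrib[symmetric]
    by (rule arg_cong[where f = "\<lambda>x. x ^ card I"]) (use q in simp)
  finally show ?thesis .
qed

text \<open>The local bound is linear in the measure of the box with a fixed constant, so it adds up
  over disjoint cells. A grid set has finitely many of them, so their thresholds have a
  maximum.\<close>

lemma grid_set_lower_bound:
  assumes I: "finite I" "2 \<le> card I" and E: "E \<in> grid_sets I K"
  shows "\<exists>q0. \<forall>q\<ge>q0. \<forall>t. 0 \<le> t \<longrightarrow> t \<le> 1 / 2 \<longrightarrow>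
    (1 / 16) * (2 * t) ^ card I * measure (leb I) E \<le> measure (leb I) (approx_set I K q t \<inter> E)"
proof -
  obtain j Z where jZ: "E = {y \<in> cube I K. cell_index I j y \<in> Z}" using E by (auto simp: grid_sets_def)
  define Y where "Y = Z \<inter> (I \<rightarrow>\<^sub>E {- int (K * 2 ^ j)..<int (K * 2 ^ j)})"
  have EY: "E = (\<Union>z\<in>Y. cell I j z)" using jZ grid_set_eq_UN_cells[of I K j Z] by (simp add: Y_def)
  have Y: "finite Y" using I by (auto simp: Y_def intro!: finite_PiE)
  have disj: "disjoint_family_on (cell I j) Y"
  proof (unfold disjoint_family_on_def, intro ballI impI)
    fix z z' assume z: "z \<in> Y" "z' \<in> Y" "z \<noteq> z'"
    then have ext: "z \<in> extensional I" "z' \<in> extensional I" by (auto simp: Y_def PiE_iff)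
    show "cell I j z \<inter> cell I j z' = {}"
    proof (rule ccontr)
      assume "\<not> ?thesis"
      then obtain y where y: "y \<in> cell I j z" "y \<in> cell I j z'" by auto
      then have "y \<in> extensional I" by (auto simp: cell_def PiE_iff)
      then have "z = z'" using y cell_index_eq_iff ext by metis
      then show False using z by simp
    qed
  qed
  have cellfm: "cell I j z \<in> fmeasurable (leb I)" if "z \<in> Y" for z
  proof (rule fmeasurableI2[OF cube_fmeasurable[OF I(1), of K]])
    show "cell I j z \<subseteq> cube I K" using that EY jZ by auto
  qed (rule cell_sets[OF I(1)])
  have cellfin: "emeasure (leb I) (cell I j z) \<noteq> \<infinity>" if "z \<in> Y" for z
    using cellfm[OF that] by (simp add: fmeasurable_def less_top)
  have "\<exists>q0. \<forall>q\<ge>q0. \<forall>t. 0 \<le> t \<longrightarrow> t \<le> 1 / 2 \<longrightarrow>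
    (1 / 16) * (2 * t) ^ card I * measure (leb I) (cell I j z) \<le>
      measure (leb I) (approx_set I K q t \<inter> cell I j z)" if z: "z \<in> Y" for z
    unfolding cell_def
  proof (rule local_lower_bound[OF I])
    fix i assume i: "i \<in> I"
    have "- int (K * 2 ^ j) \<le> z i" "z i + 1 \<le> int (K * 2 ^ j)" using z i by (auto simp: Y_def PiE_iff)
    then have "real_of_int (- int (K * 2 ^ j)) \<le> real_of_int (z i)"
      "real_of_int (z i + 1) \<le> real_of_int (int (K * 2 ^ j))" by (simp_all only: of_int_le_iff)
    then show "- real K \<le> real_of_int (z i) / 2 ^ j" "(real_of_int (z i) + 1) / 2 ^ j \<le> real K"
      by (auto simp: field_simps)
    show "real_of_int (z i) / 2 ^ j < (real_of_int (z i) + 1) / 2 ^ j" by (simp add: divide_strict_right_mono)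
  qed
  then obtain q0 where q0: "\<And>z q t. z \<in> Y \<Longrightarrow> q0 z \<le> q \<Longrightarrow> 0 \<le> t \<Longrightarrow> t \<le> 1 / 2 \<Longrightarrow>
    (1 / 16) * (2 * t) ^ card I * measure (leb I) (cell I j z) \<le>
      measure (leb I) (approx_set I K q t \<inter> cell I j z)" by metis
  have "(1 / 16) * (2 * t) ^ card I * measure (leb I) E \<le> measure (leb I) (approx_set I K q t \<inter> E)"
    if q: "Max (insert 1 (q0 ` Y)) \<le> q" and t: "0 \<le> t" "t \<le> 1 / 2" for q t
  proof -
    have q0q: "q0 z \<le> q" if "z \<in> Y" for z using q that Y by (auto simp: Max_le_iff)
    have fm: "emeasure (leb I) (approx_set I K q t \<inter> cell I j z) \<noteq> \<infinity>" if "z \<in> Y" for z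
    proof -
      have "cell I j z \<inter> approx_set I K q t \<in> fmeasurable (leb I)"
        using cellfm[OF that] approx_set_sets[OF I(1)] by (rule fmeasurable_Int_fmeasurable)
      then show ?thesis by (simp add: fmeasurable_def Int_commute less_top)
    qed
    have "measure (leb I) E = (\<Sum>z\<in>Y. measure (leb I) (cell I j z))"
      unfolding EY using disj cellfin Y
      by (intro measure_finite_Union) (auto simp: cell_sets I(1))
    then have "(1 / 16) * (2 * t) ^ card I * measure (leb I) E
        = (\<Sum>z\<in>Y. (1 / 16) * (2 * t) ^ card I * measure (leb I) (cell I j z))"
      by (simp add: sum_distrib_left)
    also have "\<dots> \<le> (\<Sum>z\<in>Y. measure (leb I) (approx_set I K q t \<inter> cell I j z))"
      using q0q t by (intro sum_mono q0)
    also have "\<dots> = measure (leb I) (\<Union>z\<in>Y. approx_set I K q t \<inter> cell I j z)"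
      using disj fm Y
      by (intro measure_finite_Union[symmetric])
         (auto simp: disjoint_family_on_def approx_set_sets cell_sets I(1))
    also have "(\<Union>z\<in>Y. approx_set I K q t \<inter> cell I j z) = approx_set I K q t \<inter> E" by (auto simp: EY)
    finally show ?thesis .
  qed
  then show ?thesis by blast
qed

lemma grid_approximation:
  assumes I: "finite I" and F: "F \<in> sets (leb I)" "F \<subseteq> cube I K" and e: "0 < e"
  shows "\<exists>E\<in>grid_sets I K. measure (leb I) (E - F) < e \<and> measure (leb I) F - e < measure (leb I) E"
proof -
  \<comment> \<open>Restricting to the cube provides the finite measure that
    \<open>approximation_by_algebra\<close> requires.\<close>
  define M where "M = restrict_space (leb I) (cube I K)"
  have c: "cube I K \<inter> space (leb I) \<in> sets (leb I)" using cube_sets[OF I] by auto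
  have cs: "cube I K \<subseteq> space (leb I)" using cube_sets[OF I] sets.sets_into_space by blast
  have M: "space M = cube I K" using cs by (auto simp: M_def space_restrict_space)
  have setsM: "S \<in> sets M \<longleftrightarrow> S \<in> sets (leb I) \<and> S \<subseteq> cube I K" for S
    unfolding M_def by (subst sets_restrict_space_iff[OF c]) auto
  have meas: "measure M S = measure (leb I) S" if "S \<subseteq> cube I K" for S
    unfolding M_def by (rule measure_restrict_space[OF c that])
  have "emeasure M (space M) < \<infinity>"
    unfolding M using cube_fmeasurable[OF I, of K]
    by (simp add: M_def emeasure_restrict_space[OF c] fmeasurable_def)
  then interpret finite_measure M by (intro finite_measureI) (simp add: less_top[symmetric])
  have g: "E \<in> sets (leb I)" if E: "E \<in> grid_sets I K" for E
  proof -
    obtain j Z where "E = {y \<in> cube I K. cell_index I j y \<in> Z}" using E by (auto simp: grid_sets_def)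
    then have "E = (\<Union>z\<in>Z \<inter> (I \<rightarrow>\<^sub>E {- int (K * 2 ^ j)..<int (K * 2 ^ j)}). cell I j z)"
      using grid_set_eq_UN_cells[of I K j Z] by simp
    then show ?thesis using I by (auto intro!: sets.finite_UN cell_sets finite_PiE)
  qed
  have sub: "E \<subseteq> cube I K" if "E \<in> grid_sets I K" for E using that by (auto simp: grid_sets_def)
  have "\<exists>E\<in>grid_sets I K. measure M ((F - E) \<union> (E - F)) < e"
    using e F algebra_grid_sets[of I K] g sub
    by (intro approximation_by_algebra) (auto simp: M setsM sets_cube_subset_sigma_grid)
  then obtain E where E: "E \<in> grid_sets I K" "measure M ((F - E) \<union> (E - F)) < e" by blast
  have EF: "E \<in> sets M" "F \<in> sets M" using E(1) g sub F by (auto simp: setsM)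
  have "measure M (E - F) \<le> measure M ((F - E) \<union> (E - F))"
    using EF by (intro finite_measure_mono) auto
  moreover have "measure M F \<le> measure M (((F - E) \<union> (E - F)) \<union> E)"
    using EF by (intro finite_measure_mono) auto
  moreover have "measure M (((F - E) \<union> (E - F)) \<union> E) \<le> measure M ((F - E) \<union> (E - F)) + measure M E"
    using EF by (intro measure_Un_le) auto
  ultimately have "measure M (E - F) < e" "measure M F - e < measure M E" using E(2) by linarith+
  moreover have "E - F \<subseteq> cube I K" using sub[OF E(1)] by blast
  ultimately show ?thesis using E(1) meas[OF sub[OF E(1)]] meas[OF F(2)] meas[of "E - F"] by auto
qed

text \<open>Let E be a grid set close to F. The sets A q cover a fixed share of E relative to their
  size, yet avoid F, so they cover that much of E - F. The second moment bound limits what so small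
  a set can carry.\<close>

lemma measure_eq_0_if_avoids:
  fixes \<delta> :: "nat \<Rightarrow> real"
  assumes I: "finite I" "2 \<le> card I"
    and d: "\<And>q. 1 \<le> q \<Longrightarrow> 0 \<le> \<delta> q" "\<And>q. 1 \<le> q \<Longrightarrow> \<delta> q \<le> 1 / 2"
    and div: "\<not> summable (\<lambda>q. \<delta> q ^ card I)"
    and F: "F \<in> sets (leb I)" "F \<subseteq> cube I K" and m: "1 \<le> m"
    and avoid: "\<And>q. m \<le> q \<Longrightarrow> F \<inter> approx_set I K q (\<delta> q) = {}"
  shows "measure (leb I) F = 0"
proof (rule ccontr)
  define f where "f = measure (leb I) F"
  assume "measure (leb I) F \<noteq> 0"
  then have f: "0 < f" using measure_nonneg[of "leb I" F] unfolding f_def by linarith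
  define n where "n = card I"
  define c where "c = (1 / 16) * (2::real) ^ n"
  \<comment> \<open>The first term is for off-diagonal overlaps, the second for the diagonal; the 1
    keeps C positive even when K = 0.\<close>
  define C where "C = (24 * real K) ^ n + (4 * real K) ^ n + 1"
  have c: "0 < c" by (simp add: c_def)
  have C: "1 \<le> C" by (simp add: C_def)
  \<comment> \<open>With parameter L s the second moment bound reads 2 c |E| <= L e + C/L. This L
    makes C/L = c f/4, and e ensures L e <= c f/4 and |E| >= 3 f/4, so 3/2 c f <= 1/2 c f, which is
    absurd.\<close>
  define L where "L = 4 * C / (c * f)"
  have L: "0 < L" using c C f by (simp add: L_def)
  define e where "e = min (f / 4) (c * f / (4 * L))"
  have e: "0 < e" using f c L by (simp add: e_def)
  obtain E where E: "E \<in> grid_sets I K" "measure (leb I) (E - F) < e" "f - e < measure (leb I) E"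
    using grid_approximation[OF I(1) F e] unfolding f_def by blast
  obtain q0 where q0: "\<And>q t. q0 \<le> q \<Longrightarrow> 0 \<le> t \<Longrightarrow> t \<le> 1 / 2 \<Longrightarrow>
    (1 / 16) * (2 * t) ^ card I * measure (leb I) E \<le> measure (leb I) (approx_set I K q t \<inter> E)"
    using grid_set_lower_bound[OF I E(1)] by metis
  define q1 where "q1 = max m q0"
  have q1: "1 \<le> q1" "m \<le> q1" "q0 \<le> q1" using m by (auto simp: q1_def)
  have "\<exists>Q. 1 \<le> (\<Sum>q=q1..Q. \<delta> q ^ n)"
  proof (rule ccontr)
    assume neg: "\<nexists>Q. 1 \<le> (\<Sum>q=q1..Q. \<delta> q ^ n)"
    have "(\<Sum>k\<le>N. norm (\<delta> (k + q1) ^ n)) \<le> 1" for N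
    proof -
      have "(\<Sum>k\<le>N. norm (\<delta> (k + q1) ^ n)) = (\<Sum>k\<le>N. \<delta> (k + q1) ^ n)"
        using d(1) q1 by (intro sum.cong) auto
      also have "\<dots> = (\<Sum>q=q1..N + q1. \<delta> q ^ n)"
        using sum.shift_bounds_cl_nat_ivl[of "\<lambda>q. \<delta> q ^ n" 0 q1 N] by (simp add: atLeast0AtMost)
      also have "\<dots> \<le> 1" using neg by (meson le_cases)
      finally show ?thesis .
    qed
    then have "summable (\<lambda>k. norm (\<delta> (k + q1) ^ n))" by (intro bounded_imp_summable) auto
    then have "summable (\<lambda>k. \<delta> (k + q1) ^ n)" by (rule summable_norm_cancel)
    then show False using div summable_iff_shift[of "\<lambda>q. \<delta> q ^ n" q1] by (simp add: n_def)
  qed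
  then obtain Q where Q: "1 \<le> (\<Sum>q=q1..Q. \<delta> q ^ n)" by blast
  define s where "s = (\<Sum>q=q1..Q. \<delta> q ^ n)"
  have s: "1 \<le> s" using Q by (simp add: s_def)
  let ?A = "\<lambda>q. approx_set I K q (\<delta> q)"
  have Afm: "?A q \<in> fmeasurable (leb I)" if "q \<in> {q1..Q}" for q
    using that q1 d(1) I by (intro approx_set_fmeasurable) auto
  have Esets: "E \<in> sets (leb I)" "E - F \<in> fmeasurable (leb I)"
  proof -
    obtain j Z where "E = {y \<in> cube I K. cell_index I j y \<in> Z}" using E(1) by (auto simp: grid_sets_def)
    then have "E = (\<Union>z\<in>Z \<inter> (I \<rightarrow>\<^sub>E {- int (K * 2 ^ j)..<int (K * 2 ^ j)}). cell I j z)" "E \<subseteq> cube I K"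
      using grid_set_eq_UN_cells[of I K j Z] by auto
    then show "E \<in> sets (leb I)" using I by (auto intro!: sets.finite_UN cell_sets finite_PiE)
    then show "E - F \<in> fmeasurable (leb I)"
      using F \<open>E \<subseteq> cube I K\<close> by (intro fmeasurableI2[OF cube_fmeasurable[OF I(1), of K]]) auto
  qed
  have pos: "0 \<le> \<delta> q" if "q \<in> {q1..Q}" for q using d(1)[of q] q1 that by auto
  have spos: "0 \<le> (\<Sum>q=q1..Q. \<delta> q ^ n)" using pos by (intro sum_nonneg) auto
  have lower: "c * measure (leb I) E * s \<le> (\<Sum>q=q1..Q. measure (leb I) (?A q \<inter> (E - F)))"
  proof -
    have "c * measure (leb I) E * s = (\<Sum>q=q1..Q. (1 / 16) * (2 * \<delta> q) ^ card I * measure (leb I) E)"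
      unfolding s_def c_def sum_distrib_left by (simp add: n_def power_mult_distrib mult_ac)
    also have "\<dots> \<le> (\<Sum>q=q1..Q. measure (leb I) (?A q \<inter> E))"
      using q1 d by (intro sum_mono q0) auto
    also have "\<dots> = (\<Sum>q=q1..Q. measure (leb I) (?A q \<inter> (E - F)))"
    proof (rule sum.cong)
      fix q assume "q \<in> {q1..Q}"
      then have "?A q \<inter> E = ?A q \<inter> (E - F)" using avoid[of q] q1 by auto
      then show "measure (leb I) (?A q \<inter> E) = measure (leb I) (?A q \<inter> (E - F))" by (simp only:)
    qed simp
    finally show ?thesis .
  qed
  have "(\<Sum>q=q1..Q. \<Sum>r=q1..Q. measure (leb I) (?A q \<inter> ?A r))
      \<le> (\<Sum>q=q1..Q. \<Sum>r=q1..Q. (24 * real K) ^ n * \<delta> q ^ n * \<delta> r ^ n +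
          (if r = q then (4 * real K) ^ n * \<delta> q ^ n else 0))"
  proof (intro sum_mono)
    fix q r assume qr: "q \<in> {q1..Q}" "r \<in> {q1..Q}"
    show "measure (leb I) (?A q \<inter> ?A r) \<le> (24 * real K) ^ n * \<delta> q ^ n * \<delta> r ^ n +
          (if r = q then (4 * real K) ^ n * \<delta> q ^ n else 0)"
    proof (cases "r = q")
      case True
      have "measure (leb I) (?A q) \<le> (4 * real K * \<delta> q) ^ n"
        unfolding n_def using I pos[OF qr(1)] q1 qr by (intro measure_approx_set_le) auto
      moreover have "0 \<le> (24 * real K) ^ n * \<delta> q ^ n * \<delta> q ^ n" using pos[OF qr(1)] by simp
      ultimately show ?thesis using True by (simp add: power_mult_distrib)
    next
      case False
      have "measure (leb I) (?A q \<inter> ?A r) \<le> (24 * real K * \<delta> q * \<delta> r) ^ n"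
        unfolding n_def using I pos qr q1 False by (intro measure_approx_set_Int_le) auto
      then show ?thesis using False by (simp add: power_mult_distrib)
    qed
  qed
  also have "\<dots> = (24 * real K) ^ n * (s * s) + (4 * real K) ^ n * s"
  proof -
    have "(\<Sum>q=q1..Q. \<Sum>r=q1..Q. (24 * real K) ^ n * \<delta> q ^ n * \<delta> r ^ n) = (24 * real K) ^ n * (s * s)"
    proof -
      have "s * s = (\<Sum>q=q1..Q. \<Sum>r=q1..Q. \<delta> q ^ n * \<delta> r ^ n)" unfolding s_def by (rule sum_product)
      then show ?thesis by (simp only: sum_distrib_left mult.assoc)
    qed
    moreover have "(\<Sum>q=q1..Q. \<Sum>r=q1..Q. if r = q then (4 * real K) ^ n * \<delta> q ^ n else 0) = (4 * real K) ^ n * s"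
      unfolding s_def sum_distrib_left by (intro sum.cong) (auto simp: sum.delta)
    ultimately show ?thesis unfolding sum.distrib by (simp only:)
  qed
  \<comment> \<open>The diagonal is only of order s; a partial sum s >= 1, available by divergence,
    lets s * s absorb it.\<close>
  also have "\<dots> \<le> (24 * real K) ^ n * (s * s) + (4 * real K) ^ n * (s * s)"
    using s by (intro add_left_mono mult_left_mono) auto
  also have "\<dots> \<le> C * (s * s)"
    unfolding C_def distrib_right by simp
  finally have second: "(\<Sum>q=q1..Q. \<Sum>r=q1..Q. measure (leb I) (?A q \<inter> ?A r)) \<le> C * (s * s)" .
  have "2 * (c * measure (leb I) E * s) \<le> 2 * (\<Sum>q=q1..Q. measure (leb I) (?A q \<inter> (E - F)))"
    using lower by simp
  also have "\<dots> \<le> (L * s) * measure (leb I) (E - F) +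
      (\<Sum>q=q1..Q. \<Sum>r=q1..Q. measure (leb I) (?A q \<inter> ?A r)) / (L * s)"
    using Afm Esets L s by (intro second_moment_bound) auto
  also have "\<dots> \<le> (L * s) * e + (C * (s * s)) / (L * s)"
    using E(2) L s second by (intro add_mono mult_left_mono divide_right_mono) auto
  also have "\<dots> = s * (L * e + C / L)" using s L by (simp add: field_simps)
  finally have "s * (2 * (c * measure (leb I) E)) \<le> s * (L * e + C / L)"
    by (simp only: mult.commute mult.left_commute)
  then have "2 * (c * measure (leb I) E) \<le> L * e + C / L"
    using s by (subst (asm) mult_le_cancel_left_pos) auto
  moreover have "L * e \<le> c * f / 4"
  proof -
    have "L * e \<le> L * (c * f / (4 * L))" using L by (intro mult_left_mono) (auto simp: e_def)
    then show ?thesis using L by simp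
  qed
  moreover have "C / L = c * f / 4" using C c f by (simp add: L_def)
  moreover have "3 / 4 * (c * f) \<le> c * measure (leb I) E"
  proof -
    have "3 / 4 * f \<le> measure (leb I) E" using E(3) by (auto simp: e_def min_def split: if_splits)
    then have "c * (3 / 4 * f) \<le> c * measure (leb I) E" using c by (intro mult_left_mono) auto
    then show ?thesis by (simp only: mult.left_commute)
  qed
  moreover have "0 < c * f" using c f by simp
  ultimately show False by linarith
qed

text \<open>A point with only finitely many solutions lies in some cube and, from some index on, in
  no approximating set. Countably many sets \<open>F K m\<close> capture all such points, and each
  is null.\<close>

theorem gallagher:
  fixes \<delta> :: "nat \<Rightarrow> real"
  assumes I: "finite I" "2 \<le> card I"
    and d: "\<And>q. 1 \<le> q \<Longrightarrow> 0 \<le> \<delta> q" "\<And>q. 1 \<le> q \<Longrightarrow> \<delta> q \<le> 1 / 2"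
    and div: "\<not> summable (\<lambda>q. \<delta> q ^ card I)"
  shows "AE y in leb I. infinite {q. 1 \<le> q \<and> (\<forall>i\<in>I. \<exists>p::int. \<bar>real q * y i - real_of_int p\<bar> < \<delta> q)}"
proof -
  \<comment> \<open>\<open>Suc m\<close> restricts to q >= 1, where the hypotheses on \<delta>
    apply.\<close>
  define F where "F K m = cube I K - (\<Union>q\<in>{Suc m..}. approx_set I K q (\<delta> q))" for K m
  have null: "F K m \<in> null_sets (leb I)" for K m
  proof -
    have Fs: "F K m \<in> sets (leb I)"
    proof -
      have "(\<Union>q\<in>{Suc m..}. approx_set I K q (\<delta> q)) \<in> sets (leb I)"
        by (rule sets.countable_UN'') (auto simp: approx_set_sets[OF I(1)])
      then show ?thesis unfolding F_def by (rule sets.Diff[OF cube_sets[OF I(1)]])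
    qed
    have "measure (leb I) (F K m) = 0"
    proof (rule measure_eq_0_if_avoids[where \<delta> = \<delta> and m = "Suc m" and K = K])
      show "F K m \<subseteq> cube I K" by (auto simp: F_def)
      show "F K m \<inter> approx_set I K q (\<delta> q) = {}" if "Suc m \<le> q" for q
        using that by (auto simp: F_def)
    qed (use I d div Fs in auto)
    moreover have "F K m \<in> fmeasurable (leb I)"
    proof (rule fmeasurableI2[OF cube_fmeasurable[OF I(1), of K]])
      show "F K m \<subseteq> cube I K" by (auto simp: F_def)
    qed (rule Fs)
    ultimately have "emeasure (leb I) (F K m) = 0"
      using emeasure_eq_measure2[of "F K m" "leb I"] by simp
    then show ?thesis using Fs by (rule null_setsI)
  qed
  have ae: "AE y in leb I. \<forall>K. \<forall>m. y \<notin> F K m"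
    by (intro AE_all_countable[THEN iffD2] allI AE_not_in null)
  have key: "infinite {q. 1 \<le> q \<and> (\<forall>i\<in>I. \<exists>p::int. \<bar>real q * y i - real_of_int p\<bar> < \<delta> q)}"
    (is "infinite ?S") if y: "y \<in> space (leb I)" "\<forall>K m. y \<notin> F K m" for y
  proof
    assume "finite ?S"
    then have "\<exists>m. \<forall>q\<in>?S. q < m" by (simp only: finite_nat_set_iff_bounded)
    then obtain m where m: "\<forall>q\<in>?S. q < m" by (rule exE)
    obtain K :: nat where K: "\<And>i. i \<in> I \<Longrightarrow> \<bar>y i\<bar> < real K"
    proof -
      define b where "b = Max (insert 0 ((\<lambda>i. \<bar>y i\<bar>) ` I))"
      have b: "\<bar>y i\<bar> \<le> b" if "i \<in> I" for i using I that by (auto simp: b_def)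
      obtain K' :: nat where "b < real K'" using reals_Archimedean2 by blast
      then show ?thesis by (intro that[of K']) (use b in \<open>blast intro: le_less_trans\<close>)
    qed
    have "- real K \<le> y i" "y i < real K" if "i \<in> I" for i using K[OF that] by linarith+
    then have "y \<in> cube I K" using y(1) by (simp add: cube_def space_PiM PiE_iff)
    then obtain q where q: "Suc m \<le> q" "y \<in> approx_set I K q (\<delta> q)"
      using y(2) unfolding F_def by blast
    then obtain p where p: "y \<in> nbhd I q (\<delta> q) p" by (auto simp: approx_set_def)
    have "\<bar>real q * y i - real_of_int (p i)\<bar> < \<delta> q" if "i \<in> I" for i
    proof -
      have "(real_of_int (p i) - \<delta> q) / real q < y i" "y i < (real_of_int (p i) + \<delta> q) / real q"
        using p that by (auto simp: nbhd_def)
      then show ?thesis using q by (simp add: field_simps abs_less_iff)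
    qed
    then have "q \<in> ?S" using q by auto
    then have "q < m" using m by (rule bspec[rotated])
    then show False using q by simp
  qed
  show ?thesis using AE_space ae by eventually_elim (rule key)
qed

section \<open>Fibres over a fixed coordinate\<close>

lemma W_I:
  assumes d: "1 \<le> d" and y: "y \<in> {1..d} \<rightarrow>\<^sub>E UNIV"
    and inf: "infinite {q. 1 \<le> q \<and> (\<forall>i\<in>{1..d}. \<exists>p::int. \<bar>real q * y i - real_of_int p\<bar> < \<psi> q)}" (is "infinite ?Q")
  shows "y \<in> W d \<psi>"
proof -
  let ?S = "{(p, q). p \<in> {1..d} \<rightarrow>\<^sub>E (UNIV :: int set) \<and> 1 \<le> q \<and>
       (MAX i\<in>{1..d}. \<bar>real q * y i - real_of_int (p i)\<bar>) < \<psi> q}"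
  have "?Q \<subseteq> snd ` ?S"
  proof
    fix q assume "q \<in> ?Q"
    then obtain p where p: "1 \<le> q" "\<And>i. i \<in> {1..d} \<Longrightarrow> \<bar>real q * y i - real_of_int (p i)\<bar> < \<psi> q"
      by (simp only: mem_Collect_eq) metis
    have "(MAX i\<in>{1..d}. \<bar>real q * y i - real_of_int (restrict p {1..d} i)\<bar>) < \<psi> q"
      using d p(2) by (subst Max_less_iff) auto
    then have "(restrict p {1..d}, q) \<in> ?S" using p(1) by auto
    then show "q \<in> snd ` ?S" by (rule image_eqI[rotated]) simp
  qed
  then have "infinite ?S" using inf by (meson finite_imageI finite_subset)
  then show ?thesis using y by (simp add: W_def)
qed

text \<open>Monotonicity leaves two cases: either truncation changes only finitely many terms, or
  every truncated term with q >= 1 equals the positive constant b^d.\<close>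

lemma not_summable_min_const:
  fixes \<psi> :: "nat \<Rightarrow> real"
  assumes nonneg: "\<And>q. 1 \<le> q \<Longrightarrow> 0 \<le> \<psi> q" and anti: "antimono_on {1..} \<psi>"
    and div: "\<not> summable (\<lambda>q. \<psi> q ^ d)" and b: "0 < b"
  shows "\<not> summable (\<lambda>q. min (\<psi> q) b ^ d)"
proof (cases "\<exists>N\<ge>1. \<psi> N \<le> b")
  case True
  then obtain N where N: "1 \<le> N" "\<psi> N \<le> b" by blast
  have "min (\<psi> q) b = \<psi> q" if "N \<le> q" for q
    using monotone_onD[OF anti, of N q] N that by simp
  then have "\<forall>\<^sub>F q in sequentially. min (\<psi> q) b ^ d = \<psi> q ^ d"
    unfolding eventually_sequentially by (intro exI[of _ N] allI impI) simp
  then have "summable (\<lambda>q. min (\<psi> q) b ^ d) = summable (\<lambda>q. \<psi> q ^ d)" by (rule summable_cong)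
  then show ?thesis using div by simp
next
  case False
  show ?thesis
  proof
    assume "summable (\<lambda>q. min (\<psi> q) b ^ d)"
    then have "(\<lambda>q. min (\<psi> q) b ^ d) \<longlonglongrightarrow> 0" by (rule summable_LIMSEQ_zero)
    moreover have "\<forall>\<^sub>F q in sequentially. min (\<psi> q) b ^ d = b ^ d"
    proof -
      have "\<not> \<psi> q \<le> b" if "1 \<le> q" for q using False that by blast
      then show ?thesis unfolding eventually_sequentially by (intro exI[of _ 1] allI impI) (simp add: min_def)
    qed
    ultimately have "(\<lambda>q::nat. b ^ d) \<longlonglongrightarrow> 0" by (subst (asm) tendsto_cong)
    then have "b ^ d = 0" by (simp add: LIMSEQ_const_iff)
    then show False using b by simp
  qed
qed

theorem fibre_full_all:
  fixes \<psi> :: "nat \<Rightarrow> real"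
  assumes d: "3 \<le> d" and nonneg: "\<And>q. 1 \<le> q \<Longrightarrow> 0 \<le> \<psi> q" and anti: "antimono_on {1..} \<psi>"
    and div: "\<not> summable (\<lambda>q. \<psi> q ^ d)"
  shows "fibre_full d \<psi> x"
proof -
  \<comment> \<open>The cap 1/2 serves both the pigeonhole count, which needs radii at most 1, and
    the disjoint neighbourhoods in \<open>gallagher\<close>. Solutions for u are solutions for
    \<psi>.\<close>
  define u where "u q = min (\<psi> q) (1 / 2)" for q
  have u: "0 \<le> u q" "u q \<le> 1 / 2" "u (Suc q) \<le> u q" if "1 \<le> q" for q
    using nonneg[OF that] monotone_onD[OF anti, of q "Suc q"] that by (auto simp: u_def)
  have udiv: "\<not> summable (\<lambda>q. u q ^ Suc (d - 1))"
    using not_summable_min_const[OF nonneg anti div, of "1 / 2"] d by (simp add: u_def)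
  define S where "S = {q. \<exists>p::int. \<bar>real q * x - of_int p\<bar> < u q}"
  \<comment> \<open>The pigeonhole count uses the fixed radius \<open>u r\<close>; as u is
    non-increasing, every q <= r that it finds also satisfies the condition with its own radius
    \<open>u q\<close>.\<close>
  have cnt: "real r * u r / 2 - 1 \<le> real (card (S \<inter> {1..r}))" if r: "1 \<le> r" for r
  proof (cases "u r = 0")
    case False
    then have ur: "0 < u r" "u r \<le> 1" using u[OF r] by auto
    have mono: "u r \<le> u q" if "1 \<le> q" "q \<le> r" for q
      using that(2,1) u(3) by (induction rule: inc_induct) (auto intro: order_trans)
    have "real r * u r / 2 - 1 \<le> real (card {q \<in> {1..r}. \<exists>p::int. \<bar>real q * x - of_int p\<bar> < u r})"
      by (rule card_fract_close[OF ur])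
    also have "\<dots> \<le> real (card (S \<inter> {1..r}))"
      using mono by (intro of_nat_mono card_mono) (auto simp: S_def intro: less_le_trans)
    finally show ?thesis .
  qed simp
  \<comment> \<open>Radius zero off S encodes the first coordinate's condition: a strict inequality
    below \<delta> q can hold only for q in S.\<close>
  define \<delta> where "\<delta> q = (if q \<in> S then u q else 0)" for q
  have eq: "(\<lambda>q. \<delta> q ^ card {2..d}) = (\<lambda>q. if q \<in> S then u q ^ (d - 1) else 0)"
    using d by (auto simp: \<delta>_def fun_eq_iff)
  have "\<not> summable (\<lambda>q. \<delta> q ^ card {2..d})"
    unfolding eq using u cnt udiv d by (intro not_summable_restrict) auto
  then have "AE y in leb {2..d}. infinite {q. 1 \<le> q \<and> (\<forall>i\<in>{2..d}. \<exists>p::int. \<bar>real q * y i - real_of_int p\<bar> < \<delta> q)}"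
    using u d by (intro gallagher) (auto simp: \<delta>_def)
  then show ?thesis
    unfolding fibre_full_def
  proof (rule AE_mp[OF _ AE_I2], intro impI)
    fix y :: "nat \<Rightarrow> real"
    assume y: "y \<in> space (leb {2..d})"
      and inf: "infinite {q. 1 \<le> q \<and> (\<forall>i\<in>{2..d}. \<exists>p::int. \<bar>real q * y i - real_of_int p\<bar> < \<delta> q)}"
    show "y(1 := x) \<in> W d \<psi>"
    proof (rule W_I)
      show "y(1 := x) \<in> {1..d} \<rightarrow>\<^sub>E UNIV" using y d by (auto simp: space_PiM PiE_iff extensional_def)
      have "{q. 1 \<le> q \<and> (\<forall>i\<in>{2..d}. \<exists>p::int. \<bar>real q * y i - real_of_int p\<bar> < \<delta> q)} \<subseteq>
        {q. 1 \<le> q \<and> (\<forall>i\<in>{1..d}. \<exists>p::int. \<bar>real q * (y(1 := x)) i - real_of_int p\<bar> < \<psi> q)}"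
      proof clarify
        fix q i assume q: "1 \<le> q" and c: "\<forall>i\<in>{2..d}. \<exists>p::int. \<bar>real q * y i - real_of_int p\<bar> < \<delta> q"
          and i: "i \<in> {1..d}"
        \<comment> \<open>Membership in S is read off from one remaining coordinate, and index 2
          exists since d >= 3.\<close>
        have "\<exists>p::int. \<bar>real q * y 2 - real_of_int p\<bar> < \<delta> q" using c d by auto
        then have "0 < \<delta> q" by (meson abs_ge_zero le_less_trans)
        then have qS: "q \<in> S" by (auto simp: \<delta>_def split: if_splits)
        then have le: "\<delta> q \<le> \<psi> q" by (auto simp: \<delta>_def u_def)
        show "\<exists>p::int. \<bar>real q * (y(1 := x)) i - real_of_int p\<bar> < \<psi> q"
        proof (cases "i = 1")
          case True
          then show ?thesis using qS by (auto simp: S_def u_def)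
        next
          case False
          then have "i \<in> {2..d}" using i by auto
          then show ?thesis using c le False by (fastforce intro: less_le_trans)
        qed
      qed
      then show "infinite {q. 1 \<le> q \<and> (\<forall>i\<in>{1..d}. \<exists>p::int. \<bar>real q * (y(1 := x)) i - real_of_int p\<bar> < \<psi> q)}"
        using inf by (meson finite_subset)
    qed (use d in simp)
  qed
qed

text \<open>On a rational line in the plane divergence of \<open>\<Sum>\<psi>(q)\<^sup>2\<close> leaves so much room that
  Dirichlet's theorem suffices, for every point of the line.\<close>

lemma fibre_full_rational_plane:
  fixes \<psi> :: "nat \<Rightarrow> real"
  assumes nonneg: "\<And>q. 1 \<le> q \<Longrightarrow> 0 \<le> \<psi> q" and anti: "antimono_on {1..} \<psi>"
    and div: "\<not> summable (\<lambda>q. \<psi> q ^ 2)" and x: "x \<in> \<rat>"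
  shows "fibre_full 2 \<psi> x"
proof -
  obtain a :: int and b :: nat where b: "0 < b" "x = of_int a / of_nat b"
    using x by (metis Rats_cases' of_int_of_nat_eq pos_int_cases)
  have mono: "\<psi> r \<le> \<psi> q" if "1 \<le> q" "q \<le> r" for q r using monotone_onD[OF anti, of q r] that by simp
  \<comment> \<open>If \<psi> (b N) < 1/N for all N >= M, monotonicity spreads this to \<psi> q <= 2
    b/q for large q, and the squares would be summable.\<close>
  have large: "\<exists>N\<ge>M. 1 / real N \<le> \<psi> (b * N)" for M
  proof (rule ccontr)
    assume neg: "\<not> ?thesis"
    define M' where "M' = b * Suc M"
    have bound: "\<psi> q \<le> 2 * real b / real q" if q: "M' \<le> q" for q
    proof -
      define N where "N = q div b"
      have N: "Suc M \<le> N" using q b unfolding N_def M'_def by (metis div_le_mono nonzero_mult_div_cancel_left not_less0)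
      have "b * N \<le> q" by (simp add: N_def)
      then have "\<psi> q \<le> \<psi> (b * N)" using b N by (intro mono) auto
      also have "\<dots> < 1 / real N" using neg N by (metis Suc_leD not_le)
      also have "\<dots> \<le> 2 * real b / real q"
      proof -
        have "q < b * Suc N" using b unfolding N_def by (metis dividend_less_times_div mult_Suc_right)
        moreover have "b * Suc N \<le> b * (2 * N)" using N by (intro mult_le_mono2) simp
        ultimately have "q \<le> b * (2 * N)" by linarith
        then have "real q \<le> real (b * (2 * N))" by (simp only: of_nat_le_iff)
        moreover have "0 < q" using q b by (auto simp: M'_def intro: Nat.gr0I)
        ultimately show ?thesis using N by (simp add: field_simps)
      qed
      finally show ?thesis by simp
    qed
    have "summable (\<lambda>q. \<psi> q ^ 2)"
    proof (rule summable_comparison_test'[where N = M'])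
      have "summable (\<lambda>q. (2 * real b)\<^sup>2 * inverse (real q ^ 2))"
        by (intro summable_mult inverse_power_summable) simp
      then show "summable (\<lambda>q. (2 * real b / real q)\<^sup>2)" by (simp add: power_divide divide_inverse power_mult_distrib power_inverse)
      fix q assume q: "M' \<le> q"
      have "1 \<le> M'" using b by (simp add: M'_def)
      then show "norm (\<psi> q ^ 2) \<le> (2 * real b / real q)\<^sup>2"
        using bound[OF q] nonneg[of q] q by (simp add: power_mono)
    qed
    then show False using div by simp
  qed
  show ?thesis
    unfolding fibre_full_def
  proof (rule AE_I2)
    fix y :: "nat \<Rightarrow> real"
    assume y: "y \<in> space (leb {2..2})"
    let ?y = "y(1 := x)"
    let ?Q = "{q. 1 \<le> q \<and> (\<forall>i\<in>{1..2}. \<exists>p::int. \<bar>real q * ?y i - real_of_int p\<bar> < \<psi> q)}"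
    \<comment> \<open>For denominators divisible by b the first coordinate has error zero, so only
      approximations to \<open>y 2\<close> by such denominators remain to be found.\<close>
    have Q: "b * k \<in> ?Q" if k: "1 \<le> k" and p: "\<bar>real (b * k) * y 2 - real_of_int p\<bar> < \<psi> (b * k)" for k and p :: int
    proof -
      have z: "real (b * k) * x - real_of_int (a * int k) = 0" using b by simp
      have "0 < \<psi> (b * k)" using p by linarith
      then have "\<bar>real (b * k) * x - real_of_int (a * int k)\<bar> < \<psi> (b * k)" unfolding z by simp
      then have 1: "\<bar>real (b * k) * ?y 1 - real_of_int (a * int k)\<bar> < \<psi> (b * k)" by (simp only: fun_upd_same)
      have 2: "\<bar>real (b * k) * ?y 2 - real_of_int p\<bar> < \<psi> (b * k)" using p by simp
      show ?thesis
      proof (intro CollectI conjI ballI)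
        fix i :: nat assume "i \<in> {1..2}"
        then have "i = 1 \<or> i = 2" by auto
        then show "\<exists>p::int. \<bar>real (b * k) * ?y i - real_of_int p\<bar> < \<psi> (b * k)"
          by (elim disjE; hypsubst) (rule exI, rule 1, rule exI, rule 2)
      qed (use k b in simp)
    qed
    have pos: "0 < \<psi> q" if q: "1 \<le> q" for q
    proof -
      obtain N where N: "q \<le> N" "1 / real N \<le> \<psi> (b * N)" using large[of q] by auto
      have "0 < 1 / real N" using N q by simp
      also have "\<dots> \<le> \<psi> (b * N)" by (rule N)
      also have "\<dots> \<le> \<psi> q" using N q b by (intro mono) (auto simp: le_trans[of _ N])
      finally show ?thesis .
    qed
    have "infinite ?Q"
    \<comment> \<open>If some multiple b k of b is an exact denominator of \<open>y 2\<close>, all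
      its multiples are solutions. Otherwise all errors are positive, and Dirichlet's theorem with N
      large gives an error below the minimum over any finite set of solutions.\<close>
    proof (cases "\<exists>k\<ge>1. \<exists>p::int. real (b * k) * y 2 = real_of_int p")
      case True
      then obtain k and p :: int where k: "1 \<le> k" "real (b * k) * y 2 = real_of_int p" by blast
      have mem: "b * (k * j) \<in> ?Q" if j: "1 \<le> j" for j
      proof (rule Q)
        have "real (b * (k * j)) * y 2 = real (b * k) * y 2 * real j" by simp
        then have z: "real (b * (k * j)) * y 2 - real_of_int (p * int j) = 0" using k(2) by simp
        show "\<bar>real (b * (k * j)) * y 2 - real_of_int (p * int j)\<bar> < \<psi> (b * (k * j))"
          unfolding z using pos[of "b * (k * j)"] k j b by simp
      qed (use k j in simp)
      have "(\<lambda>j. b * (k * j)) ` {1..} \<subseteq> ?Q" by (rule image_subsetI, rule mem) simp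
      moreover have "infinite ((\<lambda>j. b * (k * j)) ` {1..})"
        using k b by (subst finite_image_iff) (auto simp: inj_on_def infinite_Ici)
      ultimately show ?thesis by (meson finite_subset)
    next
      case False
      show ?thesis
      proof
        assume fin: "finite ?Q"
        define QQ where "QQ = ?Q"
        \<comment> \<open>The distance to the nearest integer bounds the error for every numerator,
          in particular the one that Dirichlet's theorem returns.\<close>
        define h where "h q = \<bar>real q * y 2 - real_of_int (round (real q * y 2))\<bar>" for q
        define Q' where "Q' = {k. 1 \<le> k \<and> b * k \<in> QQ}"
        have "finite Q'"
        proof (rule finite_subset)
          show "Q' \<subseteq> (\<lambda>q. q div b) ` QQ"
          proof
            fix k assume "k \<in> Q'"
            then show "k \<in> (\<lambda>q. q div b) ` QQ"
              using b by (intro image_eqI[of _ _ "b * k"]) (auto simp: Q'_def)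
          qed
        qed (use fin in \<open>simp only: QQ_def finite_imageI\<close>)
        have hpos: "0 < h (b * k)" if "1 \<le> k" for k
          
        proof -
          have "real (b * k) * y 2 \<noteq> real_of_int (round (real (b * k) * y 2))" using False that by blast
          then show ?thesis unfolding h_def by simp
        qed
        define e where "e = Min (insert 1 ((\<lambda>k. h (b * k)) ` Q'))"
        have e: "0 < e" using \<open>finite Q'\<close> hpos by (auto simp: e_def Q'_def)
        obtain M :: nat where M: "1 / e < real M" using reals_Archimedean2 by blast
        moreover have "0 < 1 / e" using e by simp
        ultimately have M0: "0 < M" by (cases "M = 0") auto
        obtain N where N: "M \<le> N" "1 / real N \<le> \<psi> (b * N)" using large by blast
        have N0: "0 < N" using N M0 by simp
        obtain k p where kp: "0 < k" "k \<le> int N" "\<bar>of_int k * (real b * y 2) - of_int p\<bar> < 1 / real N"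
          using Dirichlet_approx[of N "real b * y 2"] N0 by blast
        define k' where "k' = nat k"
        have k': "1 \<le> k'" "k' \<le> N" "\<bar>real (b * k') * y 2 - of_int p\<bar> < 1 / real N"
          using kp by (auto simp: k'_def mult_ac)
        have "\<psi> (b * N) \<le> \<psi> (b * k')" using k' b by (intro mono) auto
        then have "b * k' \<in> QQ" unfolding QQ_def using k' N by (intro Q[of k' p]) linarith+
        then have "k' \<in> Q'" using k' by (simp add: Q'_def)
        then have "e \<le> h (b * k')" using \<open>finite Q'\<close> by (auto simp: e_def)
        also have "\<dots> \<le> \<bar>real (b * k') * y 2 - of_int p\<bar>"
          unfolding h_def by (metis abs_minus_commute round_diff_minimal)
        also have "\<dots> < 1 / real N" by (rule k')
        also have "\<dots> \<le> 1 / real M" using N M0 by (intro divide_left_mono) auto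
        also have "\<dots> < e" using M M0 e by (simp add: field_simps)
        finally show False .
      qed
    qed
    moreover have "?y \<in> {1..2} \<rightarrow>\<^sub>E UNIV" using y by (auto simp: space_PiM PiE_iff extensional_def)
    ultimately show "?y \<in> W 2 \<psi>" by (intro W_I) auto
  qed
qed

section \<open>Continued fractions\<close>

lemma complete_quotient_irrational:
  assumes "x \<notin> \<rat>"
  shows "complete_quotient x n \<notin> \<rat>"
proof (induction n)
  case (Suc n)
  have "frac (complete_quotient x n) \<notin> \<rat>"
  proof
    assume "frac (complete_quotient x n) \<in> \<rat>"
    then have "frac (complete_quotient x n) + of_int \<lfloor>complete_quotient x n\<rfloor> \<in> \<rat>"
      by (intro Rats_add Rats_of_int)
    then show False using Suc by (simp add: frac_def)
  qed
  then show ?case using Rats_inverse[of "1 / frac (complete_quotient x n)"] by (auto simp: divide_inverse)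
qed (use assms in simp)

lemma complete_quotient_gt_1:
  assumes "x \<notin> \<rat>"
  shows "1 < complete_quotient x (Suc n)"
proof -
  have "complete_quotient x n \<notin> \<int>"
    using complete_quotient_irrational[OF assms] Ints_subset_Rats by blast
  then show ?thesis using frac_lt_1[of "complete_quotient x n"] frac_gt_0_iff by (simp add: field_simps)
qed

lemma partial_quotient_ge_1:
  assumes "x \<notin> \<rat>"
  shows "1 \<le> partial_quotient x (Suc n)"
  using complete_quotient_gt_1[OF assms, of n] by (simp add: partial_quotient_def le_floor_iff)

lemma continuant'_pos:
  assumes "x \<notin> \<rat>"
  shows "0 \<le> continuant' x n \<and> 1 \<le> continuant' x (Suc n)"
proof (induction n)
  case (Suc n)
  have "1 * 1 \<le> partial_quotient x (Suc n) * continuant' x (Suc n)"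
    using partial_quotient_ge_1[OF assms, of n] Suc by (intro mult_mono) auto
  then show ?case using Suc by simp
qed simp

lemma continuant'_mono:
  assumes "x \<notin> \<rat>"
  shows "continuant' x n \<le> continuant' x (Suc n)"
proof (cases n)
  case (Suc k)
  have "1 * continuant' x (Suc k) \<le> partial_quotient x (Suc k) * continuant' x (Suc k)"
    using partial_quotient_ge_1[OF assms, of k] continuant'_pos[OF assms, of k] by (intro mult_right_mono) auto
  then show ?thesis unfolding Suc continuant'.simps using continuant'_pos[OF assms, of k] by linarith
qed simp

lemma continuant'_strict_mono:
  assumes "x \<notin> \<rat>"
  shows "continuant' x (Suc (Suc n)) < continuant' x (Suc (Suc (Suc n)))"
proof -
  have "1 * continuant' x (Suc (Suc n)) \<le> partial_quotient x (Suc (Suc n)) * continuant' x (Suc (Suc n))"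
    using partial_quotient_ge_1[OF assms, of "Suc n"] continuant'_pos[OF assms, of "Suc n"]
    by (intro mult_right_mono) linarith+
  moreover have "1 \<le> continuant' x (Suc n)" using continuant'_pos[OF assms, of n] by blast
  ultimately show ?thesis by (subst continuant'.simps(3)) linarith
qed

text \<open>The absolute error of a convergent is a product of fractional parts of complete
  quotients, and the signs alternate. For opposite signs the determinant identity becomes the sum of
  positive terms in \<open>det\<close>; dropping one of them gives the bound.\<close>

lemma convergent_error:
  assumes "x \<notin> \<rat>"
  shows "\<exists>p::int. \<bar>of_int (continuant' x (Suc n)) * x - of_int p\<bar> < 1 / of_int (continuant' x (Suc (Suc n)))"
proof -
  \<comment> \<open>Numerators of the convergents with the index shift of
    \<open>continuant'\<close>; pairs turn the two-step recurrence into a primitive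
    recursion.\<close>
  define P where "P = rec_nat (1::int, \<lfloor>x\<rfloor>) (\<lambda>n (p0, p1). (p1, partial_quotient x (Suc n) * p1 + p0))"
  define p where "p n = fst (P n)" for n
  have pS: "snd (P n) = p (Suc n)" for n by (simp add: p_def P_def case_prod_beta)
  have p: "p 0 = 1" "p (Suc 0) = \<lfloor>x\<rfloor>" "p (Suc (Suc n)) = partial_quotient x (Suc n) * p (Suc n) + p n" for n
    using pS[of n] by (auto simp: p_def P_def case_prod_beta)
  define f where "f n = (\<Prod>i<n. frac (complete_quotient x i))" for n
  have fr: "0 < frac (complete_quotient x i)" "frac (complete_quotient x i) < 1" for i
    using complete_quotient_irrational[OF assms, of i] Ints_subset_Rats frac_lt_1 by (auto simp: frac_gt_0_iff)
  have fpos: "0 < f n" for n unfolding f_def using fr by (intro prod_pos) auto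
  have cq: "of_int (partial_quotient x (Suc n)) * f (Suc n) + f (Suc (Suc n)) = f n" for n
  proof -
    have "of_int (partial_quotient x (Suc n)) * f (Suc n) + f (Suc (Suc n))
       = f (Suc n) * complete_quotient x (Suc n)"
      by (simp add: f_def partial_quotient_def frac_def algebra_simps del: complete_quotient.simps)
    also have "\<dots> = f n" using fr(1)[of n] by (simp add: f_def)
    finally show ?thesis .
  qed
  have e: "of_int (continuant' x n) * x - of_int (p n) = (-1) ^ Suc n * f n \<and>
      of_int (continuant' x (Suc n)) * x - of_int (p (Suc n)) = (-1) ^ Suc (Suc n) * f (Suc n)" for n
  proof (induction n)
    case 0
    show ?case by (simp add: p f_def frac_def)
  next
    case (Suc n)
    have "of_int (continuant' x (Suc (Suc n))) * x - of_int (p (Suc (Suc n)))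
      = of_int (partial_quotient x (Suc n)) * (of_int (continuant' x (Suc n)) * x - of_int (p (Suc n)))
        + (of_int (continuant' x n) * x - of_int (p n))"
      by (simp add: p algebra_simps)
    also have "\<dots> = (-1) ^ Suc n * (f n - of_int (partial_quotient x (Suc n)) * f (Suc n))"
      using Suc by (simp add: algebra_simps)
    also have "f n - of_int (partial_quotient x (Suc n)) * f (Suc n) = f (Suc (Suc n))"
      using cq[of n] by linarith
    finally show ?case using Suc by simp
  qed
  have det: "of_int (continuant' x (Suc n)) * f n + of_int (continuant' x n) * f (Suc n) = 1" for n
  proof (induction n)
    case (Suc n)
    have "of_int (continuant' x (Suc (Suc n))) * f (Suc n) + of_int (continuant' x (Suc n)) * f (Suc (Suc n))
      = of_int (continuant' x (Suc n)) * (of_int (partial_quotient x (Suc n)) * f (Suc n) + f (Suc (Suc n)))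
        + of_int (continuant' x n) * f (Suc n)"
      by (simp add: algebra_simps)
    also have "\<dots> = 1" unfolding cq by (rule Suc)
    finally show ?case .
  qed (simp add: f_def)
  have pos: "(0::real) < of_int (continuant' x (Suc k))" for k
    using continuant'_pos[OF assms, of k] by simp
  have "of_int (continuant' x (Suc (Suc n))) * f (Suc n) < 1"
    using det[of "Suc n"] pos[of n] fpos[of "Suc (Suc n)"] by (smt (verit) mult_pos_pos)
  then have "f (Suc n) < 1 / of_int (continuant' x (Suc (Suc n)))"
    using pos[of "Suc n"] by (simp add: field_simps)
  moreover have "\<bar>of_int (continuant' x (Suc n)) * x - of_int (p (Suc n))\<bar> = f (Suc n)"
    using e[of n] fpos[of "Suc n"] by (simp add: abs_mult)
  ultimately show ?thesis by (intro exI[of _ "p (Suc n)"]) simp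
qed

lemma W1_I:
  assumes "infinite {q::nat. 1 \<le> q \<and> (\<exists>p::int. \<bar>real q * x - of_int p\<bar> < real q powr - \<tau>)}"
  shows "x \<in> W1 \<tau>"
  unfolding W1_def mem_Collect_eq
proof (rule W_I)
  have "{q. 1 \<le> q \<and> (\<forall>i\<in>{1..1::nat}. \<exists>p::int. \<bar>real q * (\<lambda>i\<in>{1}. x) i - real_of_int p\<bar> < real q powr - \<tau>)}
      = {q::nat. 1 \<le> q \<and> (\<exists>p::int. \<bar>real q * x - of_int p\<bar> < real q powr - \<tau>)}" by simp
  then show "infinite {q. 1 \<le> q \<and> (\<forall>i\<in>{1..1::nat}. \<exists>p::int. \<bar>real q * (\<lambda>i\<in>{1}. x) i - real_of_int p\<bar> < real q powr - \<tau>)}"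
    using assms by (simp only: not_False_eq_True)
qed auto

text \<open>If q_{n+1} >= q_n^\<tau> infinitely often, those convergents have error below
  q_n^(-\<tau>) and put x into \<open>W1\<close> \<tau>.\<close>

lemma continuant'_growth:
  assumes x: "x \<notin> \<rat>" and W: "x \<notin> W1 \<tau>"
  shows "\<forall>\<^sub>F n in sequentially. of_int (continuant' x (Suc (Suc n))) < of_int (continuant' x (Suc n)) powr \<tau>"
proof (rule ccontr)
  assume "\<not> ?thesis"
  then have freq: "\<exists>\<^sub>F n in sequentially. of_int (continuant' x (Suc n)) powr \<tau> \<le> of_int (continuant' x (Suc (Suc n)))"
    by (simp add: not_eventually not_less)
  \<comment> \<open>The index 0 is excluded because q_0 = q_1 may happen; from then on the
    denominators are distinct, so infinitely many indices give infinitely many of them.\<close>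
  define B where "B = {n. of_int (continuant' x (Suc n)) powr \<tau> \<le> of_int (continuant' x (Suc (Suc n))) \<and> 1 \<le> n}"
  have "infinite B"
    unfolding infinite_nat_iff_unbounded_le
  proof
    fix m
    obtain n where "Suc m \<le> n" "of_int (continuant' x (Suc n)) powr \<tau> \<le> of_int (continuant' x (Suc (Suc n)))"
      using freq unfolding frequently_sequentially by blast
    then show "\<exists>n\<ge>m. n \<in> B" by (intro exI[of _ n]) (simp add: B_def del: continuant'.simps)
  qed
  have inj: "inj_on (\<lambda>n. nat (continuant' x (Suc n))) B"
  proof -
    have "strict_mono (\<lambda>n. continuant' x (Suc (Suc n)))"
      unfolding strict_mono_Suc_iff using continuant'_strict_mono[OF x] by blast
    then have inj: "inj (\<lambda>n. continuant' x (Suc (Suc n)))" by (rule strict_mono_imp_inj_on)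
    show ?thesis
    proof (rule inj_onI)
      fix n m assume nm: "n \<in> B" "m \<in> B" "nat (continuant' x (Suc n)) = nat (continuant' x (Suc m))"
      then obtain n' m' where "n = Suc n'" "m = Suc m'" by (cases n; cases m) (auto simp: B_def)
      moreover have "continuant' x (Suc n) = continuant' x (Suc m)"
        using nm(3) continuant'_pos[OF x, of n] continuant'_pos[OF x, of m] by linarith
      ultimately show "n = m" using inj by (simp add: inj_def del: continuant'.simps)
    qed
  qed
  have sub: "(\<lambda>n. nat (continuant' x (Suc n))) ` B \<subseteq> {q::nat. 1 \<le> q \<and> (\<exists>p::int. \<bar>real q * x - of_int p\<bar> < real q powr - \<tau>)}"
  proof (rule image_subsetI)
    fix n assume n: "n \<in> B"
    let ?q = "nat (continuant' x (Suc n))"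
    have q: "real ?q = of_int (continuant' x (Suc n))" "1 \<le> ?q" using continuant'_pos[OF x, of n] by auto
    obtain p where p: "\<bar>real ?q * x - of_int p\<bar> < 1 / of_int (continuant' x (Suc (Suc n)))"
      using convergent_error[OF x, of n] unfolding q by blast
    have "1 / of_int (continuant' x (Suc (Suc n))) \<le> 1 / (real ?q powr \<tau>)"
      using n q by (intro divide_left_mono) (auto simp: B_def intro!: mult_pos_pos simp del: continuant'.simps
        intro: less_le_trans[of 0 "real ?q powr \<tau>"])
    then have "\<bar>real ?q * x - of_int p\<bar> < real ?q powr - \<tau>" using p by (simp add: powr_minus_divide)
    then show "?q \<in> {q::nat. 1 \<le> q \<and> (\<exists>p::int. \<bar>real q * x - of_int p\<bar> < real q powr - \<tau>)}" using q by blast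
  qed
  have inf: "infinite ((\<lambda>n. nat (continuant' x (Suc n))) ` B)"
    using inj \<open>infinite B\<close> by (simp add: finite_image_iff)
  have "x \<in> W1 \<tau>" by (rule W1_I[OF infinite_super[OF sub inf]])
  then show False using W by simp
qed

section \<open>Positive density\<close>

lemma sum_ge_of_interval:
  fixes u v :: nat
  assumes "finite B" "{u..v} \<subseteq> B"
  shows "(real v - real u + 1) * real u \<le> (\<Sum>n\<in>B. real n)"
proof -
  have "(real v - real u + 1) * real u \<le> real (card {u..v}) * real u"
    by (intro mult_right_mono) (auto simp: of_nat_diff)
  also have "\<dots> = (\<Sum>n\<in>{u..v}. real u)" by simp
  also have "\<dots> \<le> (\<Sum>n\<in>{u..v}. real n)" by (intro sum_mono) auto
  also have "\<dots> \<le> (\<Sum>n\<in>B. real n)" using assms by (intro sum_mono2) auto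
  finally show ?thesis .
qed

context
  fixes x :: real and R :: int
  assumes x: "x \<notin> \<rat>" and R: "1 \<le> R" and infinite_large: "infinite (large_indices x R)"
begin

text \<open>Index dictionary: \<open>large_pos m\<close> is k_{m+1} and \<open>den (Suc k)\<close>
  is q_k. With k = k_{m+1}, the block numbered \<open>Suc m\<close> ends at q_k, and the next one
  starts at q_{k+1} - R q_k.\<close>

abbreviation "large_pos \<equiv> enumerate (large_indices x R)"
abbreviation "den \<equiv> continuant' x"
abbreviation "block_end \<equiv> block_end_pos x R"

lemma large_index_simps:
  "continuant x (large_index x R (Suc m)) = den (Suc (large_pos m))"
  "continuant x (large_index x R (Suc m) + 1) = den (Suc (Suc (large_pos m)))"
  by (simp_all add: continuant_def large_index_def nat_add_distrib del: continuant'.simps)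

lemma block_start_simps:
  "block_start x R (Suc 0) = 1"
  "block_start x R (Suc (Suc m)) = den (Suc (Suc (large_pos m))) - R * den (Suc (large_pos m))"
  by (simp_all add: block_start_def large_index_simps del: continuant'.simps)
     (simp add: continuant_def large_index_def)

lemma block_Suc: "block x R (Suc m) = {n. block_start x R (Suc m) \<le> int n \<and> int n \<le> den (Suc (large_pos m))}"
  using infinite_large by (simp add: block_def large_index_simps del: continuant'.simps)

lemma den_mono: "i \<le> j \<Longrightarrow> den i \<le> den j"
  using continuant'_mono[OF x] by (rule lift_Suc_mono_le)

lemma den_pos: "1 \<le> den (Suc i)"
  using continuant'_pos[OF x, of i] by blast

text \<open>A partial quotient of at least R + 1 leaves one copy of q_k after R q_k is
  subtracted.\<close>

lemma block_start_ge: "den (Suc (large_pos m)) \<le> block_start x R (Suc (Suc m))"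
proof -
  have "large_pos m \<in> large_indices x R" using enumerate_in_set[OF infinite_large] .
  then have "R + 1 \<le> partial_quotient x (Suc (large_pos m))" by (simp add: large_indices_def)
  then have "(R + 1) * den (Suc (large_pos m)) \<le> partial_quotient x (Suc (large_pos m)) * den (Suc (large_pos m))"
    using den_pos[of "large_pos m"] by (intro mult_right_mono) auto
  moreover have "0 \<le> den (large_pos m)" using continuant'_pos[OF x] by blast
  moreover have "den (Suc (Suc (large_pos m))) = partial_quotient x (Suc (large_pos m)) * den (Suc (large_pos m)) + den (large_pos m)"
    by (rule continuant'.simps)
  ultimately show ?thesis unfolding block_start_simps by (simp add: algebra_simps del: continuant'.simps)
qed

lemma block_start_ge_1: "1 \<le> block_start x R (Suc m)"
  using block_start_ge den_pos by (cases m) (auto simp: block_start_simps(1) intro: order_trans)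

lemma block_start_le: "block_start x R (Suc m) \<le> den (Suc (large_pos m))"
proof (cases m)
  case (Suc l)
  have "Suc (large_pos l) \<le> large_pos m" using enumerate_step[OF infinite_large, of l] Suc by simp
  then have "den (Suc (Suc (large_pos l))) \<le> den (Suc (large_pos m))" by (intro den_mono) simp
  moreover have "0 \<le> R * den (Suc (large_pos l))" using R den_pos[of "large_pos l"] by simp
  ultimately show ?thesis using Suc by (simp add: block_start_simps(2) del: continuant'.simps)
qed (use den_pos block_start_simps(1) in simp)

lemma block_eq_atLeastAtMost: "block x R (Suc m) = {nat (block_start x R (Suc m))..nat (den (Suc (large_pos m)))}"
  unfolding block_Suc using block_start_ge_1[of m] den_pos[of "large_pos m"] by (auto simp del: continuant'.simps)

lemma finite_block: "finite (block x R m)"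
proof (cases m)
  case 0
  then show ?thesis by (simp add: block_def)
qed (simp add: block_eq_atLeastAtMost)

lemma card_block_pos: "0 < card (block x R (Suc m))"
  unfolding block_eq_atLeastAtMost using block_start_le[of m] block_start_ge_1[of m] by simp

section \<open>Positions and partial sums in the concatenated sequence\<close>

lemma block_end_Suc: "block_end (Suc m) = block_end m + card (block x R (Suc m))"
  by (simp add: block_end_pos_def)

lemma block_end_mono: "i \<le> j \<Longrightarrow> block_end i \<le> block_end j"
  by (rule lift_Suc_mono_le) (simp_all add: block_end_Suc)

lemma block_at_eq:
  assumes "block_end m < n" "n \<le> block_end (Suc m)"
  shows "block_at x R n = Suc m"
  unfolding block_at_def
proof (rule Least_equality)
  fix m' assume "infinite (block x R m') \<or> n \<le> block_end m'"
  then have "n \<le> block_end m'" using finite_block by blast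
  then show "Suc m \<le> m'" using assms block_end_mono[of m' m] by (meson leI le_less_trans less_Suc_eq_le not_less)
qed (use assms in simp)

lemma concat_blocks_eq:
  assumes "i < card (block x R (Suc m))"
  shows "concat_blocks x R (block_end m + 1 + i) = enumerate (block x R (Suc m)) i"
proof -
  have "block_at x R (block_end m + 1 + i) = Suc m" using assms by (intro block_at_eq) (auto simp: block_end_Suc)
  then show ?thesis by (simp add: concat_blocks_def block_start_pos_def)
qed

lemma concat_blocks_start:
  "concat_blocks x R (block_start_pos x R (Suc m)) = nat (block_start x R (Suc m))"
proof -
  have "concat_blocks x R (block_start_pos x R (Suc m)) = enumerate (block x R (Suc m)) 0"
    using concat_blocks_eq[of 0 m] card_block_pos by (simp add: block_start_pos_def)
  also have "\<dots> = (LEAST n. n \<in> block x R (Suc m))" by (simp add: enumerate_0)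
  also have "\<dots> = nat (block_start x R (Suc m))"
    unfolding block_eq_atLeastAtMost using block_start_le[of m] by (intro Least_equality) auto
  finally show ?thesis .
qed

lemma sum_concat_blocks:
  "(\<Sum>n\<in>{block_end m + 1..block_end (Suc m)}. concat_blocks x R n) = \<Sum>(block x R (Suc m))"
proof -
  let ?B = "block x R (Suc m)"
  have "(\<Sum>n\<in>{block_end m + 1..block_end (Suc m)}. concat_blocks x R n) = (\<Sum>i<card ?B. concat_blocks x R (block_end m + 1 + i))"
    by (rule sum.reindex_bij_witness[of _ "\<lambda>i. block_end m + 1 + i" "\<lambda>n. n - (block_end m + 1)"]) (auto simp: block_end_Suc)
  also have "\<dots> = (\<Sum>i<card ?B. enumerate ?B i)"
    by (intro sum.cong) (auto simp only: lessThan_iff concat_blocks_eq)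
  also have "\<dots> = \<Sum>?B"
    using finite_bij_enumerate[OF finite_block] by (rule sum.reindex_bij_betw)
  finally show ?thesis .
qed

text \<open>Of all the earlier blocks only the last is kept; its sum alone will be comparable with
  the start of the next block.\<close>

lemma concat_sum_ge:
  "block_start x R (Suc (Suc m)) + \<Sum>(int ` block x R (Suc m)) \<le> int (concat_sum x R (block_start_pos x R (Suc (Suc m))))"
proof -
  have s: "block_start_pos x R (Suc (Suc m)) = Suc (block_end (Suc m))" by (simp add: block_start_pos_def)
  have "(\<Sum>n\<in>{block_end m + 1..block_end (Suc m)}. concat_blocks x R n) \<le> (\<Sum>n=1..block_end (Suc m). concat_blocks x R n)"
    by (intro sum_mono2) auto
  then have "\<Sum>(block x R (Suc m)) + concat_blocks x R (Suc (block_end (Suc m))) \<le> concat_sum x R (Suc (block_end (Suc m)))"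
    using sum_concat_blocks[of m] by (simp add: concat_sum_def)
  moreover have "int (concat_blocks x R (Suc (block_end (Suc m)))) = block_start x R (Suc (Suc m))"
    using concat_blocks_start[of "Suc m"] block_start_ge_1[of "Suc m"] by (simp add: s)
  moreover have "\<Sum>(int ` block x R (Suc m)) = int (\<Sum>(block x R (Suc m)))"
    by (subst sum.reindex) auto
  ultimately show ?thesis unfolding s by linarith
qed

text \<open>If the preceding block sums to at least c times the next start, that start makes up at
  most 1/(1 + c) of the partial sum ending with it.\<close>

lemma positive_density_if_block_sums:
  assumes c: "0 < c" and ev: "\<forall>\<^sub>F m in sequentially.
    c * of_int (block_start x R (Suc (Suc m))) \<le> (\<Sum>n\<in>block x R (Suc m). real n)"
  shows "positive_density x"
proof -
  let ?r = "\<lambda>m. real (concat_blocks x R (block_start_pos x R m)) / real (concat_sum x R (block_start_pos x R m))"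
  have "\<forall>\<^sub>F m in sequentially. ereal (?r (Suc (Suc m))) \<le> ereal (1 / (1 + c))"
    using ev
  proof eventually_elim
    case (elim m)
    let ?s = "real_of_int (block_start x R (Suc (Suc m)))"
    have s: "real (concat_blocks x R (block_start_pos x R (Suc (Suc m)))) = ?s" "1 \<le> ?s"
      using concat_blocks_start[of "Suc m"] block_start_ge_1[of "Suc m"] by simp_all
    have "\<Sum>(int ` block x R (Suc m)) = int (\<Sum>(block x R (Suc m)))"
      by (subst sum.reindex) auto
    then have "block_start x R (Suc (Suc m)) + int (\<Sum>(block x R (Suc m)))
        \<le> int (concat_sum x R (block_start_pos x R (Suc (Suc m))))"
      using concat_sum_ge[of m] by simp
    then have "?s + (\<Sum>n\<in>block x R (Suc m). real n) \<le> real (concat_sum x R (block_start_pos x R (Suc (Suc m))))"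
      by (simp flip: of_nat_sum)
    then have *: "(1 + c) * ?s \<le> real (concat_sum x R (block_start_pos x R (Suc (Suc m))))"
      using elim by (simp add: algebra_simps)
    have "?s / real (concat_sum x R (block_start_pos x R (Suc (Suc m)))) \<le> ?s / ((1 + c) * ?s)"
      using * s c by (intro divide_left_mono) (auto intro!: mult_pos_pos intro: less_le_trans[OF _ *])
    also have "\<dots> = 1 / (1 + c)" using s c by simp
    finally show ?case unfolding s by simp
  qed
  then have "\<forall>\<^sub>F m in sequentially. ereal (?r m) \<le> ereal (1 / (1 + c))"
    using eventually_sequentially_seg[of "\<lambda>m. ereal (?r m) \<le> ereal (1 / (1 + c))" 2] by simp
  then have "limsup (\<lambda>m. ereal (?r m)) \<le> ereal (1 / (1 + c))" by (rule Limsup_bounded)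
  also have "\<dots> < 1" using c by simp
  finally show ?thesis unfolding positive_density_def using R by blast
qed

section \<open>Lower bounds for block sums and the two criteria\<close>

text \<open>The block starts at or below half of its last element v, so it contains the integers
  from about v/2 to v: at least v/2 terms, each at least v/2.\<close>

lemma block_sum_long:
  assumes "2 * den (Suc (Suc (large_pos m))) \<le> den (Suc (large_pos (Suc m)))"
  shows "(of_int (den (Suc (large_pos (Suc m)))))\<^sup>2 / 4 \<le> (\<Sum>n\<in>block x R (Suc (Suc m)). real n)"
proof -
  define v where "v = nat (den (Suc (large_pos (Suc m))))"
  define u where "u = v - v div 2"
  have v: "int v = den (Suc (large_pos (Suc m)))" using den_pos[of "large_pos (Suc m)"] by (simp add: v_def)
  have "block_start x R (Suc (Suc m)) \<le> den (Suc (Suc (large_pos m)))"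
    using R den_pos[of "large_pos m"] by (simp add: block_start_simps(2) del: continuant'.simps)
  then have "2 * block_start x R (Suc (Suc m)) \<le> int v" using assms v by linarith
  then have "block_start x R (Suc (Suc m)) \<le> int u" unfolding u_def by linarith
  then have "{u..v} \<subseteq> block x R (Suc (Suc m))"
    unfolding block_Suc using v by (auto simp del: continuant'.simps)
  then have "(real v - real u + 1) * real u \<le> (\<Sum>n\<in>block x R (Suc (Suc m)). real n)"
    by (intro sum_ge_of_interval finite_block)
  moreover have "real v / 2 * (real v / 2) \<le> (real v - real u + 1) * real u"
  proof (intro mult_mono)
    show "real v / 2 \<le> real v - real u + 1" "real v / 2 \<le> real u" "0 \<le> real v - real u + 1"
      unfolding u_def by linarith+
  qed simp
  ultimately show ?thesis using v by (simp add: power2_eq_square v_def del: continuant'.simps)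
qed

text \<open>Write q, q' for the two continuants in the statement. As R >= 1, the block starts at or
  below q' - q, and it reaches q' because the next large index comes later. The integers from about
  q' - q/2 to q' contribute at least q/2 terms of size at least q'/2.\<close>

lemma block_sum_general:
  "of_int (den (Suc (large_pos m))) * of_int (den (Suc (Suc (large_pos m)))) / 4
    \<le> (\<Sum>n\<in>block x R (Suc (Suc m)). real n)"
proof -
  define v where "v = nat (den (Suc (Suc (large_pos m))))"
  define w where "w = nat (den (Suc (large_pos m)))"
  define u where "u = v - w div 2"
  have v: "int v = den (Suc (Suc (large_pos m)))" using den_pos[of "Suc (large_pos m)"] by (simp add: v_def)
  have w: "int w = den (Suc (large_pos m))" using den_pos[of "large_pos m"] by (simp add: w_def)
  have wv: "w \<le> v" using den_mono[of "Suc (large_pos m)" "Suc (Suc (large_pos m))"] v w by linarith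
  have "1 * int w \<le> R * int w" using R by (intro mult_right_mono) auto
  then have "block_start x R (Suc (Suc m)) \<le> int v - int w"
    using v w by (simp add: block_start_simps(2) del: continuant'.simps)
  then have 1: "block_start x R (Suc (Suc m)) \<le> int u" unfolding u_def using wv by linarith
  have "Suc (large_pos m) \<le> large_pos (Suc m)" using enumerate_step[OF infinite_large, of m] by simp
  then have "den (Suc (Suc (large_pos m))) \<le> den (Suc (large_pos (Suc m)))" by (intro den_mono) simp
  then have "{u..v} \<subseteq> block x R (Suc (Suc m))"
    unfolding block_Suc using v 1 by (auto simp del: continuant'.simps)
  then have "(real v - real u + 1) * real u \<le> (\<Sum>n\<in>block x R (Suc (Suc m)). real n)"
    by (intro sum_ge_of_interval finite_block)
  moreover have "real w / 2 * (real v / 2) \<le> (real v - real u + 1) * real u"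
  proof (intro mult_mono)
    show "real w / 2 \<le> real v - real u + 1" "real v / 2 \<le> real u" unfolding u_def using wv by linarith+
  qed (use wv in \<open>auto simp: u_def\<close>)
  ultimately show ?thesis using v w by (simp add: v_def w_def del: continuant'.simps)
qed

lemma growth_at_large_indices:
  assumes "x \<notin> W1 \<tau>"
  shows "\<forall>\<^sub>F m in sequentially. of_int (den (Suc (Suc (large_pos m)))) < of_int (den (Suc (large_pos m))) powr \<tau>"
proof -
  have "filterlim large_pos at_top sequentially"
    using strict_mono_enumerate[OF infinite_large] by (rule filterlim_subseq)
  then show ?thesis using continuant'_growth[OF x assms] by (rule eventually_compose_filterlim[rotated])
qed

lemma block_start_lt: "block_start x R (Suc (Suc m)) < den (Suc (Suc (large_pos m)))"
  using R den_pos[of "large_pos m"] by (simp add: block_start_simps(2) del: continuant'.simps)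

text \<open>A doubling block ending at Q has sum at least Q^2/4, and x outside \<open>W1 2\<close>
  keeps the next start below Q^2.\<close>

lemma positive_density_of_doubling:
  assumes W: "x \<notin> W1 2" and dbl: "\<forall>\<^sub>F m in sequentially.
    2 * continuant x (large_index x R m + 1) \<le> continuant x (large_index x R (Suc m))"
  shows "positive_density x"
proof -
  have "\<forall>\<^sub>F m in sequentially. 2 * den (Suc (Suc (large_pos m))) \<le> den (Suc (large_pos (Suc m)))"
    using eventually_sequentially_seg[of "\<lambda>m. 2 * continuant x (large_index x R m + 1) \<le> continuant x (large_index x R (Suc m))" 1] dbl
    by (simp add: large_index_simps del: continuant'.simps)
  moreover have "\<forall>\<^sub>F m in sequentially. real_of_int (den (Suc (Suc (large_pos (Suc m))))) < of_int (den (Suc (large_pos (Suc m)))) powr 2"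
    using growth_at_large_indices[OF W] by (subst eventually_sequentially_Suc)
  ultimately have "\<forall>\<^sub>F m in sequentially.
    1 / 4 * of_int (block_start x R (Suc (Suc (Suc m)))) \<le> (\<Sum>n\<in>block x R (Suc (Suc m)). real n)"
  proof eventually_elim
    case (elim m)
    let ?Q = "real_of_int (den (Suc (large_pos (Suc m))))"
    have "real_of_int (block_start x R (Suc (Suc (Suc m)))) < of_int (den (Suc (Suc (large_pos (Suc m)))))"
      using block_start_lt by (simp only: of_int_less_iff)
    also have "\<dots> < ?Q\<^sup>2" using elim(2) den_pos[of "large_pos (Suc m)"] by (simp add: powr_numeral del: continuant'.simps)
    also have "\<dots> \<le> 4 * (\<Sum>n\<in>block x R (Suc (Suc m)). real n)" using block_sum_long[OF elim(1)] by simp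
    finally show ?case by simp
  qed
  then have "\<forall>\<^sub>F m in sequentially.
    1 / 4 * of_int (block_start x R (Suc (Suc m))) \<le> (\<Sum>n\<in>block x R (Suc m). real n)"
    by (subst (asm) eventually_sequentially_Suc)
  then show ?thesis by (rule positive_density_if_block_sums[rotated]) simp
qed

text \<open>A short block still has sum of order \<open>q q'\<close>, where \<open>q\<close> and \<open>q'\<close> are the continuants
  around its start; as \<open>\<phi>(\<phi> - 1) = 1\<close>, the bound \<open>q' < q\<^sup>\<phi>\<close> says \<open>q'\<^sup>\<phi> < q q'\<close>.\<close>

lemma positive_density_of_golden:
  assumes W: "x \<notin> W1 ((1 + sqrt 5) / 2)"
  shows "positive_density x"
proof -
  define \<phi> where "\<phi> = (1 + sqrt 5) / 2"
  have s5: "sqrt 5 * sqrt 5 = (5::real)" by simp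
  have "2 \<le> sqrt 5" by (rule real_le_rsqrt) simp
  moreover have "sqrt 5 \<le> 3" by (rule real_le_lsqrt) auto
  ultimately have phi: "1 \<le> \<phi>" "\<phi> \<le> 2" by (simp_all add: \<phi>_def)
  have gold: "\<phi> * (\<phi> - 1) = 1" using s5 by (simp add: \<phi>_def field_simps)
  have W': "x \<notin> W1 \<phi>" using W by (simp add: \<phi>_def)
  have "\<forall>\<^sub>F m in sequentially. real_of_int (den (Suc (Suc (large_pos (Suc m))))) < of_int (den (Suc (large_pos (Suc m)))) powr \<phi>"
    using growth_at_large_indices[OF W'] by (subst eventually_sequentially_Suc)
  then have "\<forall>\<^sub>F m in sequentially.
    1 / 16 * of_int (block_start x R (Suc (Suc (Suc m)))) \<le> (\<Sum>n\<in>block x R (Suc (Suc m)). real n)"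
    using growth_at_large_indices[OF W']
  proof eventually_elim
    case (elim m)
    define q where "q = real_of_int (den (Suc (large_pos m)))"
    define q' where "q' = real_of_int (den (Suc (Suc (large_pos m))))"
    define Q where "Q = real_of_int (den (Suc (large_pos (Suc m))))"
    have ge1: "1 \<le> q" "1 \<le> q'" "1 \<le> Q"
      unfolding q_def q'_def Q_def using den_pos by (simp_all del: continuant'.simps)
    have start: "real_of_int (block_start x R (Suc (Suc (Suc m)))) < Q powr \<phi>"
    proof -
      have "real_of_int (block_start x R (Suc (Suc (Suc m)))) < of_int (den (Suc (Suc (large_pos (Suc m)))))"
        using block_start_lt by (simp only: of_int_less_iff)
      also have "\<dots> < Q powr \<phi>" using elim(1) by (simp only: Q_def)
      finally show ?thesis .
    qed
    show ?case
    \<comment> \<open>A long block has sum at least Q^2/4, and \<phi> <= 2. For a short one Q < 2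
      q', so Q^\<phi> <= 4 q'^\<phi> <= 4 q q', which is at most 16 times the block sum.\<close>
    proof (cases "2 * q' \<le> Q")
      case True
      then have "2 * den (Suc (Suc (large_pos m))) \<le> den (Suc (large_pos (Suc m)))"
        unfolding q'_def Q_def by linarith
      then have "Q\<^sup>2 / 4 \<le> (\<Sum>n\<in>block x R (Suc (Suc m)). real n)"
        unfolding Q_def by (rule block_sum_long)
      moreover have "Q powr \<phi> \<le> Q powr 2" using ge1 phi by (intro powr_mono) auto
      moreover have "Q powr 2 = Q\<^sup>2" using ge1 by (simp add: powr_numeral)
      moreover have "0 \<le> Q\<^sup>2" by simp
      ultimately show ?thesis using start by linarith
    next
      case False
      have "Q powr \<phi> \<le> (2 * q') powr \<phi>" using False ge1 phi by (intro powr_mono2) auto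
      also have "\<dots> = 2 powr \<phi> * q' powr \<phi>" using ge1 by (simp add: powr_mult)
      also have "\<dots> \<le> 4 * q' powr \<phi>"
      proof (rule mult_right_mono)
        have "2 powr \<phi> \<le> 2 powr (2::real)" using phi by (intro powr_mono) auto
        then show "2 powr \<phi> \<le> 4" by simp
      qed simp
      also have "q' powr \<phi> = q' powr (\<phi> - 1) * q'"
      proof -
        have "q' powr \<phi> = q' powr (\<phi> - 1 + 1)" by simp
        also have "\<dots> = q' powr (\<phi> - 1) * q'" using ge1 by (subst powr_add) simp
        finally show ?thesis .
      qed
      also have "q' powr (\<phi> - 1) \<le> (q powr \<phi>) powr (\<phi> - 1)"
        using elim(2) ge1 phi unfolding q_def q'_def by (intro powr_mono2) auto
      also have "\<dots> = q" using ge1 gold by (simp add: powr_powr)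
      finally have "Q powr \<phi> \<le> 4 * (q * q')" using ge1 by simp
      moreover have "q * q' / 4 \<le> (\<Sum>n\<in>block x R (Suc (Suc m)). real n)"
        unfolding q_def q'_def by (rule block_sum_general)
      ultimately show ?thesis using start by linarith
    qed
  qed
  then have "\<forall>\<^sub>F m in sequentially.
    1 / 16 * of_int (block_start x R (Suc (Suc m))) \<le> (\<Sum>n\<in>block x R (Suc m). real n)"
    by (subst (asm) eventually_sequentially_Suc)
  then show ?thesis by (rule positive_density_if_block_sums[rotated]) simp
qed

end

section \<open>Numbers of prescribed Diophantine type\<close>

text \<open>Indices are shifted as in \<open>continuant'\<close>: \<open>cf_num a n / cf_den a n\<close> is the convergent
  \<open>p\<^bsub>n-1\<^esub> / q\<^bsub>n-1\<^esub>\<close> of \<open>[0; a\<^sub>1, a\<^sub>2, \<dots>]\<close>.\<close>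

fun cf_den :: "(nat \<Rightarrow> nat) \<Rightarrow> nat \<Rightarrow> int" where
  "cf_den a 0 = 0"
| "cf_den a (Suc 0) = 1"
| "cf_den a (Suc (Suc n)) = int (a (Suc n)) * cf_den a (Suc n) + cf_den a n"

fun cf_num :: "(nat \<Rightarrow> nat) \<Rightarrow> nat \<Rightarrow> int" where
  "cf_num a 0 = 1"
| "cf_num a (Suc 0) = 0"
| "cf_num a (Suc (Suc n)) = int (a (Suc n)) * cf_num a (Suc n) + cf_num a n"

text \<open>Expresses that x is the value of the continued fraction: strictly alternating errors
  place x between consecutive convergents. Here f n is the absolute error of the convergent with
  index n - 1; f 0 = 1 and f 1 = x.\<close>

definition cf_errors :: "(nat \<Rightarrow> nat) \<Rightarrow> real \<Rightarrow> (nat \<Rightarrow> real) \<Rightarrow> bool" where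
  "cf_errors a x f \<longleftrightarrow> (\<forall>n. 0 < f n \<and>
     of_int (cf_den a n) * x - of_int (cf_num a n) = (-1) ^ Suc n * f n)"

lemma cf_det: "cf_num a (Suc n) * cf_den a n - cf_num a n * cf_den a (Suc n) = (-1) ^ Suc n"
  by (induction n) (simp_all add: algebra_simps)

context
  fixes a :: "nat \<Rightarrow> nat"
  assumes a: "\<And>n. 1 \<le> a (Suc n)"
begin

lemma cf_den_ge: "0 \<le> cf_den a n \<and> 1 \<le> cf_den a (Suc n)"
proof (induction n)
  case (Suc n)
  have "1 * cf_den a (Suc n) \<le> int (a (Suc n)) * cf_den a (Suc n)"
    using Suc a[of n] by (intro mult_right_mono) auto
  then show ?case unfolding cf_den.simps using Suc by linarith
qed simp

lemma cf_den_step: "cf_den a (Suc n) + cf_den a n \<le> cf_den a (Suc (Suc n))"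
proof -
  have "1 * cf_den a (Suc n) \<le> int (a (Suc n)) * cf_den a (Suc n)"
    using cf_den_ge[of n] a[of n] by (intro mult_right_mono) auto
  then show ?thesis by simp
qed

lemma cf_den_mono: "cf_den a n \<le> cf_den a (Suc n)"
proof (cases n)
  case (Suc m)
  then show ?thesis using cf_den_step[of m] cf_den_ge[of m] by (simp only:) linarith
qed simp

lemma cf_den_linear: "int n + 1 \<le> cf_den a (Suc (Suc n))"
proof (induction n)
  case 0
  then show ?case using cf_den_step[of 0] by simp
next
  case (Suc n)
  then show ?case using cf_den_step[of "Suc n"] cf_den_ge[of n] by (simp del: cf_den.simps(3))
qed

text \<open>x is the alternating series of the terms 1/(q_k q_{k+1}), whose partial sums are the
  convergents by the determinant identity; Leibniz's criterion brackets x between them.\<close>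

lemma cf_exists: "\<exists>x f. cf_errors a x f"
proof -
  define t where "t k = 1 / real_of_int (cf_den a (Suc k) * cf_den a (Suc (Suc k)))" for k
  have pos: "0 < real_of_int (cf_den a (Suc k))" for k using cf_den_ge[of k] by linarith
  have tpos: "0 < t k" for k unfolding t_def of_int_mult by (intro divide_pos_pos mult_pos_pos pos) simp
  have tdec: "t (Suc k) < t k" for k
  proof -
    have "cf_den a (Suc k) < cf_den a (Suc (Suc (Suc k)))"
      using cf_den_step[of "Suc k"] cf_den_ge[of "Suc k"] by linarith
    then have "real_of_int (cf_den a (Suc k)) < real_of_int (cf_den a (Suc (Suc (Suc k))))"
      by (simp only: of_int_less_iff)
    then have "real_of_int (cf_den a (Suc k)) * real_of_int (cf_den a (Suc (Suc k)))
      < real_of_int (cf_den a (Suc (Suc k))) * real_of_int (cf_den a (Suc (Suc (Suc k))))"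
      using pos[of "Suc k"] by (simp add: mult.commute del: cf_den.simps)
    then show ?thesis unfolding t_def of_int_mult
      by (rule divide_strict_left_mono) (simp, intro mult_pos_pos pos)
  qed
  have tlim: "t \<longlonglongrightarrow> 0"
  proof (rule tendsto_sandwich)
    show "\<forall>\<^sub>F k in sequentially. t k \<le> 1 / real (Suc k)"
    proof (rule always_eventually, rule allI)
      fix k
      have "1 * (real k + 1) \<le> real_of_int (cf_den a (Suc k)) * real_of_int (cf_den a (Suc (Suc k)))"
      proof (rule mult_mono)
        show "1 \<le> real_of_int (cf_den a (Suc k))" using cf_den_ge[of k] by linarith
        show "real k + 1 \<le> real_of_int (cf_den a (Suc (Suc k)))" using cf_den_linear[of k] by linarith
      qed (use pos[of k] in auto)
      then show "t k \<le> 1 / real (Suc k)"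
        unfolding t_def of_int_mult by (intro divide_left_mono) (auto simp del: cf_den.simps)
    qed
    show "\<forall>\<^sub>F k in sequentially. 0 \<le> t k" using tpos by (intro always_eventually) (auto intro: less_imp_le)
    show "(\<lambda>k. 1 / real (Suc k)) \<longlonglongrightarrow> 0" by (rule LIMSEQ_Suc[OF lim_1_over_n])
  qed auto
  have partial: "(\<Sum>k<n. (-1) ^ k * t k) = real_of_int (cf_num a (Suc n)) / real_of_int (cf_den a (Suc n))" for n
  proof (induction n)
    case (Suc n)
    have "real_of_int (cf_num a (Suc (Suc n)) * cf_den a (Suc n) - cf_num a (Suc n) * cf_den a (Suc (Suc n)))
      = (-1) ^ n" unfolding cf_det by simp
    then have "(-1) ^ n * t n = real_of_int (cf_num a (Suc (Suc n))) / real_of_int (cf_den a (Suc (Suc n)))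
        - real_of_int (cf_num a (Suc n)) / real_of_int (cf_den a (Suc n))"
      unfolding t_def using pos[of n] pos[of "Suc n"] by (simp add: field_simps del: cf_den.simps cf_num.simps)
    then show ?case using Suc by simp
  qed simp
  define x where "x = (\<Sum>k. (-1) ^ k * t k)"
  note L = summable_Leibniz'[of t, OF tlim less_imp_le[OF tpos] less_imp_le[OF tdec], folded x_def]
  have odd: "real_of_int (cf_num a (Suc (2 * j))) < real_of_int (cf_den a (Suc (2 * j))) * x" for j
  proof -
    \<comment> \<open>Leibniz's criterion gives only weak inequalities; moving on to the next
      partial sum of the same parity makes them strict.\<close>
    have "(\<Sum>k<2 * j. (-1) ^ k * t k) < (\<Sum>k<2 * Suc j. (-1) ^ k * t k)" using tdec[of "2 * j"] by simp
    also have "\<dots> \<le> x" by (rule L(2))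
    finally show ?thesis unfolding partial using pos[of "2 * j"] by (simp add: field_simps del: cf_den.simps cf_num.simps)
  qed
  have even: "real_of_int (cf_den a (Suc (Suc (2 * j)))) * x < real_of_int (cf_num a (Suc (Suc (2 * j))))" for j
  proof -
    have "x \<le> (\<Sum>k<2 * Suc j + 1. (-1) ^ k * t k)" by (rule L(4))
    also have "\<dots> < (\<Sum>k<Suc (2 * j). (-1) ^ k * t k)" using tdec[of "Suc (2 * j)"] by simp
    finally show ?thesis unfolding partial using pos[of "Suc (2 * j)"] by (simp add: field_simps del: cf_den.simps cf_num.simps)
  qed
  define f where "f n = (-1) ^ Suc n * (real_of_int (cf_den a n) * x - real_of_int (cf_num a n))" for n
  have "0 < f n" for n
  proof (cases n)
    case (Suc m)
    show ?thesis
    proof (cases "even m")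
      case True
      then obtain j where "m = 2 * j" by (auto elim: evenE)
      then show ?thesis unfolding f_def Suc using odd[of j] by (simp del: cf_den.simps cf_num.simps)
    next
      case False
      then obtain j where "m = Suc (2 * j)" by (auto elim: oddE)
      then show ?thesis unfolding f_def Suc using even[of j] by (simp del: cf_den.simps cf_num.simps)
    qed
  qed (simp add: f_def)
  moreover have "real_of_int (cf_den a n) * x - real_of_int (cf_num a n) = (-1) ^ Suc n * f n" for n
  proof -
    have "(-1) ^ Suc n * f n = ((-1) ^ Suc n * (-1) ^ Suc n) * (real_of_int (cf_den a n) * x - real_of_int (cf_num a n))"
      unfolding f_def by (simp only: mult.assoc)
    also have "(-1) ^ Suc n * (-1) ^ Suc n = (1::real)" by (simp flip: power_mult_distrib)
    finally show ?thesis by simp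
  qed
  ultimately show ?thesis unfolding cf_errors_def by blast
qed

context
  fixes x :: real and f :: "nat \<Rightarrow> real"
  assumes cf: "cf_errors a x f"
begin

lemma cf_pos: "0 < f n"
  using cf by (simp add: cf_errors_def)

lemma cf_eq: "of_int (cf_den a n) * x - of_int (cf_num a n) = (-1) ^ Suc n * f n"
  using cf by (simp add: cf_errors_def)

lemma cf_abs: "\<bar>of_int (cf_den a n) * x - of_int (cf_num a n)\<bar> = f n"
  unfolding cf_eq using cf_pos[of n] by (simp add: abs_mult)

lemma cf_rec: "f n = real (a (Suc n)) * f (Suc n) + f (Suc (Suc n))"
proof -
  have "(-1) ^ Suc (Suc (Suc n)) * f (Suc (Suc n)) = of_int (cf_den a (Suc (Suc n))) * x - of_int (cf_num a (Suc (Suc n)))"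
    by (rule cf_eq[symmetric])
  also have "\<dots> = real (a (Suc n)) * (of_int (cf_den a (Suc n)) * x - of_int (cf_num a (Suc n)))
      + (of_int (cf_den a n) * x - of_int (cf_num a n))"
    by (simp add: algebra_simps)
  also have "\<dots> = (-1) ^ Suc n * (f n - real (a (Suc n)) * f (Suc n))"
    unfolding cf_eq by (simp add: algebra_simps)
  finally have "(-1) ^ Suc n * f (Suc (Suc n)) = (-1) ^ Suc n * (f n - real (a (Suc n)) * f (Suc n))" by simp
  then have "f (Suc (Suc n)) = f n - real (a (Suc n)) * f (Suc n)"
    by (subst (asm) mult_cancel_left) simp
  then show ?thesis by simp
qed

lemma cf_decreasing: "f (Suc (Suc n)) < f (Suc n)"
proof -
  have "1 * f (Suc (Suc n)) \<le> real (a (Suc (Suc n))) * f (Suc (Suc n))"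
    using a[of "Suc n"] cf_pos[of "Suc (Suc n)"] by (intro mult_right_mono) auto
  then show ?thesis using cf_rec[of "Suc n"] cf_pos[of "Suc (Suc (Suc n))"] by linarith
qed

lemma cf_unit: "of_int (cf_den a (Suc n)) * f n + of_int (cf_den a n) * f (Suc n) = 1"
proof (induction n)
  case 0
  show ?case using cf_eq[of 0] by simp
next
  case (Suc n)
  have "of_int (cf_den a (Suc (Suc n))) * f (Suc n) + of_int (cf_den a (Suc n)) * f (Suc (Suc n))
    = of_int (cf_den a (Suc n)) * (real (a (Suc n)) * f (Suc n) + f (Suc (Suc n)))
      + of_int (cf_den a n) * f (Suc n)"
    by (simp add: algebra_simps)
  also have "\<dots> = 1" unfolding cf_rec[symmetric] by (rule Suc)
  finally show ?case .
qed

lemma cf_upper: "f (Suc n) < 1 / of_int (cf_den a (Suc (Suc n)))"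
proof -
  have pos: "0 < real_of_int (cf_den a (Suc k))" for k using cf_den_ge[of k] by linarith
  have "0 < of_int (cf_den a (Suc n)) * f (Suc (Suc n))" using pos cf_pos by simp
  then have "of_int (cf_den a (Suc (Suc n))) * f (Suc n) < 1" using cf_unit[of "Suc n"] by linarith
  then show ?thesis using pos[of "Suc n"] by (simp add: field_simps del: cf_den.simps)
qed

lemma cf_lower: "1 / (2 * of_int (cf_den a (Suc (Suc n)))) \<le> f (Suc n)"
proof -
  have pos: "0 < real_of_int (cf_den a (Suc k))" for k using cf_den_ge[of k] by linarith
  have "of_int (cf_den a (Suc n)) * f (Suc (Suc n)) \<le> of_int (cf_den a (Suc (Suc n))) * f (Suc n)"
    using pos[of n] cf_pos[of "Suc (Suc n)"] cf_decreasing[of n] pos[of "Suc n"] cf_den_mono[of "Suc n"]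
    by (intro mult_mono) (auto simp del: cf_den.simps)
  then have "1 \<le> 2 * (of_int (cf_den a (Suc (Suc n))) * f (Suc n))" using cf_unit[of "Suc n"] by linarith
  then show ?thesis using pos[of "Suc n"] by (simp add: field_simps del: cf_den.simps)
qed

text \<open>As the determinant is 1 or -1, (q, p) is an integer combination, with coefficients u and
  v, of two consecutive convergent vectors. The size of q prevents u and v from having the same
  sign, and consecutive errors have opposite signs, so the two contributions add up instead of
  cancelling.\<close>

lemma cf_best_approximation:
  assumes q: "1 \<le> q" "q < cf_den a (Suc n)"
  shows "f n \<le> \<bar>of_int q * x - of_int p\<bar>"
proof -
  define s :: int where "s = (-1) ^ Suc n"
  define u where "u = s * (q * cf_num a (Suc n) - p * cf_den a (Suc n))"
  define v where "v = s * (p * cf_den a n - q * cf_num a n)"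
  have s2: "s * s = 1" by (simp add: s_def flip: power_mult_distrib)
  have det: "cf_num a (Suc n) * cf_den a n - cf_num a n * cf_den a (Suc n) = s"
    unfolding s_def by (rule cf_det)
  have qe: "q = u * cf_den a n + v * cf_den a (Suc n)"
  proof -
    have "u * cf_den a n + v * cf_den a (Suc n)
      = s * q * (cf_num a (Suc n) * cf_den a n - cf_num a n * cf_den a (Suc n))"
      unfolding u_def v_def by (simp add: algebra_simps del: cf_den.simps cf_num.simps)
    also have "\<dots> = q * (s * s)" unfolding det by simp
    finally show ?thesis by (simp add: s2)
  qed
  have pe: "p = u * cf_num a n + v * cf_num a (Suc n)"
  proof -
    have "u * cf_num a n + v * cf_num a (Suc n)
      = s * p * (cf_num a (Suc n) * cf_den a n - cf_num a n * cf_den a (Suc n))"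
      unfolding u_def v_def by (simp add: algebra_simps del: cf_den.simps cf_num.simps)
    also have "\<dots> = p * (s * s)" unfolding det by simp
    finally show ?thesis by (simp add: s2)
  qed
  have "of_int q * x - of_int p = of_int u * (of_int (cf_den a n) * x - of_int (cf_num a n))
      + of_int v * (of_int (cf_den a (Suc n)) * x - of_int (cf_num a (Suc n)))"
    unfolding qe pe by (simp add: algebra_simps del: cf_den.simps cf_num.simps)
  also have "\<dots> = (-1) ^ Suc n * (of_int u * f n - of_int v * f (Suc n))"
    unfolding cf_eq by (simp add: algebra_simps)
  finally have eq: "\<bar>of_int q * x - of_int p\<bar> = \<bar>of_int u * f n - of_int v * f (Suc n)\<bar>"
    by (simp add: abs_mult)
  have D: "0 \<le> cf_den a n" "1 \<le> cf_den a (Suc n)" using cf_den_ge[of n] by auto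
  consider "v = 0" "1 \<le> u" | "1 \<le> v" "u \<le> -1" | "v \<le> -1" "1 \<le> u"
  proof -
    have "0 < u" if "v \<le> 0"
    proof (rule ccontr)
      assume "\<not> 0 < u"
      then have "u * cf_den a n \<le> 0" "v * cf_den a (Suc n) \<le> 0"
        using D that by (auto intro: mult_nonpos_nonneg simp del: cf_den.simps)
      then show False using qe q by linarith
    qed
    moreover have "u < 0" if "1 \<le> v"
    proof (rule ccontr)
      assume "\<not> u < 0"
      then have "0 \<le> u * cf_den a n" using D by (simp del: cf_den.simps)
      moreover have "1 * cf_den a (Suc n) \<le> v * cf_den a (Suc n)" using D that by (intro mult_right_mono) auto
      ultimately show False using qe q by linarith
    qed
    ultimately show ?thesis using that by linarith
  qed
  then have "f n \<le> \<bar>of_int u * f n - of_int v * f (Suc n)\<bar>"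
  proof cases
    case 1
    have "1 * f n \<le> of_int u * f n" using 1 cf_pos[of n] by (intro mult_right_mono) auto
    then show ?thesis using 1 by simp
  next
    case 2
    have "1 * f n \<le> of_int (- u) * f n" using 2 cf_pos[of n] by (intro mult_right_mono) linarith+
    moreover have "0 \<le> of_int v * f (Suc n)" using 2 cf_pos[of "Suc n"] by simp
    ultimately show ?thesis by simp
  next
    case 3
    have "1 * f n \<le> of_int u * f n" using 3 cf_pos[of n] by (intro mult_right_mono) linarith+
    moreover have "of_int v * f (Suc n) \<le> 0" using 3 cf_pos[of "Suc n"] by (simp add: mult_nonpos_nonneg)
    ultimately show ?thesis by linarith
  qed
  then show ?thesis using eq by simp
qed

lemma cf_in_W1:
  assumes "\<forall>\<^sub>F n in sequentially. of_int (cf_den a (Suc n)) powr \<tau> \<le> of_int (cf_den a (Suc (Suc n)))"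
  shows "x \<in> W1 \<tau>"
proof (rule W1_I)
  obtain M where M: "\<And>n. M \<le> n \<Longrightarrow> of_int (cf_den a (Suc n)) powr \<tau> \<le> of_int (cf_den a (Suc (Suc n)))"
    using assms unfolding eventually_sequentially by blast
  let ?S = "{q::nat. 1 \<le> q \<and> (\<exists>p::int. \<bar>real q * x - of_int p\<bar> < real q powr - \<tau>)}"
  show "infinite ?S"
    unfolding infinite_nat_iff_unbounded_le
  proof
    fix m
    define n where "n = max M m"
    define q where "q = nat (cf_den a (Suc (Suc n)))"
    have q: "int q = cf_den a (Suc (Suc n))" "1 \<le> q" "m \<le> q"
      using cf_den_linear[of n] unfolding q_def n_def by linarith+
    have q': "real q = of_int (cf_den a (Suc (Suc n)))" using q(1) by linarith
    have "\<bar>real q * x - of_int (cf_num a (Suc (Suc n)))\<bar> = f (Suc (Suc n))" unfolding q' by (rule cf_abs)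
    also have "\<dots> < 1 / of_int (cf_den a (Suc (Suc (Suc n))))" by (rule cf_upper)
    also have "\<dots> \<le> 1 / (real q powr \<tau>)"
    proof (intro divide_left_mono)
      show "real q powr \<tau> \<le> of_int (cf_den a (Suc (Suc (Suc n))))"
        unfolding q' by (rule M) (simp add: n_def)
      have "0 < real_of_int (cf_den a (Suc (Suc (Suc n))))" using cf_den_ge[of "Suc (Suc n)"] by linarith
      then show "0 < of_int (cf_den a (Suc (Suc (Suc n)))) * real q powr \<tau>" using q(2) by simp
    qed simp
    also have "\<dots> = real q powr - \<tau>" by (simp add: powr_minus_divide)
    finally have "q \<in> ?S" using q(2) by blast
    then show "\<exists>q\<ge>m. q \<in> ?S" using q(3) by blast
  qed
qed

text \<open>Place q between consecutive denominators q_n <= q < q_{n+1}. Best approximation bounds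
  its error below by 1/(2 q_{n+1}), hence by 1/(8 q^\<sigma>), which for \<tau> > \<sigma> is
  compatible with q^(-\<tau>) only for bounded q.\<close>

lemma cf_notin_W1:
  assumes le: "\<And>n. of_int (cf_den a (Suc (Suc n))) \<le> 4 * of_int (cf_den a (Suc n)) powr \<sigma>"
    and s: "0 \<le> \<sigma>" "\<sigma> < \<tau>"
  shows "x \<notin> W1 \<tau>"
proof
  assume "x \<in> W1 \<tau>"
  then have inf: "infinite {(p, q). p \<in> {1..1::nat} \<rightarrow>\<^sub>E (UNIV :: int set) \<and> 1 \<le> q \<and>
       (MAX i\<in>{1..1::nat}. \<bar>real q * (\<lambda>i\<in>{1}. x) i - real_of_int (p i)\<bar>) < real q powr (- \<tau>)}"
      (is "infinite ?S")
    by (simp add: W1_def W_def)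
  \<comment> \<open>A solution has q^(\<tau> - \<sigma>) < 8, where the factor 2 is from
    \<open>cf_lower\<close> and the factor 4 from \<open>le\<close>. C bounds its numerator, since
    the error is below 1.\<close>
  define B where "B = nat \<lceil>8 powr (1 / (\<tau> - \<sigma>))\<rceil>"
  define C where "C = \<lceil>real B * \<bar>x\<bar> + 1\<rceil>"
  have "?S \<subseteq> ({1..1::nat} \<rightarrow>\<^sub>E {- C..C}) \<times> {1..B}"
  proof (rule subsetI)
    fix z assume "z \<in> ?S"
    then obtain p q where z: "z = (p, q)" "p \<in> {1..1::nat} \<rightarrow>\<^sub>E UNIV" "1 \<le> q" and
      close: "\<bar>real q * x - real_of_int (p 1)\<bar> < real q powr (- \<tau>)"
      by auto
    define n where "n = (LEAST n. int q < cf_den a (Suc (Suc n)))"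
    have "\<exists>n. int q < cf_den a (Suc (Suc n))" using cf_den_linear[of q] by (intro exI[of _ q]) linarith
    then have n1: "int q < cf_den a (Suc (Suc n))" unfolding n_def by (rule LeastI_ex)
    have n2: "cf_den a (Suc n) \<le> int q"
    proof (cases n)
      case (Suc m)
      have "\<not> int q < cf_den a (Suc (Suc m))" by (rule not_less_Least) (use Suc n_def in simp)
      then show ?thesis using Suc by simp
    qed (use z in simp)
    have qpos: "0 < real q" using z by simp
    have dpos: "0 < real_of_int (cf_den a (Suc k))" for k using cf_den_ge[of k] by linarith
    have n2': "real_of_int (cf_den a (Suc n)) \<le> real q" using n2 by linarith
    have "real_of_int (cf_den a (Suc (Suc n))) \<le> 4 * real q powr \<sigma>"
    proof -
      have "of_int (cf_den a (Suc n)) powr \<sigma> \<le> real q powr \<sigma>"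
        using n2' dpos[of n] s by (intro powr_mono2) auto
      then show ?thesis using le[of n] by linarith
    qed
    then have "1 / (8 * real q powr \<sigma>) \<le> 1 / (2 * of_int (cf_den a (Suc (Suc n))))"
      using dpos[of "Suc n"] qpos by (intro divide_left_mono) (auto simp del: cf_den.simps)
    also have "\<dots> \<le> f (Suc n)" by (rule cf_lower)
    also have "\<dots> \<le> \<bar>of_int (int q) * x - of_int (p 1)\<bar>"
      using z n1 by (intro cf_best_approximation) auto
    also have "\<dots> < real q powr (- \<tau>)" using close by simp
    finally have "real q powr (\<tau> - \<sigma>) < 8"
      using qpos by (simp add: powr_minus powr_diff field_simps)
    then have "(real q powr (\<tau> - \<sigma>)) powr (1 / (\<tau> - \<sigma>)) < 8 powr (1 / (\<tau> - \<sigma>))"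
      using s qpos by (intro powr_less_mono2) auto
    then have "real q < 8 powr (1 / (\<tau> - \<sigma>))" using s qpos by (simp add: powr_powr)
    then have qB: "q \<le> B" unfolding B_def by linarith
    have "real q powr (- \<tau>) \<le> 1" using z s by (simp add: powr_minus_divide ge_one_powr_ge_zero)
    moreover have "\<bar>real q * x\<bar> = real q * \<bar>x\<bar>" by (simp add: abs_mult)
    ultimately have "\<bar>real_of_int (p 1)\<bar> \<le> real q * \<bar>x\<bar> + 1" using close by linarith
    also have "\<dots> \<le> real B * \<bar>x\<bar> + 1" using qB by (simp add: mult_right_mono)
    finally have "\<bar>p 1\<bar> \<le> C" unfolding C_def by linarith
    then show "z \<in> ({1..1::nat} \<rightarrow>\<^sub>E {- C..C}) \<times> {1..B}" using z qB by (auto simp: PiE_iff)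
  qed
  then have "finite ?S" by (rule finite_subset) (auto intro!: finite_PiE)
  then show False using inf by simp
qed

end

end

text \<open>If the earlier quotients agree, so do the convergents and the errors f n and f (n+1).
  The recurrence f n = a f (n+1) + f (n+2) with 0 < f (n+2) < f (n+1) then determines the integer
  a.\<close>

lemma cf_unique:
  assumes a: "\<And>n. 1 \<le> a (Suc n)" and b: "\<And>n. 1 \<le> b (Suc n)"
    and f: "cf_errors a x f" and g: "cf_errors b x g"
  shows "a (Suc n) = b (Suc n)"
proof (induction n rule: less_induct)
  case (less n)
  have agree: "cf_den a k = cf_den b k \<and> cf_num a k = cf_num b k" if "k \<le> Suc n" for k
    using that
  proof (induction k rule: less_induct)
    case (less k)
    consider "k = 0" | "k = Suc 0" | j where "k = Suc (Suc j)" by (metis not0_implies_Suc)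
    then show ?case
    proof cases
      case 3
      then show ?thesis using less.IH[of j] less.IH[of "Suc j"] less.prems \<open>\<And>m. m < n \<Longrightarrow> a (Suc m) = b (Suc m)\<close>[of j] by simp
    qed auto
  qed
  have eq: "f k = g k" if "k \<le> Suc n" for k
    using cf_abs[OF a f, of k] cf_abs[OF b g, of k] agree[OF that] by simp
  have "real (a (Suc n)) * f (Suc n) + f (Suc (Suc n)) = real (b (Suc n)) * f (Suc n) + g (Suc (Suc n))"
    using cf_rec[OF a f, of n] cf_rec[OF b g, of n] eq[of n] eq[of "Suc n"] by simp
  then have "\<bar>real (a (Suc n)) - real (b (Suc n))\<bar> * f (Suc n) = \<bar>g (Suc (Suc n)) - f (Suc (Suc n))\<bar>"
  proof -
    assume "real (a (Suc n)) * f (Suc n) + f (Suc (Suc n)) = real (b (Suc n)) * f (Suc n) + g (Suc (Suc n))"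
    then have "(real (a (Suc n)) - real (b (Suc n))) * f (Suc n) = g (Suc (Suc n)) - f (Suc (Suc n))"
      by (simp add: algebra_simps)
    then have "\<bar>(real (a (Suc n)) - real (b (Suc n))) * f (Suc n)\<bar> = \<bar>g (Suc (Suc n)) - f (Suc (Suc n))\<bar>"
      by (simp only:)
    then show ?thesis using cf_pos[OF a f, of "Suc n"] by (simp add: abs_mult)
  qed
  also have "\<dots> < 1 * f (Suc n)"
    using cf_pos[OF a f, of "Suc (Suc n)"] cf_pos[OF b g, of "Suc (Suc n)"]
      cf_decreasing[OF a f, of n] cf_decreasing[OF b g, of n] eq[of "Suc n"] by simp
  finally have "\<bar>real (a (Suc n)) - real (b (Suc n))\<bar> < 1"
    using cf_pos[OF a f, of "Suc n"] by (simp only: mult_less_cancel_right_pos)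
  then show ?case by linarith
qed

text \<open>The quotient following the denominator \<open>q\<^sub>n\<close> is the least integer above a given power
  \<open>q\<^sub>n\<^bsup>s(n)\<^esup>\<close>, or one more. The choice, made by membership in \<open>\<beta>\<close>, does not affect the type but
  yields uncountably many numbers.\<close>

primrec den_pair :: "(nat \<Rightarrow> real) \<Rightarrow> nat set \<Rightarrow> nat \<Rightarrow> nat \<times> nat" where
  "den_pair s \<beta> 0 = (0, 1)"
| "den_pair s \<beta> (Suc n) = (snd (den_pair s \<beta> n),
     (nat \<lceil>real (snd (den_pair s \<beta> n)) powr s n\<rceil> + of_bool (n \<in> \<beta>)) * snd (den_pair s \<beta> n) + fst (den_pair s \<beta> n))"

text \<open>A quotient depends on a denominator that depends on the earlier quotients;
  \<open>den_pair\<close> breaks this circle by carrying two consecutive denominators, and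
  \<open>cf_den_typed\<close> identifies them afterwards. The shift k - 1 is there because quotients
  start at k = 1.\<close>

definition typed_quotients :: "(nat \<Rightarrow> real) \<Rightarrow> nat set \<Rightarrow> nat \<Rightarrow> nat" where
  "typed_quotients s \<beta> k = nat \<lceil>real (snd (den_pair s \<beta> (k - 1))) powr s (k - 1)\<rceil> + of_bool (k - 1 \<in> \<beta>)"

lemma cf_den_typed:
  "cf_den (typed_quotients s \<beta>) n = int (fst (den_pair s \<beta> n)) \<and>
   cf_den (typed_quotients s \<beta>) (Suc n) = int (snd (den_pair s \<beta> n))"
proof (induction n)
  case (Suc n)
  then show ?case by (simp add: typed_quotients_def)
qed simp

lemma den_pair_pos: "1 \<le> snd (den_pair s \<beta> n)"
proof (induction n)
  case (Suc n)
  have "0 < real (snd (den_pair s \<beta> n)) powr s n" using Suc by simp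
  then have "1 \<le> nat \<lceil>real (snd (den_pair s \<beta> n)) powr s n\<rceil>" by linarith
  then have "1 * 1 \<le> (nat \<lceil>real (snd (den_pair s \<beta> n)) powr s n\<rceil> + of_bool (n \<in> \<beta>)) * snd (den_pair s \<beta> n)"
    using Suc by (intro mult_le_mono) auto
  then show ?case by (simp only: den_pair.simps snd_conv)
qed simp

lemma typed_quotients_pos: "1 \<le> typed_quotients s \<beta> (Suc n)"
proof -
  have "0 < real (snd (den_pair s \<beta> n)) powr s n" using den_pair_pos[of s \<beta> n] by simp
  then have "1 \<le> nat \<lceil>real (snd (den_pair s \<beta> n)) powr s n\<rceil>" by linarith
  then show ?thesis by (simp add: typed_quotients_def)
qed

text \<open>The new quotient lies between q^(s n) and q^(s n) + 2, rounding and the free bit adding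
  at most 1 each. The older denominator adds at most q, and 3 q <= 3 q^(s n + 1) gives the
  4.\<close>

lemma cf_den_typed_bounds:
  fixes s :: "nat \<Rightarrow> real" and \<beta> :: "nat set"
  assumes s: "0 \<le> s n"
  defines "q \<equiv> real_of_int (cf_den (typed_quotients s \<beta>) (Suc n))"
  shows "q powr (s n + 1) \<le> of_int (cf_den (typed_quotients s \<beta>) (Suc (Suc n)))"
    and "of_int (cf_den (typed_quotients s \<beta>) (Suc (Suc n))) \<le> 4 * q powr (s n + 1)"
proof -
  let ?a = "typed_quotients s \<beta>"
  note ge = cf_den_ge[where a = ?a, OF typed_quotients_pos, of n]
  have q1: "1 \<le> q" using ge unfolding q_def by linarith
  have q: "q = real (snd (den_pair s \<beta> n))" unfolding q_def using cf_den_typed[of s \<beta> n] by simp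
  have aq: "real (?a (Suc n)) = real (nat \<lceil>q powr s n\<rceil>) + of_bool (n \<in> \<beta>)"
    by (simp add: typed_quotients_def q)
  have lo: "q powr s n \<le> real (?a (Suc n))" unfolding aq by (simp add: of_nat_nat) linarith
  have hi: "real (?a (Suc n)) \<le> q powr s n + 2" unfolding aq using q1 by (cases "n \<in> \<beta>") (simp; linarith)+
  have d: "real_of_int (cf_den ?a (Suc (Suc n))) = real (?a (Suc n)) * q + of_int (cf_den ?a n)"
    by (simp add: q_def)
  have pw: "q powr (s n + 1) = q powr s n * q" using q1 by (simp add: powr_add)
  have "q powr s n * q \<le> real (?a (Suc n)) * q" using lo q1 by (intro mult_right_mono) auto
  moreover have "0 \<le> real_of_int (cf_den ?a n)" using ge by simp
  ultimately show "q powr (s n + 1) \<le> of_int (cf_den ?a (Suc (Suc n)))" unfolding d pw by linarith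
  have "real (?a (Suc n)) * q \<le> (q powr s n + 2) * q" using hi q1 by (intro mult_right_mono) auto
  moreover have "real_of_int (cf_den ?a n) \<le> q"
    using cf_den_mono[where a = ?a, OF typed_quotients_pos, of n] unfolding q_def by simp
  moreover have "1 * q \<le> q powr s n * q" using q1 s by (intro mult_right_mono) (auto simp: ge_one_powr_ge_zero)
  ultimately show "of_int (cf_den ?a (Suc (Suc n))) \<le> 4 * q powr (s n + 1)"
    unfolding d pw by (simp add: algebra_simps)
qed

text \<open>Equal earlier bits give equal denominators and hence equal ceilings, so the next
  quotient reveals the next bit.\<close>

lemma typed_quotients_inj:
  assumes "\<And>n. typed_quotients s \<beta> (Suc n) = typed_quotients s \<gamma> (Suc n)"
  shows "\<beta> = \<gamma>"
proof -
  have "den_pair s \<beta> n = den_pair s \<gamma> n \<and> (n \<in> \<beta> \<longleftrightarrow> n \<in> \<gamma>)" for n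
  proof (induction n rule: less_induct)
    case (less n)
    have "den_pair s \<beta> n = den_pair s \<gamma> n"
    proof (cases n)
      case (Suc m)
      then show ?thesis using less[of m] by simp
    qed simp
    then show ?case using assms[of n] by (auto simp: typed_quotients_def of_bool_def split: if_splits)
  qed
  then show ?thesis by blast
qed

lemma uncountable_dioph_type:
  fixes \<sigma> :: ereal
  assumes "1 \<le> \<sigma>"
  shows "uncountable {x. dioph_type x = \<sigma>}"
proof -
  \<comment> \<open>Successive denominators satisfy q_{n+1} ~ q_n^(s n + 1) up to a factor 4, so a
    finite type r is produced by the constant exponent r - 1 and infinite type by s n = n.\<close>
  obtain s where s: "\<And>n. 0 \<le> s n" and
    type: "\<And>\<beta> x f. cf_errors (typed_quotients s \<beta>) x f \<Longrightarrow> dioph_type x = \<sigma>"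
  proof (cases \<sigma>)
    case (real r)
    then have r: "1 \<le> r" using assms by simp
    define s where "s = (\<lambda>n::nat. r - 1)"
    have s: "0 \<le> s n" for n using r by (simp add: s_def)
    have "dioph_type x = \<sigma>" if x: "cf_errors (typed_quotients s \<beta>) x f" for \<beta> x f
    proof -
      have "x \<in> W1 r"
      proof (rule cf_in_W1[OF typed_quotients_pos x])
        show "\<forall>\<^sub>F n in sequentially. of_int (cf_den (typed_quotients s \<beta>) (Suc n)) powr r
          \<le> of_int (cf_den (typed_quotients s \<beta>) (Suc (Suc n)))"
          using cf_den_typed_bounds(1)[OF s, where \<beta> = \<beta>] by (intro always_eventually) (simp add: s_def del: cf_den.simps)
      qed
      moreover have notin: "x \<notin> W1 \<tau>" if "r < \<tau>" for \<tau>
        using cf_notin_W1[OF typed_quotients_pos x, where \<sigma> = r and \<tau> = \<tau>] cf_den_typed_bounds(2)[OF s, where \<beta> = \<beta>] r that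
        by (simp add: s_def del: cf_den.simps)
      ultimately have "dioph_type x = ereal r"
        unfolding dioph_type_def
      proof (intro antisym Sup_least Sup_upper)
        fix y assume "y \<in> {ereal \<tau> |\<tau>. 0 < \<tau> \<and> x \<in> W1 \<tau>}"
        then obtain \<tau> where "y = ereal \<tau>" "x \<in> W1 \<tau>" by blast
        then show "y \<le> ereal r" using notin[of \<tau>] by (simp add: linorder_not_less[symmetric]) blast
      qed (use r in \<open>intro CollectI exI[of _ r], simp\<close>)
      then show ?thesis using real by simp
    qed
    then show ?thesis using s that by blast
  next
    case PInf
    define s where "s = (\<lambda>n::nat. real n)"
    have s: "0 \<le> s n" for n by (simp add: s_def)
    have "dioph_type x = \<sigma>" if x: "cf_errors (typed_quotients s \<beta>) x f" for \<beta> x f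
    proof -
      have W: "x \<in> W1 \<tau>" for \<tau>
      proof (rule cf_in_W1[OF typed_quotients_pos x])
        obtain M :: nat where M: "\<tau> \<le> real M" using real_arch_simple by blast
        have "of_int (cf_den (typed_quotients s \<beta>) (Suc n)) powr \<tau>
          \<le> of_int (cf_den (typed_quotients s \<beta>) (Suc (Suc n)))" if "M \<le> n" for n
        proof -
          have "1 \<le> real_of_int (cf_den (typed_quotients s \<beta>) (Suc n))"
            using cf_den_ge[where a = "typed_quotients s \<beta>", OF typed_quotients_pos, of n] by linarith
          then have "real_of_int (cf_den (typed_quotients s \<beta>) (Suc n)) powr \<tau>
            \<le> of_int (cf_den (typed_quotients s \<beta>) (Suc n)) powr (s n + 1)"
            using M that by (intro powr_mono) (auto simp: s_def)
          also have "\<dots> \<le> of_int (cf_den (typed_quotients s \<beta>) (Suc (Suc n)))"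
            by (rule cf_den_typed_bounds(1)[OF s])
          finally show ?thesis .
        qed
        then show "\<forall>\<^sub>F n in sequentially. of_int (cf_den (typed_quotients s \<beta>) (Suc n)) powr \<tau>
          \<le> of_int (cf_den (typed_quotients s \<beta>) (Suc (Suc n)))"
          unfolding eventually_sequentially by blast
      qed
      have "dioph_type x = \<infinity>"
      proof (rule ereal_top)
        fix B
        have "ereal B \<le> ereal (max B 1)" by simp
        also have "\<dots> \<le> dioph_type x"
          unfolding dioph_type_def using W by (intro Sup_upper CollectI exI[of _ "max B 1"]) simp
        finally show "ereal B \<le> dioph_type x" .
      qed
      then show ?thesis using PInf by simp
    qed
    then show ?thesis using s that by blast
  next
    case MInf
    then show ?thesis using assms by simp
  qed
  define \<phi> where "\<phi> \<beta> = (SOME x. \<exists>f. cf_errors (typed_quotients s \<beta>) x f)" for \<beta>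
  have phi: "\<exists>f. cf_errors (typed_quotients s \<beta>) (\<phi> \<beta>) f" for \<beta>
    unfolding \<phi>_def by (rule someI_ex) (rule cf_exists, rule typed_quotients_pos)
  have "inj \<phi>"
  proof (rule injI)
    fix \<beta> \<gamma> assume e: "\<phi> \<beta> = \<phi> \<gamma>"
    obtain f g where "cf_errors (typed_quotients s \<beta>) (\<phi> \<beta>) f" "cf_errors (typed_quotients s \<gamma>) (\<phi> \<beta>) g"
      using phi[of \<beta>] phi[of \<gamma>] e by auto
    then show "\<beta> = \<gamma>" by (intro typed_quotients_inj cf_unique typed_quotients_pos)
  qed
  have sub: "range \<phi> \<subseteq> {x. dioph_type x = \<sigma>}" using phi type by blast
  show ?thesis
  proof
    assume "countable {x. dioph_type x = \<sigma>}"
    then have "countable (range \<phi>)" using sub by (rule countable_subset[rotated])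
    then have "countable (UNIV :: nat set set)" using \<open>inj \<phi>\<close> by (rule countable_image_inj_on)
    then obtain h :: "nat set \<Rightarrow> nat" where "inj h" by (auto simp: countable_def)
    then have "surj (inv h)" by (rule inj_imp_surj_inv)
    then have "inv h ` UNIV = Pow UNIV" by simp
    then show False using Cantors_theorem[of UNIV] by blast
  qed
qed

theorem theorem3:
  fixes d :: nat and \<psi> :: "nat \<Rightarrow> real"
  assumes "2 \<le> d"
    and "\<And>q. 1 \<le> q \<Longrightarrow> 0 \<le> \<psi> q"
    and "antimono_on {1..} \<psi>"
    and "\<not> summable (\<lambda>q. \<psi> q ^ d)"
  shows "(\<forall>x\<in>\<rat>. fibre_full d \<psi> x) \<and>
    (3 \<le> d \<longrightarrow>
      (\<forall>x. x \<notin> \<rat> \<and> positive_density x \<longrightarrow> fibre_full d \<psi> x) \<and>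
      (\<forall>x. x \<notin> \<rat> \<and> x \<notin> W1 ((1 + sqrt 5) / 2) \<longrightarrow> positive_density x) \<and>
      (\<forall>x. x \<notin> \<rat> \<and> x \<notin> W1 2 \<and> doubling x \<longrightarrow> positive_density x) \<and>
      (\<forall>\<sigma>::ereal. 1 \<le> \<sigma> \<longrightarrow> uncountable {x. dioph_type x = \<sigma> \<and> fibre_full d \<psi> x}))"
proof -
  have all: "fibre_full d \<psi> x" if "3 \<le> d" for x
    by (rule fibre_full_all[OF that assms(2-4)])
  have rational: "fibre_full d \<psi> x" if "x \<in> \<rat>" for x
  proof (cases "d = 2")
    case True
    then show ?thesis using fibre_full_rational_plane[OF assms(2,3) _ that] assms(4) by simp
  next
    case False
    then show ?thesis using assms(1) all by simp
  qed
  have golden: "positive_density x" if x: "x \<notin> \<rat>" "x \<notin> W1 ((1 + sqrt 5) / 2)" for x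
  \<comment> \<open>The golden ratio criterion works with any R >= 1, so R = 1 serves as witness; a
    finite list of large indices satisfies the density condition by definition.\<close>
  proof (cases "finite (large_indices x 1)")
    case True
    then show ?thesis unfolding positive_density_def by (intro exI[of _ 1]) simp
  next
    case False
    then show ?thesis using x by (intro positive_density_of_golden[of x 1]) auto
  qed
  have doubled: "positive_density x" if x: "x \<notin> \<rat>" "x \<notin> W1 2" "doubling x" for x
  proof -
    obtain R where R: "1 \<le> R" and "finite (large_indices x R) \<or>
      (\<forall>\<^sub>F m in sequentially.
        2 * continuant x (large_index x R m + 1) \<le> continuant x (large_index x R (Suc m)))"
      using x(3) unfolding doubling_def by blast
    then consider "finite (large_indices x R)" | "infinite (large_indices x R)"
      "\<forall>\<^sub>F m in sequentially.
        2 * continuant x (large_index x R m + 1) \<le> continuant x (large_index x R (Suc m))"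
      by blast
    then show ?thesis
    proof cases
      case 1
      then show ?thesis unfolding positive_density_def using R by blast
    next
      case 2
      then show ?thesis using x(1,2) R by (intro positive_density_of_doubling[of x R])
    qed
  qed
  show ?thesis using all rational golden doubled uncountable_dioph_type by simp
qed

end
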